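(* Consider a general network of beams governed by the intrinsic network system (S) described in the context. Suppose that $R_i\in C^2([0,\ell_i];\mathrm{SO}(3))$ for all $i\in\mathcal I$ and that Assumption 1 (stated in the context) is fulfilled with $m=2$. Then, for any $T>0$, there exists $\varepsilon_0>0$ such that for all $\varepsilon\in(0,\varepsilon_0)$ there is some $\delta>0$ such that the following holds. For all initial data $y_i^0\in C^1([0,\ell_i];\mathbb R^{12})$ ($i\in\mathcal I$) and boundary data $q_n\in C^1([0,T];\mathbb R^6)$ ($n\in\mathcal N$) satisfying $\|y_i^0\|_{C^1_x}+\|q_n\|_{C^1_t}\le\delta$ for all $i\in\mathcal I$, $n\in\mathcal N$, and the first-order compatibility conditions of (S), there exists a unique solution $(y_i)_{i\in\mathcal I}\in\prod_{i=1}^N C^1([0,\ell_i]\times[0,T];\mathbb R^{12})$ to (S), and $\|y_i\|_{C^1_{x,t}}\le\varepsilon$ for all $i\in\mathcal I$.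
   Context: Notation. $\mathbb S_{++}^n$: real symmetric positive definite $n\times n$ matrices. For $u,\zeta\in\mathbb R^3$, $\widehat u\,\zeta=u\times\zeta$ ($\widehat u$ skew-symmetric), and $\mathrm{vec}(\widehat u)=u$. $e_1=(1,0,0)^\intercal$. $C^1_x$, $C^1_t$, $C^1_{x,t}$ denote $C^1$ in space, in time, and in both. Network. $N$ beams indexed by $\mathcal I=\{1,\dots,N\}$ are the edges of an oriented graph with nodes $\mathcal N=\{1,\dots,\#\mathcal N\}$. Edge $i$ is identified with $[0,\ell_i]$, $\ell_i>0$; its endpoints $x=0$ (initial point) and $x=\ell_i$ (ending point) correspond to two (distinct) nodes. For $n\in\mathcal N$: $\mathcal I^n$ is the set of edges incident with $n$, $k_n=\#\mathcal I^n$ its degree, $i^n=\min\mathcal I^n$; for $i\in\mathcal I^n$, $\mathbf x_i^n\in\{0,\ell_i\}$ is the end of $[0,\ell_i]$ corresponding to $n$, and $\tau_i^n=-1$ if $\mathbf x_i^n=0$, $\tau_i^n=+1$ if $\mathbf x_i^n=\ell_i$. $\mathcal N_S$ is the set of simple nodes ($k_n=1$), $\mathcal N_M$ the set of multiple nodes (several incident edges), and $\mathcal N_S=\mathcal N_S^D\cup\mathcal N_S^N$ is a partition. Cycles are allowed. Beam data. For each $i$: mass matrix $\mathbf M_i$ and flexibility matrix $\mathbf C_i$ on $[0,\ell_i]$ with values in $\mathbb S_{++}^6$; $R_i:[0,\ell_i]\to\mathrm{SO}(3)$; $\Upsilon_{c,i}=\mathrm{vec}(R_i^\intercal\frac{\mathrm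 d}{\mathrm dx}R_i)$; $\overline R_i=\mathrm{diag}(R_i,R_i)$; $\mathbf E_i=\begin{bmatrix}\widehat\Upsilon_{c,i}&0\\ \widehat e_1&\widehat\Upsilon_{c,i}\end{bmatrix}$; $Q_i^{\mathcal P}=\mathrm{diag}(\mathbf M_i,\mathbf C_i)$; $$A_i=-(Q_i^{\mathcal P})^{-1}\begin{bmatrix}0&\mathbf I_6\\ \mathbf I_6&0\end{bmatrix},\quad \overline B_i=(Q_i^{\mathcal P})^{-1}\begin{bmatrix}0&-\mathbf E_i\\ \mathbf E_i^\intercal&0\end{bmatrix},\quad \overline g_i(x,u)=Q_i^{\mathcal P}(x)^{-1}\mathcal G(u)Q_i^{\mathcal P}(x)u,$$ where for $u=(u_1^\intercal,u_2^\intercal,u_3^\intercal,u_4^\intercal)^\intercal$, $u_j\in\mathbb R^3$, $$\mathcal G(u)=-\begin{bmatrix}\widehat u_2&0&0&\widehat u_3\\ \widehat u_1&\widehat u_2&\widehat u_3&\widehat u_4\\ 0&0&\widehat u_2&\widehat u_1\\ 0&0&0&\widehat u_2\end{bmatrix}.$$ Assumption 1 (with integer $m\ge1$): for all $i\in\mathcal I$, (1) $\mathbf C_i,\mathbf M_i\in C^m([0,\ell_i];\mathbb S_{++}^6)$; (2) $\Theta_i=(\mathbf C_i^{1/2}\mathbf M_i\mathbf C_i^{1/2})^{-1}$ belongs to $C^m([0,\ell_i];\mathbb S_{++}^6)$ and there exist $U_i,D_i\in C^m([0,\ell_i];\mathbb R^{6\times6})$ with $\Theta_i=U_i^\intercal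 D_i^2U_i$ on $[0,\ell_i]$, $D_i(x)$ positive definite diagonal containing the square roots of the eigenvalues of $\Theta_i(x)$, and $U_i(x)$ unitary. System (S). Unknown $y_i=(v_i^\intercal,z_i^\intercal)^\intercal$, $v_i,z_i\in\mathbb R^6$: - $\partial_ty_i+A_i\partial_xy_i+\overline B_iy_i=\overline g_i(\cdot,y_i)$ in $(0,\ell_i)\times(0,T)$, $i\in\mathcal I$; - $(\overline R_iv_i)(\mathbf x_i^n,t)=(\overline R_{i^n}v_{i^n})(\mathbf x_{i^n}^n,t)$, $i\in\mathcal I^n$, $n\in\mathcal N_M$; - $\sum_{i\in\mathcal I^n}\tau_i^n(\overline R_iz_i)(\mathbf x_i^n,t)=q_n(t)$, $n\in\mathcal N_M$; - $\tau_{i^n}^nz_{i^n}(\mathbf x_{i^n}^n,t)=q_n(t)$, $n\in\mathcal N_S^N$; - $v_{i^n}(\mathbf x_{i^n}^n,t)=q_n(t)$, $n\in\mathcal N_S^D$; - $y_i(x,0)=y_i^0(x)$, $x\in(0,\ell_i)$, $i\in\mathcal I$ (nodal conditions for $t\in(0,T)$). First-order compatibility conditions of (S). Write $y_i^0=((v_i^0)^\intercal,(z_i^0)^\intercal)^\intercal$ and $y_i^1=((v_i^1)^\intercal,(z_i^1)^\intercal)^\intercal:=-A_i\frac{\mathrm dy_i^0}{\mathrm dx}-\overline B_iy_i^0+\overline g_i(\cdot,y_i^0)$. The data satisfy them if $(\overline R_iv_i^0)(\mathbf x_i^n)=(\overline R_jv_j^0)(\mathbf x_j^n)$ ($i,j\in\mathcal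 I^n$, $n\in\mathcal N_M$), $\sum_{i\in\mathcal I^n}\tau_i^n(\overline R_iz_i^0)(\mathbf x_i^n)=q_n(0)$ ($n\in\mathcal N_M$), $\tau_{i^n}^nz_{i^n}^0(\mathbf x_{i^n}^n)=q_n(0)$ ($n\in\mathcal N_S^N$), $v_{i^n}^0(\mathbf x_{i^n}^n)=q_n(0)$ ($n\in\mathcal N_S^D$), and the same identities hold with $v_i^0,z_i^0,q_n(0)$ replaced by $v_i^1,z_i^1,\frac{\mathrm dq_n}{\mathrm dt}(0)$. *)

theory Defs
  imports "HOL-Analysis.Analysis"
begin

section \<open>Vectors and block matrices\<close>

text \<open>Vectors of dimension 6 and 12 are indexed by the types \<open>3 + 3\<close> and \<open>(3 + 3) + (3 + 3)\<close>,
  of cardinality 6 and 12, so that the block structure can be read off the index: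
  \<open>Inl\<close> selects the first half and \<open>Inr\<close> the second.\<close>

type_synonym vec3 = "real^3"
type_synonym vec6 = "real^(3 + 3)"
type_synonym vec12 = "real^((3 + 3) + (3 + 3))"
type_synonym mat3 = "real^3^3"
type_synonym mat6 = "real^(3 + 3)^(3 + 3)"
type_synonym mat12 = "real^((3 + 3) + (3 + 3))^((3 + 3) + (3 + 3))"

definition upper :: "real^('a::finite + 'b::finite) \<Rightarrow> real^'a" where
  "upper u = (\<chi> i. u $ Inl i)"

definition lower :: "real^('a::finite + 'b::finite) \<Rightarrow> real^'b" where
  "lower u = (\<chi> i. u $ Inr i)"

text \<open>\<open>block A B C D\<close> is the matrix with rows of blocks \<open>A B\<close> and \<open>C D\<close>.\<close>

definition block ::
  "real^'a::finite^'c::finite \<Rightarrow> real^'b::finite^'c \<Rightarrow> real^'a^'d::finite \<Rightarrow> real^'b^'d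
     \<Rightarrow> real^('a + 'b)^('c + 'd)" where
  "block A B C D = (\<chi> r c. case r of
      Inl i \<Rightarrow> (case c of Inl j \<Rightarrow> A $ i $ j | Inr j \<Rightarrow> B $ i $ j)
    | Inr i \<Rightarrow> (case c of Inl j \<Rightarrow> C $ i $ j | Inr j \<Rightarrow> D $ i $ j))"

lemma upper_block_mult: "upper (block A B C D *v u) = A *v upper u + B *v lower u"
  and lower_block_mult: "lower (block A B C D *v u) = C *v upper u + D *v lower u"
  by (simp_all add: vec_eq_iff upper_def lower_def block_def matrix_vector_mult_def
        sum.Plus UNIV_Plus_UNIV[symmetric] del: UNIV_Plus_UNIV)

definition hat :: "vec3 \<Rightarrow> mat3" where
  "hat u = matrix (cross3 u)"

text \<open>The left inverse of \<open>hat\<close>, meaningful on skew-symmetric matrices.\<close>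

definition unhat :: "mat3 \<Rightarrow> vec3" where
  "unhat S = vector [S $ 3 $ 2, S $ 1 $ 3, S $ 2 $ 1]"

lemma hat_mult: "hat u *v z = cross3 u z"
  by (simp add: hat_def matrix_def matrix_vector_mult_def cross3_def vec_eq_iff forall_3 sum_3 axis_def)

lemma unhat_hat: "unhat (hat u) = u"
  by (simp add: unhat_def hat_def matrix_def cross3_def vec_eq_iff forall_3 axis_def)

definition SPD :: "(real^'n^'n) set" where
  "SPD = {A. transpose A = A \<and> (\<forall>x. x \<noteq> 0 \<longrightarrow> x \<bullet> (A *v x) > 0)}"

definition spd_sqrt :: "real^'n^'n \<Rightarrow> real^'n^'n" where
  "spd_sqrt A = (THE B. B \<in> SPD \<and> B ** B = A)"

definition SO3 :: "mat3 set" where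
  "SO3 = {R. rotation_matrix R}"

definition eigenvalues :: "real^'n^'n \<Rightarrow> real set" where
  "eigenvalues A = {c. \<exists>x. x \<noteq> 0 \<and> A *v x = c *\<^sub>R x}"

definition diagonal_matrix :: "real^'n^'n \<Rightarrow> bool" where
  "diagonal_matrix A \<longleftrightarrow> (\<forall>i j. i \<noteq> j \<longrightarrow> A $ i $ j = 0)"

section \<open>Functions of class \<open>C^k\<close>\<close>

text \<open>Only the values on the compact interval or rectangle matter; derivatives at its boundary
  are one-sided.\<close>

fun Ck_on :: "nat \<Rightarrow> real set \<Rightarrow> (real \<Rightarrow> 'a::real_normed_vector) \<Rightarrow> bool" where
  "Ck_on 0 S f \<longleftrightarrow> continuous_on S f"
| "Ck_on (Suc k) S f \<longleftrightarrow>
     (\<exists>f'. (\<forall>x\<in>S. (f has_vector_derivative f' x) (at x within S)) \<and> Ck_on k S f')"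

definition Ck :: "nat \<Rightarrow> real set \<Rightarrow> 'a::real_normed_vector set \<Rightarrow> (real \<Rightarrow> 'a) set" where
  "Ck k S B = {f. Ck_on k S f \<and> f ` S \<subseteq> B}"

definition C1_norm :: "real set \<Rightarrow> (real \<Rightarrow> 'a::real_normed_vector) \<Rightarrow> real" where
  "C1_norm S f = (SUP x\<in>S. norm (f x)) + (SUP x\<in>S. norm (vector_derivative f (at x within S)))"

definition partial_x :: "real \<Rightarrow> (real \<times> real \<Rightarrow> 'a::real_normed_vector) \<Rightarrow> real \<times> real \<Rightarrow> 'a" where
  "partial_x l y = (\<lambda>(x, t). vector_derivative (\<lambda>\<xi>. y (\<xi>, t)) (at x within {0..l}))"

definition partial_t :: "real \<Rightarrow> (real \<times> real \<Rightarrow> 'a::real_normed_vector) \<Rightarrow> real \<times> real \<Rightarrow> 'a" where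
  "partial_t T y = (\<lambda>(x, t). vector_derivative (\<lambda>s. y (x, s)) (at t within {0..T}))"

definition C1_xt :: "real \<Rightarrow> real \<Rightarrow> (real \<times> real \<Rightarrow> 'a::real_normed_vector) set" where
  "C1_xt l T = {y. continuous_on ({0..l} \<times> {0..T}) y
     \<and> continuous_on ({0..l} \<times> {0..T}) (partial_x l y)
     \<and> continuous_on ({0..l} \<times> {0..T}) (partial_t T y)
     \<and> (\<forall>x\<in>{0..l}. \<forall>t\<in>{0..T}.
          (\<lambda>\<xi>. y (\<xi>, t)) differentiable (at x within {0..l})
        \<and> (\<lambda>s. y (x, s)) differentiable (at t within {0..T}))}"

definition C1_xt_norm :: "real \<Rightarrow> real \<Rightarrow> (real \<times> real \<Rightarrow> 'a::real_normed_vector) \<Rightarrow> real" where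
  "C1_xt_norm l T y = (SUP p\<in>{0..l} \<times> {0..T}. norm (y p))
     + (SUP p\<in>{0..l} \<times> {0..T}. norm (partial_x l y p))
     + (SUP p\<in>{0..l} \<times> {0..T}. norm (partial_t T y p))"

section \<open>Networks of beams\<close>

record beam_network =
  num_beams :: nat
  num_nodes :: nat
  init_node :: "nat \<Rightarrow> nat"
  end_node :: "nat \<Rightarrow> nat"
  len :: "nat \<Rightarrow> real"
  dirichlet_nodes :: "nat set"
  neumann_nodes :: "nat set"
  mass :: "nat \<Rightarrow> real \<Rightarrow> mat6"
  flex :: "nat \<Rightarrow> real \<Rightarrow> mat6"
  rot :: "nat \<Rightarrow> real \<Rightarrow> mat3"

definition beams :: "beam_network \<Rightarrow> nat set" where
  "beams net = {1..num_beams net}"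

definition nodes :: "beam_network \<Rightarrow> nat set" where
  "nodes net = {1..num_nodes net}"

definition incident :: "beam_network \<Rightarrow> nat \<Rightarrow> nat set" where
  "incident net n = {i \<in> beams net. init_node net i = n \<or> end_node net i = n}"

definition degree :: "beam_network \<Rightarrow> nat \<Rightarrow> nat" where
  "degree net n = card (incident net n)"

definition first_beam :: "beam_network \<Rightarrow> nat \<Rightarrow> nat" where
  "first_beam net n = Min (incident net n)"

definition simple_nodes :: "beam_network \<Rightarrow> nat set" where
  "simple_nodes net = {n \<in> nodes net. degree net n = 1}"

definition multiple_nodes :: "beam_network \<Rightarrow> nat set" where
  "multiple_nodes net = {n \<in> nodes net. degree net n \<ge> 2}"

definition node_pos :: "beam_network \<Rightarrow> nat \<Rightarrow> nat \<Rightarrow> real" where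
  "node_pos net n i = (if init_node net i = n then 0 else len net i)"

definition node_sign :: "beam_network \<Rightarrow> nat \<Rightarrow> nat \<Rightarrow> real" where
  "node_sign net n i = (if init_node net i = n then -1 else 1)"

definition wf_network :: "beam_network \<Rightarrow> bool" where
  "wf_network net \<longleftrightarrow>
     (\<forall>i\<in>beams net. len net i > 0
        \<and> init_node net i \<in> nodes net \<and> end_node net i \<in> nodes net
        \<and> init_node net i \<noteq> end_node net i)
   \<and> simple_nodes net = dirichlet_nodes net \<union> neumann_nodes net
   \<and> dirichlet_nodes net \<inter> neumann_nodes net = {}"

section \<open>Coefficients\<close>

definition Theta :: "beam_network \<Rightarrow> nat \<Rightarrow> real \<Rightarrow> mat6" where
  "Theta net i x =
     matrix_inv (spd_sqrt (flex net i x) ** mass net i x ** spd_sqrt (flex net i x))"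

definition assumption1 :: "nat \<Rightarrow> beam_network \<Rightarrow> bool" where
  "assumption1 m net \<longleftrightarrow> (\<forall>i\<in>beams net.
     flex net i \<in> Ck m {0..len net i} SPD
   \<and> mass net i \<in> Ck m {0..len net i} SPD
   \<and> Theta net i \<in> Ck m {0..len net i} SPD
   \<and> (\<exists>U D. U \<in> Ck m {0..len net i} UNIV \<and> D \<in> Ck m {0..len net i} UNIV
        \<and> (\<forall>x\<in>{0..len net i}.
              Theta net i x = transpose (U x) ** (D x ** D x) ** U x
            \<and> D x \<in> SPD \<and> diagonal_matrix (D x)
            \<and> {D x $ k $ k |k. True} = sqrt ` eigenvalues (Theta net i x)
            \<and> orthogonal_matrix (U x))))"

definition Upsilon :: "beam_network \<Rightarrow> nat \<Rightarrow> real \<Rightarrow> vec3" where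
  "Upsilon net i x =
     unhat (transpose (rot net i x) ** vector_derivative (rot net i) (at x within {0..len net i}))"

definition Rbar :: "beam_network \<Rightarrow> nat \<Rightarrow> real \<Rightarrow> mat6" where
  "Rbar net i x = block (rot net i x) 0 0 (rot net i x)"

definition E_mat :: "beam_network \<Rightarrow> nat \<Rightarrow> real \<Rightarrow> mat6" where
  "E_mat net i x = block (hat (Upsilon net i x)) 0 (hat (axis 1 1)) (hat (Upsilon net i x))"

definition Q_mat :: "beam_network \<Rightarrow> nat \<Rightarrow> real \<Rightarrow> mat12" where
  "Q_mat net i x = block (mass net i x) 0 0 (flex net i x)"

definition A_mat :: "beam_network \<Rightarrow> nat \<Rightarrow> real \<Rightarrow> mat12" where
  "A_mat net i x = - (matrix_inv (Q_mat net i x) ** block 0 (mat 1) (mat 1) 0)"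

definition B_mat :: "beam_network \<Rightarrow> nat \<Rightarrow> real \<Rightarrow> mat12" where
  "B_mat net i x =
     matrix_inv (Q_mat net i x) ** block 0 (- E_mat net i x) (transpose (E_mat net i x)) 0"

definition G_mat :: "vec12 \<Rightarrow> mat12" where
  "G_mat u =
     (let u1 = upper (upper u); u2 = lower (upper u); u3 = upper (lower u); u4 = lower (lower u)
      in - block
             (block (hat u2) 0
                    (hat u1) (hat u2))   (block 0        (hat u3)
                                                (hat u3) (hat u4))
             0                           (block (hat u2) (hat u1)
                                                0        (hat u2)))"

definition g_fun :: "beam_network \<Rightarrow> nat \<Rightarrow> real \<Rightarrow> vec12 \<Rightarrow> vec12" where
  "g_fun net i x u = matrix_inv (Q_mat net i x) *v (G_mat u *v (Q_mat net i x *v u))"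

section \<open>The system and its compatibility conditions\<close>

definition solves_system ::
  "beam_network \<Rightarrow> real \<Rightarrow> (nat \<Rightarrow> real \<Rightarrow> vec12) \<Rightarrow> (nat \<Rightarrow> real \<Rightarrow> vec6)
     \<Rightarrow> (nat \<Rightarrow> real \<times> real \<Rightarrow> vec12) \<Rightarrow> bool" where
  "solves_system net T y0 q y \<longleftrightarrow>
     (\<forall>i\<in>beams net. \<forall>x\<in>{0<..<len net i}. \<forall>t\<in>{0<..<T}.
        partial_t T (y i) (x, t) + A_mat net i x *v partial_x (len net i) (y i) (x, t)
          + B_mat net i x *v y i (x, t) = g_fun net i x (y i (x, t)))
   \<and> (\<forall>t\<in>{0<..<T}.
        (let pos = node_pos net; fst_b = first_beam net;
             v = (\<lambda>i x. upper (y i (x, t))); z = (\<lambda>i x. lower (y i (x, t)))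
         in (\<forall>n\<in>multiple_nodes net. \<forall>i\<in>incident net n.
               Rbar net i (pos n i) *v v i (pos n i)
               = Rbar net (fst_b n) (pos n (fst_b n)) *v v (fst_b n) (pos n (fst_b n)))
          \<and> (\<forall>n\<in>multiple_nodes net.
               (\<Sum>i\<in>incident net n.
                  node_sign net n i *\<^sub>R (Rbar net i (pos n i) *v z i (pos n i))) = q n t)
          \<and> (\<forall>n\<in>neumann_nodes net.
               node_sign net n (fst_b n) *\<^sub>R z (fst_b n) (pos n (fst_b n)) = q n t)
          \<and> (\<forall>n\<in>dirichlet_nodes net. v (fst_b n) (pos n (fst_b n)) = q n t)))
   \<and> (\<forall>i\<in>beams net. \<forall>x\<in>{0<..<len net i}. y i (x, 0) = y0 i x)"

text \<open>The nodal identities on spatial profiles \<open>w\<close> and nodal values \<open>r\<close>; the first-order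
  compatibility conditions require them of \<open>(y0, q(0))\<close> and of \<open>(y1, q'(0))\<close>.\<close>

definition nodal_identities ::
  "beam_network \<Rightarrow> (nat \<Rightarrow> real \<Rightarrow> vec12) \<Rightarrow> (nat \<Rightarrow> vec6) \<Rightarrow> bool" where
  "nodal_identities net w r \<longleftrightarrow>
     (let pos = node_pos net; fst_b = first_beam net;
          v = (\<lambda>i x. upper (w i x)); z = (\<lambda>i x. lower (w i x))
      in (\<forall>n\<in>multiple_nodes net. \<forall>i\<in>incident net n. \<forall>j\<in>incident net n.
            Rbar net i (pos n i) *v v i (pos n i) = Rbar net j (pos n j) *v v j (pos n j))
       \<and> (\<forall>n\<in>multiple_nodes net.
            (\<Sum>i\<in>incident net n.
               node_sign net n i *\<^sub>R (Rbar net i (pos n i) *v z i (pos n i))) = r n)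
       \<and> (\<forall>n\<in>neumann_nodes net.
            node_sign net n (fst_b n) *\<^sub>R z (fst_b n) (pos n (fst_b n)) = r n)
       \<and> (\<forall>n\<in>dirichlet_nodes net. v (fst_b n) (pos n (fst_b n)) = r n))"

definition initial_velocity ::
  "beam_network \<Rightarrow> (nat \<Rightarrow> real \<Rightarrow> vec12) \<Rightarrow> nat \<Rightarrow> real \<Rightarrow> vec12" where
  "initial_velocity net y0 i x =
     - (A_mat net i x *v vector_derivative (y0 i) (at x within {0..len net i}))
     - B_mat net i x *v y0 i x + g_fun net i x (y0 i x)"

definition first_order_compatible ::
  "beam_network \<Rightarrow> real \<Rightarrow> (nat \<Rightarrow> real \<Rightarrow> vec12) \<Rightarrow> (nat \<Rightarrow> real \<Rightarrow> vec6) \<Rightarrow> bool" where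
  "first_order_compatible net T y0 q \<longleftrightarrow>
     nodal_identities net y0 (\<lambda>n. q n 0)
   \<and> nodal_identities net (initial_velocity net y0)
       (\<lambda>n. vector_derivative (q n) (at 0 within {0..T}))"

end

theory Submission
  imports Defs
begin

text \<open>The system is semilinear and its coefficients do not depend on time. In Riemann invariants
  each component is transported at a given speed, and a nodal condition determines the waves
  entering the incident beams from the waves leaving them: at a joint this amounts to inverting a
  sum of positive definite admittances. The time derivative \<open>w\<close> of the solution solves a system of
  the same kind, with the solution itself recovered as \<open>r = r0 + \<integral> w\<close>. Integrated along
  characteristics, this is a fixed point equation for a merely continuous \<open>w\<close>, contractive in a
  norm weighted in space and time; smallness of the data keeps the iterates in the unit ball, where
  the quadratic term is Lipschitz. Integrating the equation of \<open>w\<close> in time shows that \<open>r\<close> is also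
  differentiable in space. Uniqueness is an energy estimate, since the nodal conditions with zero
  data neither create nor dissipate energy.\<close>

section \<open>Symmetric positive definite matrices\<close>

text \<open>A fixed point argument for the solution itself would end with a merely mild solution,
  whose differentiability would have to be recovered separately. With the time derivative as unknown
  only continuity is at stake, and the part of the compatibility conditions on the initial velocity
  and \<open>q'(0)\<close> is what makes inflow and initial values meet at the corner. The part on
  \<open>y0\<close> and \<open>q(0)\<close> enters when the nodal identities, linear with
  coefficients constant in time, are integrated back.

  The scattering map at a node is tied to an energy and need not be a contraction in the maximum
  norm. The weight in space exploits that a wave has to cross a whole beam before it meets a node
  again; this asks for the travel time as coordinate, a different one for each component.

  The diagonalisation must be C^1 in space, because its derivative becomes a zeroth-order
  coefficient. Hence the square root of the flexibility is differentiated through a Sylvester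
  equation, and inverses are written as products of factors already known to be C^1. All bounds are
  linear in the data, which allows \<epsilon>0 = 1 and \<delta> = \<epsilon> / C.\<close>

lemma has_vector_derivative_iff_quotient:
  "(f has_vector_derivative D) (at x within X) \<longleftrightarrow>
     ((\<lambda>y. (f y - f x) /\<^sub>R (y - x)) \<longlongrightarrow> D) (at x within X)"
proof -
  have "norm (f y - f x - (y - x) *\<^sub>R D) / norm (y - x) = norm ((f y - f x) /\<^sub>R (y - x) - D)"
    if "y \<noteq> x" for y
  proof -
    have "(f y - f x) /\<^sub>R (y - x) - D = (f y - f x - (y - x) *\<^sub>R D) /\<^sub>R (y - x)"
      using that by (simp add: scaleR_diff_right)
    then show ?thesis by (simp add: divide_inverse mult.commute)
  qed
  then have "((\<lambda>y. norm (f y - f x - (y - x) *\<^sub>R D) / norm (y - x)) \<longlongrightarrow> 0) (at x within X)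
      \<longleftrightarrow> ((\<lambda>y. norm ((f y - f x) /\<^sub>R (y - x) - D)) \<longlongrightarrow> 0) (at x within X)"
    by (intro tendsto_cong) (auto simp: eventually_at_filter)
  then show ?thesis
    by (simp add: has_vector_derivative_def has_derivative_iff_norm bounded_linear_scaleR_left
        tendsto_norm_zero_iff LIM_zero_iff)
qed

section \<open>Norm bounds and bilinearity of matrix products\<close>

lemma norm_matrix_vector_le:
  fixes A :: "real^'n^'m"
  shows "norm (A *v x) \<le> norm A * norm x"
proof (rule power2_le_imp_le)
  \<comment> \<open>The norm of a matrix is the Euclidean norm of its vector of rows, that is, the
    Frobenius norm; Cauchy-Schwarz is applied to each row.\<close>
  have "(norm (A *v x))\<^sup>2 = (\<Sum>i\<in>UNIV. (A $ i \<bullet> x)\<^sup>2)"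
    by (simp add: norm_vec_def L2_set_def sum_nonneg matrix_vector_mul_component)
  also have "\<dots> \<le> (\<Sum>i\<in>UNIV. (norm (A $ i) * norm x)\<^sup>2)"
  proof (intro sum_mono)
    fix i show "(A $ i \<bullet> x)\<^sup>2 \<le> (norm (A $ i) * norm x)\<^sup>2"
      using Cauchy_Schwarz_ineq2[of "A $ i" x] by (metis abs_le_square_iff abs_mult abs_norm_cancel)
  qed
  also have "\<dots> = (norm A * norm x)\<^sup>2"
    by (simp add: norm_vec_def[of A] L2_set_def sum_nonneg power_mult_distrib sum_distrib_right)
  finally show "(norm (A *v x))\<^sup>2 \<le> (norm A * norm x)\<^sup>2" .
qed simp

lemma inner_transpose: "transpose A \<bullet> transpose B = A \<bullet> (B :: real^'n^'m)"
  unfolding inner_vec_def transpose_def by (simp, rule sum.swap)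

lemma norm_transpose: "norm (transpose A) = norm (A :: real^'n^'m)"
  by (simp add: norm_eq_sqrt_inner inner_transpose)

text \<open>Row \<open>i\<close> of the product is the transpose of \<open>B\<close> applied to row
  \<open>i\<close> of \<open>A\<close>, so the estimate for matrix-vector products is summed over
  the rows.\<close>

lemma norm_matrix_mult_le:
  fixes A :: "real^'n^'m" and B :: "real^'k^'n"
  shows "norm (A ** B) \<le> norm A * norm B"
proof (rule power2_le_imp_le)
  have row: "(A ** B) $ i = transpose B *v (A $ i)" for i
    by (simp add: matrix_matrix_mult_def matrix_vector_mult_def transpose_def vec_eq_iff mult.commute)
  have "(norm (A ** B))\<^sup>2 = (\<Sum>i\<in>UNIV. (norm (transpose B *v (A $ i)))\<^sup>2)"
    by (simp add: norm_vec_def[of "A ** B"] L2_set_def sum_nonneg row)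
  also have "\<dots> \<le> (\<Sum>i\<in>UNIV. (norm B * norm (A $ i))\<^sup>2)"
    using norm_matrix_vector_le[of "transpose B"]
    by (intro sum_mono power_mono) (auto simp: norm_transpose)
  also have "\<dots> = (norm A * norm B)\<^sup>2"
    by (simp add: norm_vec_def[of A] L2_set_def sum_nonneg power_mult_distrib sum_distrib_left mult.commute)
  finally show "(norm (A ** B))\<^sup>2 \<le> (norm A * norm B)\<^sup>2" .
qed simp

lemma bounded_bilinear_matrix_vector_mult:
  "bounded_bilinear ((*v) :: real^'n^'m \<Rightarrow> real^'n \<Rightarrow> real^'m)"
proof -
  have "bilinear ((*v) :: real^'n^'m \<Rightarrow> real^'n \<Rightarrow> real^'m)"
    unfolding bilinear_def
    by (auto intro!: linearI simp: algebra_simps scaleR_matrix_vector_assoc)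
  then show ?thesis
    by (simp add: bilinear_conv_bounded_bilinear)
qed

lemma bounded_bilinear_matrix_matrix_mult:
  "bounded_bilinear ((**) :: real^'n^'m \<Rightarrow> real^'k^'n \<Rightarrow> real^'k^'m)"
proof -
  have "bilinear ((**) :: real^'n^'m \<Rightarrow> real^'k^'n \<Rightarrow> real^'k^'m)"
    unfolding bilinear_def
    by (auto intro!: linearI simp: matrix_matrix_mult_def vec_eq_iff sum.distrib algebra_simps sum_distrib_left)
  then show ?thesis
    by (simp add: bilinear_conv_bounded_bilinear)
qed

lemmas continuous_on_matrix_vector_mult [continuous_intros] =
  bounded_bilinear.continuous_on[OF bounded_bilinear_matrix_vector_mult]
lemmas continuous_on_matrix_matrix_mult [continuous_intros] =
  bounded_bilinear.continuous_on[OF bounded_bilinear_matrix_matrix_mult]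

lemma continuous_on_transpose [continuous_intros]:
  fixes A :: "'a::topological_space \<Rightarrow> real^'n^'m"
  assumes "continuous_on S A"
  shows "continuous_on S (\<lambda>x. transpose (A x))"
  unfolding transpose_def by (intro continuous_intros assms)

section \<open>Quantitative positivity and inverses\<close>

lemma SPD_D:
  assumes "A \<in> SPD"
  shows "transpose A = A" and "x \<noteq> 0 \<Longrightarrow> x \<bullet> (A *v x) > 0" and "x \<bullet> (A *v x) \<ge> 0"
    and "(A *v x) \<bullet> y = x \<bullet> (A *v y)"
  using assms
  apply (auto simp: SPD_def)
   apply (metis inner_zero_left less_le order_refl)
  by (metis dot_lmul_matrix inner_commute vector_transpose_matrix)

text \<open>By compactness the quadratic form attains a positive minimum over \<open>K\<close> times
  the unit sphere, and homogeneity extends the bound to all vectors. The constant is uniform in the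
  parameter, as the energy estimate requires along a whole beam.\<close>

lemma SPD_coercive_on:
  fixes A :: "'a::topological_space \<Rightarrow> real^'n^'n"
  assumes K: "compact K" and cont: "continuous_on K A" and spd: "\<And>x. x \<in> K \<Longrightarrow> A x \<in> SPD"
  obtains \<mu> where "\<mu> > 0" and "\<And>x v. x \<in> K \<Longrightarrow> \<mu> * (norm v)\<^sup>2 \<le> v \<bullet> (A x *v v)"
proof (cases "K = {}")
  case True
  then show ?thesis using that[of 1] by auto
next
  case False
  let ?S = "sphere (0::real^'n) 1"
  have "compact (K \<times> ?S)" by (simp add: K compact_Times)
  moreover obtain e :: "real^'n" where "norm e = 1"
    using vector_choose_size[of 1] by auto
  then have "K \<times> ?S \<noteq> {}"
    using False by auto
  moreover have "continuous_on (K \<times> ?S) (\<lambda>p. snd p \<bullet> (A (fst p) *v snd p))"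
    by (intro continuous_intros continuous_on_compose2[OF cont]) auto
  ultimately obtain z where z: "z \<in> K \<times> ?S"
    and min: "\<forall>y\<in>K \<times> ?S. snd z \<bullet> (A (fst z) *v snd z) \<le> snd y \<bullet> (A (fst y) *v snd y)"
    using continuous_attains_inf[of "K \<times> ?S" "\<lambda>p. snd p \<bullet> (A (fst p) *v snd p)"] by blast
  define \<mu> where "\<mu> = snd z \<bullet> (A (fst z) *v snd z)"
  show ?thesis
  proof
    show "\<mu> > 0"
      unfolding \<mu>_def using z by (intro SPD_D(2)[OF spd]) auto
    fix x v assume x: "x \<in> K"
    show "\<mu> * (norm v)\<^sup>2 \<le> v \<bullet> (A x *v v)"
    proof (cases "v = 0")
      case False
      let ?u = "v /\<^sub>R norm v"
      have "(x, ?u) \<in> K \<times> ?S" using False x by simp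
      then have "\<mu> \<le> ?u \<bullet> (A x *v ?u)" using bspec[OF min, of "(x, ?u)"] unfolding \<mu>_def by simp
      also have "\<dots> = (v \<bullet> (A x *v v)) / (norm v)\<^sup>2"
        by (simp add: matrix_vector_mult_scaleR power2_eq_square divide_inverse)
      finally show ?thesis using False by (simp add: pos_le_divide_eq)
    qed simp
  qed
qed

lemma SPD_coercive:
  fixes A :: "real^'n^'n"
  assumes "A \<in> SPD"
  obtains \<mu> where "\<mu> > 0" and "\<And>v. \<mu> * (norm v)\<^sup>2 \<le> v \<bullet> (A *v v)"
proof (rule SPD_coercive_on[of "{0::real}" "\<lambda>_. A"])
qed (use assms that in auto)

text \<open>\<open>matrix_inv\<close> is a choice among two-sided inverses; positivity makes the
  kernel trivial, so there is one to choose.\<close>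

lemma SPD_invertible:
  fixes A :: "real^'n^'n"
  assumes "A \<in> SPD"
  shows "matrix_inv A ** A = mat 1" and "A ** matrix_inv A = mat 1"
proof -
  have "\<forall>x. A *v x = 0 \<longrightarrow> x = 0"
    using SPD_D(2)[OF assms] by (metis inner_zero_right less_irrefl)
  then have "invertible A"
    by (simp add: invertible_left_inverse matrix_left_invertible_ker)
  then have "\<exists>B. A ** B = mat 1 \<and> B ** A = mat 1" by (simp add: invertible_def)
  then have "A ** matrix_inv A = mat 1 \<and> matrix_inv A ** A = mat 1"
    unfolding matrix_inv_def by (rule someI_ex)
  then show "matrix_inv A ** A = mat 1" and "A ** matrix_inv A = mat 1" by auto
qed

lemma symmetric_matrixI:
  fixes A :: "real^'n^'n"
  assumes "\<And>u v. (A *v u) \<bullet> v = u \<bullet> (A *v v)"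
  shows "transpose A = A"
proof -
  have "u \<bullet> (transpose A *v v) = u \<bullet> (A *v v)" for u v
    using assms[of u v] by (metis dot_lmul_matrix inner_commute transpose_transpose vector_transpose_matrix)
  then have "transpose A *v v = A *v v" for v
    by (metis vector_eq_ldot)
  then show ?thesis by (simp add: matrix_eq)
qed

text \<open>With \<open>C = c (I - X)\<close> and \<open>\<parallel>X\<parallel> < 1\<close>, the square root is \<open>\<surd>c (I - Y)\<close>, where \<open>Y\<close> is the
  fixed point of the contraction \<open>Y \<mapsto> (X + Y\<^sup>2) / 2\<close>.\<close>

lemma SPD_sqrt_exists:
  fixes C :: "real^'n^'n"
  assumes C: "C \<in> SPD"
  shows "\<exists>S. S \<in> SPD \<and> S ** S = C"
proof -
  obtain \<mu> where \<mu>: "\<mu> > 0" "\<And>v. \<mu> * (norm v)\<^sup>2 \<le> v \<bullet> (C *v v)"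
    using SPD_coercive[OF C] by blast
  define K where "K = norm C + 1"
  have K: "K > 0" "norm (C *v v) \<le> K * norm v" for v
    using norm_matrix_vector_le[of C v] norm_ge_zero[of v] norm_ge_zero[of C] by (auto simp: K_def algebra_simps simp del: norm_ge_zero)
  \<comment> \<open>\<open>c \<ge> \<mu>\<close> keeps \<open>1 - \<mu> / c\<close> in
    \<open>[0, 1)\<close>, and \<open>c \<ge> K^2 / \<mu>\<close> makes the quadratic remainder in
    \<open>norm (X v)^2\<close> cost at most half of the gain \<open>2 * \<mu> / c\<close>.\<close>
  define c where "c = K\<^sup>2 / \<mu> + \<mu>"
  have c: "c > 0" "c \<ge> \<mu>" "K\<^sup>2 \<le> \<mu> * c" using \<mu>(1) K(1) by (auto simp: c_def field_simps add_pos_pos)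
  define q where "q = sqrt (1 - \<mu> / c)"
  have q: "0 \<le> q" "q < 1" "q\<^sup>2 = 1 - \<mu> / c"
    using c \<mu>(1) by (auto simp: q_def real_sqrt_lt_1_iff field_simps)
  \<comment> \<open>Bounded linear maps carry the operator norm and form a complete space. In the
    Frobenius norm of matrices, \<open>X\<close> need not be shorter than 1.\<close>
  define X where "X = Blinfun (\<lambda>v. v - (1 / c) *\<^sub>R (C *v v))"
  have X: "blinfun_apply X = (\<lambda>v. v - (1 / c) *\<^sub>R (C *v v))"
    unfolding X_def
    by (intro bounded_linear_Blinfun_apply bounded_linear_sub bounded_linear_ident
        bounded_linear_const_scaleR matrix_vector_mul_bounded_linear)
  have nX: "norm X \<le> q"
  proof (rule norm_blinfun_bound[OF q(1)])
    fix v
    have "(norm (X v))\<^sup>2 = (norm v)\<^sup>2 - 2 / c * (v \<bullet> (C *v v)) + (norm (C *v v))\<^sup>2 / c\<^sup>2"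
      unfolding X power2_norm_eq_inner
      by (simp add: inner_diff_left inner_diff_right inner_commute power2_eq_square)
    also have "\<dots> \<le> (norm v)\<^sup>2 - 2 / c * (\<mu> * (norm v)\<^sup>2) + (K * norm v)\<^sup>2 / c\<^sup>2"
      using c \<mu>(2)[of v] K(2)[of v]
      by (intro add_mono diff_mono mult_left_mono divide_right_mono power_mono) auto
    also have "\<dots> = (1 - 2 * \<mu> / c + (K\<^sup>2 / c) / c) * (norm v)\<^sup>2"
      by (simp add: algebra_simps power_mult_distrib power2_eq_square)
    also have "\<dots> \<le> (1 - 2 * \<mu> / c + \<mu> / c) * (norm v)\<^sup>2"
      using c by (intro mult_right_mono add_left_mono divide_right_mono) (auto simp: field_simps)
    also have "\<dots> = (q * norm v)\<^sup>2" by (simp add: q power_mult_distrib)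
    finally show "norm (X v) \<le> q * norm v"
      using q(1) by (simp add: power2_le_iff_abs_le abs_mult)
  qed
  \<comment> \<open>Symmetry is built into the closed set, so the fixed point inherits it. The ball
    of radius \<open>q\<close> is preserved because \<open>(q + q^2) / 2 \<le> q\<close>, and on it
    the map has Lipschitz constant \<open>q\<close>.\<close>
  define Z where "Z = {Y :: (real^'n) \<Rightarrow>\<^sub>L (real^'n). norm Y \<le> q \<and> (\<forall>u v. blinfun_apply Y u \<bullet> v = u \<bullet> blinfun_apply Y v)}"
  define f where "f Y = (1/2) *\<^sub>R (X + (Y o\<^sub>L Y))" for Y
  have "\<exists>!Y\<in>Z. f Y = Y"
  proof (rule Banach_fix[where c = q])
    have "closed Z" unfolding Z_def
      by (intro closed_Collect_conj closed_Collect_le closed_Collect_all closed_Collect_eq continuous_intros)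
    then show "complete Z" by (simp add: complete_eq_closed)
    show "Z \<noteq> {}" using q(1) by (auto simp: Z_def intro!: exI[of _ 0])
    show "f ` Z \<subseteq> Z"
    proof safe
      fix Y assume Y: "Y \<in> Z"
      have "norm (Y o\<^sub>L Y) \<le> norm Y * norm Y" by (rule norm_blinfun_compose)
      also have "\<dots> \<le> q * 1" using Y q by (intro mult_mono) (auto simp: Z_def)
      finally have "norm (X + (Y o\<^sub>L Y)) \<le> q + q"
        using nX norm_triangle_ineq[of X "Y o\<^sub>L Y"] by simp
      moreover have "blinfun_apply (f Y) u \<bullet> v = u \<bullet> blinfun_apply (f Y) v" for u v
        using Y SPD_D(4)[OF C, of u v]
        by (simp add: f_def Z_def blinfun.bilinear_simps X inner_add inner_diff)
      ultimately show "f Y \<in> Z" by (simp add: Z_def f_def)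
    qed
    show "dist (f Y) (f W) \<le> q * dist Y W" if YW: "Y \<in> Z" "W \<in> Z" for Y W
    proof -
      have "f Y - f W = (1/2) *\<^sub>R ((Y o\<^sub>L (Y - W)) + ((Y - W) o\<^sub>L W))"
        by (simp add: f_def bounded_bilinear.diff_left[OF bounded_bilinear_blinfun_compose]
            bounded_bilinear.diff_right[OF bounded_bilinear_blinfun_compose] algebra_simps)
      moreover have "norm (Y o\<^sub>L (Y - W)) \<le> q * norm (Y - W)"
        using norm_blinfun_compose[of Y "Y - W"] YW mult_right_mono[of "norm Y" q "norm (Y - W)"]
        by (auto simp: Z_def)
      moreover have "norm ((Y - W) o\<^sub>L W) \<le> q * norm (Y - W)"
        using norm_blinfun_compose[of "Y - W" W] YW mult_left_mono[of "norm W" q "norm (Y - W)"]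
        by (auto simp: Z_def mult.commute)
      ultimately show "dist (f Y) (f W) \<le> q * dist Y W"
        using norm_triangle_ineq[of "Y o\<^sub>L (Y - W)" "(Y - W) o\<^sub>L W"] by (simp add: dist_norm)
    qed
  qed (use q in auto)
  then obtain Y where Y: "Y \<in> Z" "f Y = Y" by blast
  define S where "S = matrix (\<lambda>v. sqrt c *\<^sub>R (v - Y v))"
  have lin: "linear (\<lambda>v. sqrt c *\<^sub>R (v - Y v))"
    by (intro bounded_linear.linear bounded_linear_const_scaleR bounded_linear_sub bounded_linear_ident
        blinfun.bounded_linear_right)
  have S: "S *v v = sqrt c *\<^sub>R (v - Y v)" for v
    unfolding S_def using matrix_works[of "\<lambda>v. sqrt c *\<^sub>R (v - Y v)"] lin by (simp add: linear_matrix_vector_mul_eq)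
  \<comment> \<open>The fixed point equation solved for \<open>Y^2\<close>; it turns
    \<open>c (I - Y)^2\<close> into \<open>c (I - X)\<close>, that is, into
    \<open>C\<close>.\<close>
  have YY: "Y (Y v) = 2 *\<^sub>R Y v - X v" for v
  proof -
    have "Y v = (1/2) *\<^sub>R (X v + Y (Y v))"
      using arg_cong[OF Y(2), of "\<lambda>F. blinfun_apply F v"] by (simp add: f_def blinfun.bilinear_simps)
    then have "2 *\<^sub>R Y v = X v + Y (Y v)" by (metis (no_types) scaleR_half_double scaleR_2 scaleR_right_distrib)
    then show ?thesis by simp
  qed
  have "(S ** S) *v v = C *v v" for v
  proof -
    have "(S ** S) *v v = c *\<^sub>R (v - 2 *\<^sub>R Y v + Y (Y v))"
      using c(1) by (simp add: matrix_vector_mul_assoc[symmetric] S blinfun.bilinear_simps algebra_simps scaleR_2)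
    also have "\<dots> = C *v v" using c(1) by (simp add: YY X algebra_simps)
    finally show ?thesis .
  qed
  then have "S ** S = C" by (simp add: matrix_eq)
  moreover have "S \<in> SPD"
    unfolding SPD_def
  proof (intro CollectI conjI allI impI symmetric_matrixI)
    fix u v :: "real^'n"
    show "(S *v u) \<bullet> v = u \<bullet> (S *v v)" using Y(1) by (simp add: S Z_def inner_diff)
  next
    fix v :: "real^'n" assume v: "v \<noteq> 0"
    have "v \<bullet> Y v \<le> norm v * norm (Y v)" by (rule norm_cauchy_schwarz)
    also have "\<dots> \<le> norm v * (q * norm v)"
      using norm_blinfun[of Y v] Y(1) mult_right_mono[of "norm Y" q "norm v"]
      by (intro mult_left_mono) (auto simp: Z_def)
    also have "\<dots> < norm v * norm v" using v q by simp
    finally show "v \<bullet> (S *v v) > 0" using c(1)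
      by (simp add: S inner_diff dot_square_norm power2_eq_square)
  qed
  ultimately show ?thesis by blast
qed

section \<open>The Sylvester equation and derivatives of the square root\<close>

lemma inner_matrix_mult_right:
  fixes H :: "real^'n^'m" and B :: "real^'n^'n"
  assumes "\<And>v. \<mu> * (norm v)\<^sup>2 \<le> v \<bullet> (B *v v)" and "transpose B = B"
  shows "\<mu> * (norm H)\<^sup>2 \<le> H \<bullet> (H ** B)"
proof -
  \<comment> \<open>In the Frobenius inner product the estimate decouples into rows, because a
    symmetric \<open>B\<close> acts on each row of \<open>H\<close> as it acts on vectors.\<close>
  have row: "(H ** B) $ i = B *v (H $ i)" for i
    using vector_transpose_matrix[of "H $ i" B]
    by (simp add: assms(2)) (simp add: matrix_matrix_mult_def vector_matrix_mult_def vec_eq_iff mult.commute)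
  have "\<mu> * (norm H)\<^sup>2 = (\<Sum>i\<in>UNIV. \<mu> * (norm (H $ i))\<^sup>2)"
    by (simp add: norm_vec_def[of H] L2_set_def sum_nonneg sum_distrib_left)
  also have "\<dots> \<le> (\<Sum>i\<in>UNIV. H $ i \<bullet> (B *v (H $ i)))"
    by (intro sum_mono assms)
  also have "\<dots> = H \<bullet> (H ** B)" by (simp add: inner_vec_def[of H] row)
  finally show ?thesis .
qed

lemma inner_matrix_mult_left:
  fixes H :: "real^'n^'m" and A :: "real^'m^'m"
  assumes "\<And>v. \<mu> * (norm v)\<^sup>2 \<le> v \<bullet> (A *v v)" and "transpose A = A"
  shows "\<mu> * (norm H)\<^sup>2 \<le> H \<bullet> (A ** H)"
  using inner_matrix_mult_right[OF assms, of "transpose H"] 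

    inner_transpose[of H "A ** H"]
  by (simp add: matrix_transpose_mul assms(2) norm_transpose)

text \<open>Only one of the two factors needs a quantitative lower bound.\<close>

lemma sylvester_bound:
  fixes H :: "real^'n^'n"
  assumes \<mu>: "\<mu> > 0" "\<And>v. \<mu> * (norm v)\<^sup>2 \<le> v \<bullet> (A *v v)" and "A \<in> SPD" "B \<in> SPD"
  shows "\<mu> * norm H \<le> norm (A ** H + H ** B)" and "\<mu> * norm H \<le> norm (B ** H + H ** A)"
proof -
  \<comment> \<open>The expression is tested against \<open>H\<close>: the factor without a
    quantitative bound contributes a nonnegative term (constant 0), the other one at least
    \<open>\<mu> * (norm H)^2\<close>.\<close>
  have "0 * (norm H)\<^sup>2 \<le> H \<bullet> (H ** B)" "0 * (norm H)\<^sup>2 \<le> H \<bullet> (B ** H)"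
    by (intro inner_matrix_mult_right inner_matrix_mult_left; use SPD_D[OF assms(4)] in simp)+
  moreover have "\<mu> * (norm H)\<^sup>2 \<le> H \<bullet> (A ** H)" "\<mu> * (norm H)\<^sup>2 \<le> H \<bullet> (H ** A)"
    using assms SPD_D by (intro inner_matrix_mult_right inner_matrix_mult_left; auto)+
  ultimately have "\<mu> * (norm H)\<^sup>2 \<le> H \<bullet> (A ** H + H ** B)" "\<mu> * (norm H)\<^sup>2 \<le> H \<bullet> (B ** H + H ** A)"
    by (auto simp: inner_add)
  then have "norm H * (\<mu> * norm H) \<le> norm H * norm (A ** H + H ** B)"
     "norm H * (\<mu> * norm H) \<le> norm H * norm (B ** H + H ** A)"
    using norm_cauchy_schwarz[of H "A ** H + H ** B"] norm_cauchy_schwarz[of H "B ** H + H ** A"]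
    by (auto simp: power2_eq_square algebra_simps)
  then show "\<mu> * norm H \<le> norm (A ** H + H ** B)" "\<mu> * norm H \<le> norm (B ** H + H ** A)"
    by (cases "H = 0"; simp)+
qed

text \<open>The difference of two positive roots solves a homogeneous Sylvester equation and
  therefore vanishes; this gives the definite description in \<open>spd_sqrt\<close> its
  meaning.\<close>

lemma spd_sqrt:
  assumes "C \<in> SPD"
  shows "spd_sqrt C \<in> SPD" and "spd_sqrt C ** spd_sqrt C = C"
proof -
  have uniq: "S = S'" if S: "S \<in> SPD" "S ** S = C" and S': "S' \<in> SPD" "S' ** S' = C" for S S'
  proof -
    obtain \<mu> where \<mu>: "\<mu> > 0" "\<And>v. \<mu> * (norm v)\<^sup>2 \<le> v \<bullet> (S *v v)"
      using SPD_coercive[OF S(1)] by blast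
    have "S ** (S - S') + (S - S') ** S' = 0"
      using S S' by (simp add: bounded_bilinear.diff_left[OF bounded_bilinear_matrix_matrix_mult]
            bounded_bilinear.diff_right[OF bounded_bilinear_matrix_matrix_mult])
    then have "\<mu> * norm (S - S') \<le> 0"
      using sylvester_bound(1)[OF \<mu> S(1) S'(1), of "S - S'"] by simp
    then show ?thesis using \<mu>(1) by (simp add: mult_le_0_iff)
  qed
  have "\<exists>!S. S \<in> SPD \<and> S ** S = C" using SPD_sqrt_exists[OF assms] uniq by blast
  then have "spd_sqrt C \<in> SPD \<and> spd_sqrt C ** spd_sqrt C = C"
    unfolding spd_sqrt_def by (rule theI')
  then show "spd_sqrt C \<in> SPD" and "spd_sqrt C ** spd_sqrt C = C" by auto
qed

text \<open>Derivatives of the square root \<open>S\<close> of \<open>C\<close> solve the Sylvester equation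
  \<open>S K + K S = C'\<close>.\<close>

lemma spd_sqrt_C1:
  fixes C :: "real \<Rightarrow> real^'n^'n"
  assumes spd: "\<And>x. x \<in> X \<Longrightarrow> C x \<in> SPD"
    and der: "\<And>x. x \<in> X \<Longrightarrow> (C has_vector_derivative C' x) (at x within X)"
    and cont: "continuous_on X C'"
  obtains K where "\<And>x. x \<in> X \<Longrightarrow> ((\<lambda>x. spd_sqrt (C x)) has_vector_derivative K x) (at x within X)"
    and "continuous_on X K"
proof -
  note bmm = bounded_bilinear_matrix_matrix_mult
  define S where "S x = spd_sqrt (C x)" for x
  have S: "S x \<in> SPD" "S x ** S x = C x" if "x \<in> X" for x
    using spd_sqrt spd that by (auto simp: S_def)
  \<comment> \<open>The noncommutative form of \<open>a^2 - b^2\<close>: the increment of the root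
    solves a Sylvester equation with mixed coefficients \<open>S y\<close> and \<open>S x\<close>,
    whose right-hand side is the increment of \<open>C\<close>.\<close>
  have diff: "S y ** (S y - S x) + (S y - S x) ** S x = C y - C x" if "x \<in> X" "y \<in> X" for x y
    using S[OF that(1)] S[OF that(2)] 
    by (simp add: bounded_bilinear.diff_left[OF bmm] bounded_bilinear.diff_right[OF bmm])
  have contC: "continuous_on X C"
    using der has_vector_derivative_continuous continuous_on_eq_continuous_within by blast
  \<comment> \<open>The coercivity constant is taken at the fixed point \<open>x\<close>;
    \<open>S y\<close> enters only through its positivity, so one constant serves all
    \<open>y\<close>.\<close>
  have contS: "(S \<longlongrightarrow> S x) (at x within X)" if x: "x \<in> X" for x
  proof -
    obtain \<mu> where \<mu>: "\<mu> > 0" "\<And>v. \<mu> * (norm v)\<^sup>2 \<le> v \<bullet> (S x *v v)"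
      using SPD_coercive[OF S(1)[OF x]] by blast
    have "((\<lambda>y. S y - S x) \<longlongrightarrow> 0) (at x within X)"
    proof (rule Lim_null_comparison)
      show "\<forall>\<^sub>F y in at x within X. norm (S y - S x) \<le> norm (C y - C x) / \<mu>"
        unfolding eventually_at_filter
      proof (intro always_eventually allI impI)
        fix y assume y: "y \<in> X"
        show "norm (S y - S x) \<le> norm (C y - C x) / \<mu>"
          using sylvester_bound(2)[OF \<mu> S(1)[OF x] S(1)[OF y], of "S y - S x"] diff[OF x y] \<mu>(1)
          by (simp add: field_simps)
      qed
      have "((\<lambda>y. norm (C y - C x)) \<longlongrightarrow> norm (C x - C x)) (at x within X)"
        using contC x by (intro tendsto_intros) (auto simp: continuous_on_def)
      then show "((\<lambda>y. norm (C y - C x) / \<mu>) \<longlongrightarrow> 0) (at x within X)"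
        by (intro tendsto_divide_zero) simp
    qed
    then show ?thesis by (simp add: LIM_zero_iff)
  qed
  have "\<exists>K. S x ** K + K ** S x = C' x" if x: "x \<in> X" for x
  proof -
    obtain \<mu> where \<mu>: "\<mu> > 0" "\<And>v. \<mu> * (norm v)\<^sup>2 \<le> v \<bullet> (S x *v v)"
      using SPD_coercive[OF S(1)[OF x]] by blast
    let ?L = "\<lambda>K. S x ** K + K ** S x"
    have lin: "linear ?L"
      by (intro linearI) (simp_all add: bounded_bilinear.add_left[OF bmm] bounded_bilinear.add_right[OF bmm]
          bounded_bilinear.scaleR_left[OF bmm] bounded_bilinear.scaleR_right[OF bmm] algebra_simps)
    \<comment> \<open>In finite dimension, injectivity of the Sylvester operator already produces
      the candidate derivative \<open>K x\<close>.\<close>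
    moreover have "inj ?L"
    proof (subst linear_injective_0[OF lin], intro allI impI)
      fix K assume "?L K = 0"
      then show "K = 0"
        using sylvester_bound(1)[OF \<mu> S(1)[OF x] S(1)[OF x], of K] \<mu>(1) by (simp add: mult_le_0_iff)
    qed
    ultimately have "surj ?L" by (rule linear_inj_imp_surj)
    then show ?thesis unfolding surj_def by metis
  qed
  then obtain K where K: "\<And>x. x \<in> X \<Longrightarrow> S x ** K x + K x ** S x = C' x"
    using bchoice[of X "\<lambda>x K. S x ** K + K ** S x = C' x"] by blast
  show ?thesis
  proof (rule that)
    fix x assume x: "x \<in> X"
    obtain \<mu> where \<mu>: "\<mu> > 0" "\<And>v. \<mu> * (norm v)\<^sup>2 \<le> v \<bullet> (S x *v v)"
      using SPD_coercive[OF S(1)[OF x]] by blast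
    let ?h = "\<lambda>y. (S y - S x) /\<^sub>R (y - x)"
    let ?R = "\<lambda>y. (C y - C x) /\<^sub>R (y - x) - (S y ** K x + K x ** S x)"
    have "((\<lambda>y. ?h y - K x) \<longlongrightarrow> 0) (at x within X)"
    proof (rule Lim_null_comparison)
      show "\<forall>\<^sub>F y in at x within X. norm (?h y - K x) \<le> norm (?R y) / \<mu>"
        unfolding eventually_at_filter
      proof (intro always_eventually allI impI)
        fix y assume y: "y \<in> X" "y \<noteq> x"
        \<comment> \<open>The error of the difference quotient solves a Sylvester equation again;
          its right-hand side \<open>?R y\<close> tends to zero by the equation that defines
          \<open>K x\<close>.\<close>
        have "S y ** (?h y - K x) + (?h y - K x) ** S x
            = (S y ** (S y - S x) + (S y - S x) ** S x) /\<^sub>R (y - x) - (S y ** K x + K x ** S x)"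
          by (simp add: bounded_bilinear.diff_left[OF bmm] bounded_bilinear.diff_right[OF bmm]
              bounded_bilinear.add_left[OF bmm] bounded_bilinear.add_right[OF bmm]
              bounded_bilinear.scaleR_left[OF bmm] bounded_bilinear.scaleR_right[OF bmm] algebra_simps)
        then have "S y ** (?h y - K x) + (?h y - K x) ** S x = ?R y"
          unfolding diff[OF x y(1)] .
        then have "\<mu> * norm (?h y - K x) \<le> norm (?R y)"
          using sylvester_bound(2)[OF \<mu> S(1)[OF x] S(1)[OF y(1)], of "?h y - K x"] by (simp only:)
        then show "norm (?h y - K x) \<le> norm (?R y) / \<mu>"
          using \<mu>(1) by (simp only: pos_le_divide_eq mult.commute)
      qed
      have "((\<lambda>y. (C y - C x) /\<^sub>R (y - x)) \<longlongrightarrow> C' x) (at x within X)"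
        using der[OF x] by (simp add: has_vector_derivative_iff_quotient)
      then have "((\<lambda>y. norm (?R y)) \<longlongrightarrow> norm (C' x - (S x ** K x + K x ** S x))) (at x within X)"
        by (intro tendsto_intros bounded_bilinear.tendsto[OF bmm] contS[OF x])
      then show "((\<lambda>y. norm (?R y) / \<mu>) \<longlongrightarrow> 0) (at x within X)"
        using K[OF x] by (intro tendsto_divide_zero) simp
    qed
    then show "((\<lambda>x. spd_sqrt (C x)) has_vector_derivative K x) (at x within X)"
      by (simp add: has_vector_derivative_iff_quotient S_def[symmetric] LIM_zero_iff)
  next
    show "continuous_on X K"
      unfolding continuous_on_def
    proof
      fix x assume x: "x \<in> X"
      obtain \<mu> where \<mu>: "\<mu> > 0" "\<And>v. \<mu> * (norm v)\<^sup>2 \<le> v \<bullet> (S x *v v)"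
        using SPD_coercive[OF S(1)[OF x]] by blast
      let ?R = "\<lambda>y. C' y - (S y ** K x + K x ** S y)"
      have lim: "((\<lambda>y. norm (?R y)) \<longlongrightarrow> norm (C' x - (S x ** K x + K x ** S x))) (at x within X)"
        using cont x by (intro tendsto_intros bounded_bilinear.tendsto[OF bmm] contS[OF x])
          (auto simp: continuous_on_def)
      \<comment> \<open>Continuity of \<open>K\<close>: freezing the coefficients at
        \<open>x\<close> leaves an error of at most \<open>2 * norm (S y - S x)\<close> times
        \<open>norm (K y - K x)\<close>, which half of the coercivity absorbs once \<open>y\<close>
        is close to \<open>x\<close>.\<close>
      have "((\<lambda>y. 2 * norm (S y - S x)) \<longlongrightarrow> 2 * norm (S x - S x)) (at x within X)"
        by (intro tendsto_intros contS[OF x])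
      then have "\<forall>\<^sub>F y in at x within X. 2 * norm (S y - S x) < \<mu> / 2"
        using \<mu>(1) by (intro order_tendstoD(2)) auto
      have "((\<lambda>y. K y - K x) \<longlongrightarrow> 0) (at x within X)"
      proof (rule Lim_null_comparison)
        show "\<forall>\<^sub>F y in at x within X. norm (K y - K x) \<le> norm (?R y) / (\<mu> / 2)"
          using \<open>\<forall>\<^sub>F y in at x within X. 2 * norm (S y - S x) < \<mu> / 2\<close>
          unfolding eventually_at_filter
        proof (rule eventually_mono, intro impI)
          fix y assume y: "y \<noteq> x \<longrightarrow> y \<in> X \<longrightarrow> 2 * norm (S y - S x) < \<mu> / 2" "y \<noteq> x" "y \<in> X"
          let ?H = "K y - K x" and ?E = "S y - S x"
          have "S x ** ?H + ?H ** S x = ?R y - (?E ** ?H + ?H ** ?E)"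
            using K[OF y(3)]
            by (simp add: bounded_bilinear.diff_left[OF bmm] bounded_bilinear.diff_right[OF bmm] algebra_simps)
          then have "\<mu> * norm ?H \<le> norm (?R y - (?E ** ?H + ?H ** ?E))"
            using sylvester_bound(1)[OF \<mu> S(1)[OF x] S(1)[OF x], of ?H] by simp
          also have "\<dots> \<le> norm (?R y) + (norm (?E ** ?H) + norm (?H ** ?E))"
            by (intro order_trans[OF norm_triangle_ineq4] add_left_mono norm_triangle_ineq)
          also have "\<dots> \<le> norm (?R y) + (norm ?E * norm ?H + norm ?H * norm ?E)"
            by (intro add_mono order_refl norm_matrix_mult_le)
          also have "\<dots> = norm (?R y) + (2 * norm ?E) * norm ?H" by simp
          also have "\<dots> \<le> norm (?R y) + (\<mu> / 2) * norm ?H"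
            using y by (intro add_left_mono mult_right_mono) auto
          finally show "norm (K y - K x) \<le> norm (?R y) / (\<mu> / 2)"
            using \<mu>(1) by (simp add: field_simps)
        qed
        show "((\<lambda>y. norm (?R y) / (\<mu> / 2)) \<longlongrightarrow> 0) (at x within X)"
          using lim K[OF x] by (intro tendsto_divide_zero) simp
      qed
      then show "(K \<longlongrightarrow> K x) (at x within X)" by (simp add: LIM_zero_iff)
    qed
  qed
qed

section \<open>Mild solutions of transport systems\<close>

text \<open>Contraction is expressed by pointwise domination by \<open>c * W\<close>, for every
  constant \<open>c\<close>, instead of by a weighted norm: the components live on different
  domains, and no metric space of families has to be built. Completeness becomes closedness of
  \<open>P\<close> under uniform limits; the bound \<open>Wmax\<close> turns weighted estimates into
  uniform ones.\<close>

lemma picard_fixed_point: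
  fixes \<Phi> :: "('j \<Rightarrow> 'p::topological_space \<Rightarrow> real) \<Rightarrow> 'j \<Rightarrow> 'p \<Rightarrow> real"
  assumes W: "\<And>j p. j \<in> J \<Longrightarrow> p \<in> D j \<Longrightarrow> 0 \<le> W j p \<and> W j p \<le> Wmax"
    and \<kappa>: "0 \<le> \<kappa>" "\<kappa> < 1"
    and P: "P u0" "\<And>u. P u \<Longrightarrow> P (\<Phi> u)"
    and contr: "\<And>u v c j p. P u \<Longrightarrow> P v
        \<Longrightarrow> (\<And>k p. k \<in> J \<Longrightarrow> p \<in> D k \<Longrightarrow> \<bar>u k p - v k p\<bar> \<le> c * W k p)
        \<Longrightarrow> j \<in> J \<Longrightarrow> p \<in> D j \<Longrightarrow> \<bar>\<Phi> u j p - \<Phi> v j p\<bar> \<le> \<kappa> * c * W j p"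
    and init: "\<And>j p. j \<in> J \<Longrightarrow> p \<in> D j \<Longrightarrow> \<bar>\<Phi> u0 j p - u0 j p\<bar> \<le> c0 * W j p"
    and closed: "\<And>u w. (\<And>n. P (u n)) \<Longrightarrow>
        (\<And>j. j \<in> J \<Longrightarrow> uniform_limit (D j) (\<lambda>n. u n j) (w j) sequentially) \<Longrightarrow> P w"
  shows "\<exists>w. P w \<and> (\<forall>j\<in>J. \<forall>p\<in>D j. \<Phi> w j p = w j p)"
proof -
  define c where "c = max c0 0"
  define u where "u n = (\<Phi> ^^ n) u0" for n
  have Pu: "P (u n)" for n by (induction n) (auto simp: u_def P)
  have uSuc: "u (Suc n) = \<Phi> (u n)" for n by (simp add: u_def)
  have step: "\<bar>u (Suc n) j p - u n j p\<bar> \<le> c * \<kappa> ^ n * W j p" if "j \<in> J" "p \<in> D j" for n j p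
    using that
  proof (induction n arbitrary: j p)
    case 0
    have "c0 * W j p \<le> c * W j p" using W[OF 0] by (intro mult_right_mono) (auto simp: c_def)
    then show ?case using init[OF 0] by (simp add: u_def)
  next
    case (Suc n)
    have "\<bar>\<Phi> (u (Suc n)) j p - \<Phi> (u n) j p\<bar> \<le> \<kappa> * (c * \<kappa> ^ n) * W j p"
      using Suc by (intro contr Pu) auto
    then show ?case by (simp add: uSuc mult_ac)
  qed
  \<comment> \<open>The limit is defined by the telescoping series of the increments, so that the
    Weierstrass test yields uniform convergence.\<close>
  define w where "w j p = u0 j p + (\<Sum>i. u (Suc i) j p - u i j p)" for j p
  have lim: "uniform_limit (D j) (\<lambda>n. u n j) (w j) sequentially" if j: "j \<in> J" for j
  proof -
    have "uniform_limit (D j) (\<lambda>n p. \<Sum>i<n. u (Suc i) j p - u i j p)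
        (\<lambda>p. \<Sum>i. u (Suc i) j p - u i j p) sequentially"
    proof (rule Weierstrass_m_test)
      fix n p assume p: "p \<in> D j"
      have "c * \<kappa> ^ n * W j p \<le> c * \<kappa> ^ n * Wmax"
        using W[OF j p] \<kappa> by (intro mult_left_mono) (auto simp: c_def)
      then show "norm (u (Suc n) j p - u n j p) \<le> c * \<kappa> ^ n * Wmax"
        using step[OF j p, of n] by simp
    next
      show "summable (\<lambda>n. c * \<kappa> ^ n * Wmax)"
        using \<kappa> by (intro summable_mult summable_mult2 summable_geometric) auto
    qed
    then have "uniform_limit (D j) (\<lambda>n p. u0 j p + (\<Sum>i<n. u (Suc i) j p - u i j p)) (w j) sequentially"
      unfolding w_def by (intro uniform_limit_intros)
    moreover have "u0 j p + (\<Sum>i<n. u (Suc i) j p - u i j p) = u n j p" for n p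
      using sum_lessThan_telescope[of "\<lambda>i. u i j p" n] by (simp add: u_def)
    ultimately show ?thesis by simp
  qed
  then have Pw: "P w" by (intro closed[of u w] Pu)
  have ptw: "(\<lambda>n. u n j p) \<longlonglongrightarrow> w j p" if "j \<in> J" "p \<in> D j" for j p
    using tendsto_uniform_limitI[OF lim] that by blast
  have far: "\<bar>u (m + n) j p - u n j p\<bar> \<le> c * \<kappa> ^ n / (1 - \<kappa>) * W j p" if jp: "j \<in> J" "p \<in> D j" for n m j p
  proof -
    have "\<bar>u (m + n) j p - u n j p\<bar> \<le> c * \<kappa> ^ n * ((1 - \<kappa> ^ m) / (1 - \<kappa>)) * W j p"
    proof (induction m)
      case (Suc m)
      have "\<bar>u (Suc m + n) j p - u n j p\<bar> \<le> c * \<kappa> ^ (n + m) * W j p + c * \<kappa> ^ n * ((1 - \<kappa> ^ m) / (1 - \<kappa>)) * W j p"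
        using Suc step[OF jp, of "m + n"] by (simp add: add.commute)
      also have "\<dots> = c * \<kappa> ^ n * (\<kappa> ^ m + (1 - \<kappa> ^ m) / (1 - \<kappa>)) * W j p"
        by (simp add: algebra_simps power_add)
      also have "\<kappa> ^ m + (1 - \<kappa> ^ m) / (1 - \<kappa>) = (1 - \<kappa> ^ Suc m) / (1 - \<kappa>)"
        using \<kappa> by (simp add: field_simps)
      finally show ?case .
    qed simp
    also have "\<dots> \<le> c * \<kappa> ^ n * (1 / (1 - \<kappa>)) * W j p"
      using \<kappa> W[OF jp] by (intro mult_right_mono mult_left_mono divide_right_mono) (auto simp: c_def)
    finally show ?thesis by simp
  qed
  have near: "\<bar>w j p - u n j p\<bar> \<le> c * \<kappa> ^ n / (1 - \<kappa>) * W j p" if jp: "j \<in> J" "p \<in> D j" for n j p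
  proof (rule tendsto_upperbound)
    show "(\<lambda>m. \<bar>u (m + n) j p - u n j p\<bar>) \<longlonglongrightarrow> \<bar>w j p - u n j p\<bar>"
      by (intro tendsto_intros LIMSEQ_ignore_initial_segment ptw jp)
    show "\<forall>\<^sub>F m in sequentially. \<bar>u (m + n) j p - u n j p\<bar> \<le> c * \<kappa> ^ n / (1 - \<kappa>) * W j p"
      using far[OF jp] by (intro always_eventually allI)
  qed simp
  \<comment> \<open>The contraction estimate, applied to \<open>w\<close> and \<open>u n\<close>
    with the tail bound \<open>near\<close>, provides the continuity of \<open>\<Phi>\<close> at the
    limit.\<close>
  have "\<Phi> w j p = w j p" if jp: "j \<in> J" "p \<in> D j" for j p
  proof -
    have "(\<lambda>n. u (Suc n) j p - \<Phi> w j p) \<longlonglongrightarrow> 0"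
    proof (rule Lim_null_comparison)
      show "\<forall>\<^sub>F n in sequentially. norm (u (Suc n) j p - \<Phi> w j p)
          \<le> \<kappa> * (c * \<kappa> ^ n / (1 - \<kappa>)) * W j p"
      proof (intro always_eventually allI)
        fix n
        show "norm (u (Suc n) j p - \<Phi> w j p) \<le> \<kappa> * (c * \<kappa> ^ n / (1 - \<kappa>)) * W j p"
          using contr[OF Pw Pu[of n] near jp] by (simp add: uSuc abs_minus_commute)
      qed
      have "(\<lambda>n. \<kappa> * (c * \<kappa> ^ n / (1 - \<kappa>)) * W j p) \<longlonglongrightarrow> \<kappa> * (c * 0 / (1 - \<kappa>)) * W j p"
        using \<kappa> by (intro tendsto_intros LIMSEQ_power_zero) auto
      then show "(\<lambda>n. \<kappa> * (c * \<kappa> ^ n / (1 - \<kappa>)) * W j p) \<longlonglongrightarrow> 0" by simp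
    qed
    then have "(\<lambda>n. u (Suc n) j p) \<longlonglongrightarrow> \<Phi> w j p" by (simp add: LIM_zero_iff)
    moreover have "(\<lambda>n. u (Suc n) j p) \<longlonglongrightarrow> w j p"
      using ptw[OF jp] by (rule LIMSEQ_Suc)
    ultimately show ?thesis by (rule LIMSEQ_unique)
  qed
  with Pw show ?thesis by blast
qed

section \<open>Integrals up to a moving end point\<close>

lemma integral_rescale_unit:
  fixes g :: "real \<Rightarrow> 'b::banach"
  assumes "0 \<le> m" and "continuous_on {0..m} g"
  shows "integral {0..m} g = m *\<^sub>R integral {0..1} (\<lambda>\<theta>. g (m * \<theta>))"
proof (cases "m = 0")
  case False
  then have m: "m > 0" using assms by simp
  have "(g has_integral integral {0..m} g) (cbox 0 m)"
    using integrable_continuous_real[OF assms(2)] by (simp add: integrable_integral)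
  then have "((\<lambda>x. g (m * x)) has_integral (1 / \<bar>m\<bar>) *\<^sub>R integral {0..m} g) ((\<lambda>x. x / m) ` cbox 0 m)"
    using has_integral_stretch_real[of g _ 0 m m] False by simp
  moreover have "(\<lambda>x. x / m) ` cbox 0 m = {0..1}"
    using m by (auto simp: image_iff field_simps intro!: bexI[of _ "m * _"])
  ultimately have "integral {0..1} (\<lambda>\<theta>. g (m * \<theta>)) = (1 / \<bar>m\<bar>) *\<^sub>R integral {0..m} g"
    by (simp add: integral_unique)
  then show ?thesis using m by simp
qed simp

text \<open>Rescaling to the unit interval moves the variable end point into the integrand, where
  continuity of parameter integrals over a fixed box applies.\<close>

lemma continuous_on_integral_moving:
  fixes g :: "'a::topological_space \<Rightarrow> real \<Rightarrow> 'b::banach"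
  assumes m: "continuous_on S m" "\<And>p. p \<in> S \<Longrightarrow> 0 \<le> m p"
    and g: "continuous_on {(p, u). p \<in> S \<and> u \<in> {0..m p}} (\<lambda>(p, u). g p u)"
  shows "continuous_on S (\<lambda>p. integral {0..m p} (g p))"
proof -
  have "continuous_on S (\<lambda>p. m p *\<^sub>R integral (cbox 0 1) (\<lambda>\<theta>. g p (m p * \<theta>)))"
  proof (intro continuous_intros m integral_continuous_on_param)
    have "continuous_on (S \<times> cbox 0 1) (\<lambda>p. (fst p, m (fst p) * snd p))"
      by (intro continuous_intros continuous_on_compose2[OF m(1)]) auto
    moreover have "(\<lambda>p. (fst p, m (fst p) * snd p)) ` (S \<times> cbox 0 1) \<subseteq> {(p, u). p \<in> S \<and> u \<in> {0..m p}}"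
      using m(2) by (auto simp: mult_left_le)
    ultimately have "continuous_on (S \<times> cbox 0 1) (\<lambda>p. (\<lambda>(p, u). g p u) (fst p, m (fst p) * snd p))"
      by (rule continuous_on_compose2[OF g])
    then show "continuous_on (S \<times> cbox 0 1) (\<lambda>(x, \<theta>). g x (m x * \<theta>))"
      by (simp add: case_prod_unfold)
  qed
  moreover have "integral {0..m p} (g p) = m p *\<^sub>R integral (cbox 0 1) (\<lambda>\<theta>. g p (m p * \<theta>))"
    if p: "p \<in> S" for p
  proof -
    have "continuous_on {0..m p} (\<lambda>u. (\<lambda>(p, u). g p u) (p, u))"
      by (rule continuous_on_compose2[OF g]) (auto intro!: continuous_intros p)
    then show ?thesis using integral_rescale_unit[OF m(2)[OF p], of "g p"] by simp
  qed
  ultimately show ?thesis by (simp cong: continuous_on_cong)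
qed

text \<open>The factor \<open>1 / \<gamma>\<close> gained by integrating the exponential, uniformly
  in the length \<open>m\<close>, is what makes source terms contractive for large
  \<open>\<gamma>\<close>.\<close>

lemma integral_exp_bound:
  fixes g :: "real \<Rightarrow> real"
  assumes "0 \<le> m" and "\<gamma> > 0" and K: "0 \<le> K" and g: "continuous_on {0..m} g"
    and le: "\<And>u. u \<in> {0..m} \<Longrightarrow> \<bar>g u\<bar> \<le> K * exp (\<gamma> * (t - u))"
  shows "\<bar>integral {0..m} g\<bar> \<le> K * exp (\<gamma> * t) / \<gamma>"
proof -
  have I: "((\<lambda>u. K * exp (\<gamma> * (t - u))) has_integral
      (- K * exp (\<gamma> * (t - m)) / \<gamma>) - (- K * exp (\<gamma> * (t - 0)) / \<gamma>)) {0..m}"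
    using assms(1,2)
    by (intro fundamental_theorem_of_calculus)
      (auto intro!: derivative_eq_intros simp flip: has_real_derivative_iff_has_vector_derivative)
  have "norm (integral {0..m} g) \<le> integral {0..m} (\<lambda>u. K * exp (\<gamma> * (t - u)))"
    using le g by (intro integral_norm_bound_integral integrable_continuous_real continuous_intros) auto
  also have "\<dots> = K * exp (\<gamma> * t) / \<gamma> - K * exp (\<gamma> * (t - m)) / \<gamma>"
    using integral_unique[OF I] by simp
  also have "\<dots> \<le> K * exp (\<gamma> * t) / \<gamma>" using K assms(2) by simp
  finally show ?thesis by simp
qed

text \<open>The equation \<open>\<partial>\<^sub>t w + \<partial>\<^sub>s w = F\<close> integrated along \<open>s - t = const\<close>, with inflow value
  \<open>\<beta>\<close> at \<open>s = 0\<close> and initial value \<open>w0\<close>.\<close>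

definition mild_form ::
  "(real \<Rightarrow> real) \<Rightarrow> (real \<Rightarrow> real) \<Rightarrow> (real \<times> real \<Rightarrow> real) \<Rightarrow> real \<times> real \<Rightarrow> real" where
  "mild_form \<beta> w0 F = (\<lambda>(s, t). (if s \<le> t then \<beta> (t - s) else w0 (s - t))
     + integral {0..min s t} (\<lambda>u. F (s - u, t - u)))"

text \<open>The two branches meet on the diagonal \<open>s = t\<close>, where
  \<open>\<beta> 0 = w0 0\<close> makes them agree: here compatibility of the data becomes
  continuity.\<close>

lemma continuous_on_mild_form:
  assumes \<beta>: "continuous_on {0..T} \<beta>" and w0: "continuous_on {0..\<tau>} w0" and "\<beta> 0 = w0 0"
    and F: "continuous_on ({0..\<tau>} \<times> {0..T}) F"
  shows "continuous_on ({0..\<tau>} \<times> {0..T}) (mild_form \<beta> w0 F)"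
proof -
  let ?R = "{0..\<tau>} \<times> {0..T}"
  have "continuous_on ?R (\<lambda>p. if fst p - snd p \<le> 0 then \<beta> (snd p - fst p) else w0 (fst p - snd p))"
    using assms(3)
    by (intro continuous_on_cases_le continuous_intros continuous_on_compose2[OF \<beta>] continuous_on_compose2[OF w0])
      (auto simp: algebra_simps)
  moreover have "continuous_on ?R (\<lambda>p. integral {0..min (fst p) (snd p)} (\<lambda>u. F (fst p - u, snd p - u)))"
    unfolding case_prod_unfold
    by (intro continuous_on_integral_moving continuous_intros)
      (auto intro!: continuous_intros continuous_on_compose2[OF F] simp: case_prod_unfold)
  ultimately show ?thesis
    unfolding mild_form_def case_prod_unfold diff_le_0_iff_le by (intro continuous_intros)
qed

text \<open>Moving along a characteristic keeps \<open>s - t\<close>, hence the branch and its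
  inflow or initial value; only the range of the source integral grows.\<close>

lemma mild_form_shift:
  assumes F: "continuous_on ({0..\<tau>} \<times> {0..T}) F" and "0 \<le> h" "0 \<le> s" "0 \<le> t" "s + h \<le> \<tau>" "t + h \<le> T"
  shows "mild_form \<beta> w0 F (s + h, t + h)
      = mild_form \<beta> w0 F (s, t) + integral {0..h} (\<lambda>u. F (s + h - u, t + h - u))"
proof -
  let ?m = "min s t"
  let ?g = "\<lambda>u. F (s + h - u, t + h - u)"
  have g: "continuous_on {0..?m + h} ?g"
    using assms by (intro continuous_on_compose2[OF F] continuous_intros) auto
  have "integral {0..h} ?g + integral {h..?m + h} ?g = integral {0..?m + h} ?g"
    using assms g by (intro Henstock_Kurzweil_Integration.integral_combine integrable_continuous_real) auto
  moreover have "integral {h..?m + h} ?g = integral {0..?m} (\<lambda>u. F (s - u, t - u))"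
    using integral_shift[of 0 h ?m ?g] continuous_on_subset[OF g] assms(2)
    by (simp add: o_def algebra_simps)
  moreover have "min (s + h) (t + h) = ?m + h" by simp
  ultimately have "integral {0..min (s + h) (t + h)} ?g
      = integral {0..h} ?g + integral {0..?m} (\<lambda>u. F (s - u, t - u))"
    by (simp only:)
  then show ?thesis
    unfolding mild_form_def prod.case add_le_cancel_right add_diff_cancel_right
    by (simp only: ac_simps)
qed

section \<open>The fixed point problem along characteristics\<close>

definition admissible :: "'j set \<Rightarrow> ('j \<Rightarrow> real) \<Rightarrow> real \<Rightarrow> ('j \<Rightarrow> real \<times> real \<Rightarrow> real) \<Rightarrow> bool" where
  "admissible J \<tau> T w \<longleftrightarrow> (\<forall>j\<in>J. continuous_on ({0..\<tau> j} \<times> {0..T}) (w j)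
     \<and> (\<forall>p\<in>{0..\<tau> j} \<times> {0..T}. \<bar>w j p\<bar> \<le> 1))"

text \<open>\<open>F\<close> is a causal source functional, Lipschitz on the unit ball; \<open>Bd j t\<close> maps the values leaving
  the components at time \<open>t\<close> to the value entering component \<open>j\<close>.\<close>

locale mild_problem =
  fixes J :: "'j set" and \<tau> :: "'j \<Rightarrow> real" and T L \<kappa>0 :: real
    and F :: "('j \<Rightarrow> real \<times> real \<Rightarrow> real) \<Rightarrow> 'j \<Rightarrow> real \<times> real \<Rightarrow> real"
    and Bd :: "'j \<Rightarrow> real \<Rightarrow> ('j \<Rightarrow> real) \<Rightarrow> real" and w0 :: "'j \<Rightarrow> real \<Rightarrow> real" and \<delta> :: real
  assumes \<delta>: "\<delta> \<ge> 0"
    and Fcont: "\<And>w j. admissible J \<tau> T w \<Longrightarrow> j \<in> J \<Longrightarrow> continuous_on ({0..\<tau> j} \<times> {0..T}) (F w j)"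
    and Flip: "\<And>w w' j s t M. admissible J \<tau> T w \<Longrightarrow> admissible J \<tau> T w' \<Longrightarrow> j \<in> J \<Longrightarrow> s \<in> {0..\<tau> j} \<Longrightarrow> t \<in> {0..T} \<Longrightarrow>
       (\<And>k s t'. k \<in> J \<Longrightarrow> s \<in> {0..\<tau> k} \<Longrightarrow> t' \<in> {0..t} \<Longrightarrow> \<bar>w k (s, t') - w' k (s, t')\<bar> \<le> M)
       \<Longrightarrow> \<bar>F w j (s, t) - F w' j (s, t)\<bar> \<le> L * M"
    and Fbd: "\<And>w j s t M. admissible J \<tau> T w \<Longrightarrow> j \<in> J \<Longrightarrow> s \<in> {0..\<tau> j} \<Longrightarrow> t \<in> {0..T} \<Longrightarrow>
       (\<And>k s t'. k \<in> J \<Longrightarrow> s \<in> {0..\<tau> k} \<Longrightarrow> t' \<in> {0..t} \<Longrightarrow> \<bar>w k (s, t')\<bar> \<le> M)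
       \<Longrightarrow> \<bar>F w j (s, t)\<bar> \<le> L * M"
    and Bcont: "\<And>o' j. (\<And>k. k \<in> J \<Longrightarrow> continuous_on {0..T} (o' k)) \<Longrightarrow> j \<in> J
       \<Longrightarrow> continuous_on {0..T} (\<lambda>t. Bd j t (\<lambda>k. o' k t))"
    and Blip: "\<And>j t o1 o2 M. j \<in> J \<Longrightarrow> t \<in> {0..T} \<Longrightarrow> (\<And>k. k \<in> J \<Longrightarrow> \<bar>o1 k - o2 k\<bar> \<le> M)
       \<Longrightarrow> \<bar>Bd j t o1 - Bd j t o2\<bar> \<le> \<kappa>0 * M"
    and Bbd: "\<And>j t. j \<in> J \<Longrightarrow> t \<in> {0..T} \<Longrightarrow> \<bar>Bd j t (\<lambda>_. 0)\<bar> \<le> \<delta>"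
    and w0cont: "\<And>j. j \<in> J \<Longrightarrow> continuous_on {0..\<tau> j} (w0 j)"
    and w0bd: "\<And>j s. j \<in> J \<Longrightarrow> s \<in> {0..\<tau> j} \<Longrightarrow> \<bar>w0 j s\<bar> \<le> \<delta>"
    and compat: "\<And>j. j \<in> J \<Longrightarrow> Bd j 0 (\<lambda>k. w0 k (\<tau> k)) = w0 j 0"

text \<open>The weight \<open>exp (\<gamma> t - a s)\<close> makes the inflow contract because \<open>a\<close> charges each crossing of
  a component, and the sources contract because \<open>\<gamma>\<close> is large compared with \<open>a\<close>.\<close>

theorem mild_solution_exists:
  fixes J :: "'j set" and \<tau> :: "'j \<Rightarrow> real" and T L \<kappa>0 :: real
  assumes J: "finite J" and \<tau>: "\<And>j. j \<in> J \<Longrightarrow> \<tau> j > 0" and T: "T > 0" and L: "L \<ge> 0" and \<kappa>0: "\<kappa>0 \<ge> 0"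
  obtains C where "C > 0" and "\<And>F Bd w0 \<delta>. mild_problem J \<tau> T L \<kappa>0 F Bd w0 \<delta> \<Longrightarrow> C * \<delta> \<le> 1 \<Longrightarrow>
    \<exists>w. \<forall>j\<in>J. continuous_on ({0..\<tau> j} \<times> {0..T}) (w j)
      \<and> (\<forall>p\<in>{0..\<tau> j} \<times> {0..T}. \<bar>w j p\<bar> \<le> C * \<delta>
           \<and> w j p = mild_form (\<lambda>t. Bd j t (\<lambda>k. w k (\<tau> k, t))) (w0 j) (F w j) p)
      \<and> (\<forall>s\<in>{0..\<tau> j}. w j (s, 0) = w0 j s)"
proof (cases "J = {}")
  case True
  then show ?thesis using that[of 1] by auto
next
  case False
  define \<tau>m where "\<tau>m = Min (\<tau> ` J)"
  define \<tau>M where "\<tau>M = Max (\<tau> ` J)"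
  have \<tau>m: "\<tau>m > 0" "\<And>j. j \<in> J \<Longrightarrow> \<tau>m \<le> \<tau> j" and \<tau>M: "\<And>j. j \<in> J \<Longrightarrow> \<tau> j \<le> \<tau>M"
    using False J \<tau> by (auto simp: \<tau>m_def \<tau>M_def)
  \<comment> \<open>By \<open>exp x \<ge> 1 + x\<close>, the weight factor of even the shortest
    crossing brings the scattering bound \<open>\<kappa>0\<close> down to
    \<open>1 / 4\<close>.\<close>
  define a where "a = 4 * \<kappa>0 / \<tau>m"
  have a: "a \<ge> 0" "\<kappa>0 * exp (- (a * \<tau>m)) \<le> 1 / 4"
  proof -
    show "a \<ge> 0" using \<kappa>0 \<tau>m by (simp add: a_def)
    have "a * \<tau>m = 4 * \<kappa>0" using \<tau>m by (simp add: a_def)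
    then have "4 * \<kappa>0 \<le> exp (a * \<tau>m)" using exp_ge_add_one_self[of "a * \<tau>m"] by linarith
    then show "\<kappa>0 * exp (- (a * \<tau>m)) \<le> 1 / 4" by (simp add: exp_minus field_simps)
  qed
  \<comment> \<open>\<open>\<gamma> \<ge> a\<close> makes the weight at \<open>(s, t)\<close>
    dominate the one at the foot \<open>(0, t - s)\<close> of the characteristic; the second summand
    leaves the source a share of at most \<open>1 / 4\<close>.\<close>
  define \<gamma> where "\<gamma> = a + 4 * L * exp (a * \<tau>M) + 1"
  have "0 \<le> 4 * L * exp (a * \<tau>M)" using L by simp
  then have \<gamma>: "\<gamma> > 0" "\<gamma> \<ge> a" and "4 * L * exp (a * \<tau>M) \<le> \<gamma>"
    using a unfolding \<gamma>_def by linarith+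
  then have \<gamma>L: "L / \<gamma> \<le> exp (- (a * \<tau>M)) / 4"
    by (simp add: field_simps exp_minus)
  define C where "C = 2 * exp (a * \<tau>M + \<gamma> * T)"
  define W where "W = (\<lambda>(s::real, t). exp (\<gamma> * t - a * s))"
  have Wpos: "W p > 0" for p by (simp add: W_def split: prod.split)
  define R where "R j = {0..\<tau> j} \<times> {0..T}" for j
  have Wle: "W p \<le> exp (\<gamma> * T)" if "p \<in> R j" for p j
  proof -
    have "\<gamma> * snd p \<le> \<gamma> * T" "0 \<le> a * fst p" using that \<gamma>(1) a(1) by (auto simp: R_def)
    then show ?thesis by (auto simp: W_def case_prod_unfold)
  qed
  have Wge: "exp (\<gamma> * t) * exp (- (a * \<tau>M)) \<le> W (s, t)" if "j \<in> J" "s \<in> {0..\<tau> j}" for s t j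
  proof -
    have "a * s \<le> a * \<tau>M" using that \<tau>M[OF that(1)] a(1) by (intro mult_left_mono) auto
    then show ?thesis by (simp add: W_def flip: exp_add)
  qed
  have Wout: "\<kappa>0 * (c * W (\<tau> k, t)) \<le> c / 4 * exp (\<gamma> * t)" if "k \<in> J" "c \<ge> 0" for c k t
  proof -
    have "a * \<tau>m \<le> a * \<tau> k" using \<tau>m(2)[OF that(1)] a(1) by (intro mult_left_mono)
    then have "W (\<tau> k, t) \<le> exp (\<gamma> * t) * exp (- (a * \<tau>m))" by (simp add: W_def flip: exp_add)
    then have "\<kappa>0 * (c * W (\<tau> k, t)) \<le> \<kappa>0 * (c * (exp (\<gamma> * t) * exp (- (a * \<tau>m))))"
      using \<kappa>0 that by (intro mult_left_mono) auto
    also have "\<dots> = (c * exp (\<gamma> * t)) * (\<kappa>0 * exp (- (a * \<tau>m)))" by simp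
    also have "\<dots> \<le> (c * exp (\<gamma> * t)) * (1 / 4)" using a(2) that by (intro mult_left_mono) auto
    finally show ?thesis by simp
  qed
  have Win: "exp (\<gamma> * (t - s)) \<le> W (s, t)" if "s \<ge> 0" for s t
    using mult_right_mono[OF \<gamma>(2) that] by (simp add: W_def algebra_simps)
  have Wsrc: "L * c * exp (\<gamma> * t) / \<gamma> \<le> c / 4 * W (s, t)" if "j \<in> J" "s \<in> {0..\<tau> j}" "c \<ge> 0" for j s t c
  proof -
    have "L * c * exp (\<gamma> * t) / \<gamma> = c * exp (\<gamma> * t) * (L / \<gamma>)" by simp
    also have "\<dots> \<le> c * exp (\<gamma> * t) * (exp (- (a * \<tau>M)) / 4)"
      using \<gamma>L that(3) by (intro mult_left_mono) auto
    also have "\<dots> = c / 4 * (exp (\<gamma> * t) * exp (- (a * \<tau>M)))" by simp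
    also have "\<dots> \<le> c / 4 * W (s, t)" using Wge[OF that(1,2)] that(3) by (intro mult_left_mono) auto
    finally show ?thesis .
  qed
  show ?thesis
  proof (rule that[of C])
    show "C > 0" by (simp add: C_def)
    fix F :: "('j \<Rightarrow> real \<times> real \<Rightarrow> real) \<Rightarrow> 'j \<Rightarrow> real \<times> real \<Rightarrow> real"
      and Bd :: "'j \<Rightarrow> real \<Rightarrow> ('j \<Rightarrow> real) \<Rightarrow> real" and w0 \<delta>
    assume "mild_problem J \<tau> T L \<kappa>0 F Bd w0 \<delta>" and C\<delta>: "C * \<delta> \<le> 1"
    then interpret mild_problem J \<tau> T L \<kappa>0 F Bd w0 \<delta> by simp
    \<comment> \<open>Radius of the weighted ball. The shares are \<open>1 / 4\<close> for the
      scattered waves, \<open>1 / 4\<close> for the source and \<open>1 / 2\<close> for the data,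
      the last because \<open>exp (- (a * \<tau>M))\<close> bounds the weight from below. Multiplied
      by the upper bound \<open>exp (\<gamma> * T)\<close> of the weight, the radius becomes
      \<open>C * \<delta>\<close>.\<close>
    define \<eta> where "\<eta> = 2 * \<delta> * exp (a * \<tau>M)"
    have \<eta>: "\<eta> \<ge> 0" "\<eta> * exp (\<gamma> * T) = C * \<delta>"
      using \<delta> by (auto simp: \<eta>_def C_def exp_add)
    have \<delta>W: "\<delta> \<le> \<eta> / 2 * W (s, t)" if "j \<in> J" "s \<in> {0..\<tau> j}" "t \<ge> 0" for j s t
    proof -
      have "\<gamma> * t \<ge> 0" using \<gamma>(1) that(3) by simp
      then have "exp (- (a * \<tau>M)) \<le> W (s, t)"
        using Wge[OF that(1,2), of t] by (auto intro: order_trans[rotated])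
      then have "\<eta> / 2 * exp (- (a * \<tau>M)) \<le> \<eta> / 2 * W (s, t)" using \<eta>(1) by (intro mult_left_mono) auto
      moreover have "\<eta> / 2 * exp (- (a * \<tau>M)) = \<delta>" by (simp add: \<eta>_def flip: exp_add)
      ultimately show ?thesis by simp
    qed
    define \<Phi> where "\<Phi> w j = mild_form (\<lambda>t. Bd j t (\<lambda>k. w k (\<tau> k, t))) (w0 j) (F w j)" for w j
    \<comment> \<open>The initial values belong to \<open>P\<close>: they make the inflow at time 0
      depend on \<open>w0\<close> alone, so that \<open>compat\<close> applies to every
      iterate.\<close>
    define P where "P w \<longleftrightarrow> (\<forall>j\<in>J. continuous_on (R j) (w j) \<and> (\<forall>p\<in>R j. \<bar>w j p\<bar> \<le> \<eta> * W p)
        \<and> (\<forall>s\<in>{0..\<tau> j}. w j (s, 0) = w0 j s))" for w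
    have Padm: "admissible J \<tau> T w" if "P w" for w
    proof -
      have "\<bar>w j p\<bar> \<le> 1" if "j \<in> J" "p \<in> R j" for j p
      proof -
        have "\<bar>w j p\<bar> \<le> \<eta> * W p" using \<open>P w\<close> that by (auto simp: P_def)
        also have "\<dots> \<le> \<eta> * exp (\<gamma> * T)" using Wle[OF that(2)] \<eta>(1) by (intro mult_left_mono)
        finally show ?thesis using \<eta>(2) C\<delta> by simp
      qed
      then show ?thesis using that unfolding admissible_def P_def R_def by blast
    qed
    have tau0: "\<tau> j \<in> {0..\<tau> j}" "0 \<in> {0..\<tau> j}" if "j \<in> J" for j using \<tau>[OF that] by auto
    have exp_le: "W (s, t') \<le> exp (\<gamma> * t)" if "s \<ge> 0" "t' \<le> t" for s t t'
    proof -
      have "0 \<le> a * s" "\<gamma> * t' \<le> \<gamma> * t"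
        using a(1) that \<gamma>(1) by (auto intro: mult_left_mono)
      then show ?thesis by (simp add: W_def)
    qed
    have bcont: "continuous_on {0..T} (\<lambda>t. Bd j t (\<lambda>k. w k (\<tau> k, t)))" if "P w" "j \<in> J" for w j
    proof (rule Bcont[OF _ that(2)])
      fix k assume k: "k \<in> J"
      then have "continuous_on ({0..\<tau> k} \<times> {0..T}) (w k)" using that(1) by (simp add: P_def R_def)
      then show "continuous_on {0..T} (\<lambda>t. w k (\<tau> k, t))"
        by (rule continuous_on_compose2) (use \<tau>[OF k] in \<open>auto intro!: continuous_intros\<close>)
    qed
    have \<Phi>cont: "continuous_on (R j) (\<Phi> w j)" if "P w" "j \<in> J" for w j
      unfolding \<Phi>_def R_def
    proof (rule continuous_on_mild_form[OF bcont[OF that] w0cont[OF that(2)] _ Fcont[OF Padm[OF that(1)] that(2)]])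
      \<comment> \<open>The Lipschitz bound with \<open>M = 0\<close> says that \<open>Bd\<close>
        only sees arguments indexed by \<open>J\<close>, where the two families coincide.\<close>
      have "\<bar>Bd j 0 (\<lambda>k. w k (\<tau> k, 0)) - Bd j 0 (\<lambda>k. w0 k (\<tau> k))\<bar> \<le> \<kappa>0 * 0"
        using that T tau0 by (intro Blip) (auto simp: P_def)
      then show "Bd j 0 (\<lambda>k. w k (\<tau> k, 0)) = w0 j 0" using compat[OF that(2)] by simp
    qed
    have Fint: "continuous_on {0..min s t} (\<lambda>u. F w j (s - u, t - u))"
      if "P w" "j \<in> J" "s \<in> {0..\<tau> j}" "t \<in> {0..T}" for w j s t
      using that by (intro continuous_on_compose2[OF Fcont[OF Padm[OF that(1)] that(2)]] continuous_intros) auto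
    show "\<exists>w. \<forall>j\<in>J. continuous_on ({0..\<tau> j} \<times> {0..T}) (w j)
          \<and> (\<forall>p\<in>{0..\<tau> j} \<times> {0..T}. \<bar>w j p\<bar> \<le> C * \<delta>
               \<and> w j p = mild_form (\<lambda>t. Bd j t (\<lambda>k. w k (\<tau> k, t))) (w0 j) (F w j) p)
          \<and> (\<forall>s\<in>{0..\<tau> j}. w j (s, 0) = w0 j s)"
    proof -
      have contr: "\<bar>\<Phi> v j (s, t) - \<Phi> v' j (s, t)\<bar> \<le> 1 / 2 * c * W (s, t)"
        if P: "P v" "P v'" and c: "\<And>k p. k \<in> J \<Longrightarrow> p \<in> R k \<Longrightarrow> \<bar>v k p - v' k p\<bar> \<le> c * W p"
          and j: "j \<in> J" and st: "s \<in> {0..\<tau> j}" "t \<in> {0..T}" for v v' c j s t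
      proof -
        \<comment> \<open>The constant is arbitrary in the contraction hypothesis, so its sign is
          read off at one point, where the weight is positive.\<close>
        have c0: "c \<ge> 0"
          using c[OF j, of "(s, t)"] st Wpos[of "(s, t)"]
          by (auto simp: R_def) (meson abs_ge_zero order_trans zero_le_mult_iff not_le)
        have foot: "\<bar>Bd j (t - s) (\<lambda>k. v k (\<tau> k, t - s)) - Bd j (t - s) (\<lambda>k. v' k (\<tau> k, t - s))\<bar>
            \<le> c / 4 * W (s, t)" if "s \<le> t"
        proof -
          \<comment> \<open>\<open>Blip\<close> asks for one bound over all exits. The maximum is
            attained at some \<open>k\<close>, whose exit weight carries the factor of a full
            crossing.\<close>
          define M where "M = Max ((\<lambda>k. c * W (\<tau> k, t - s)) ` J)"
          have M: "c * W (\<tau> k, t - s) \<le> M" if "k \<in> J" for k unfolding M_def using that J by (intro Max_ge) auto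
          have "M \<in> (\<lambda>k. c * W (\<tau> k, t - s)) ` J"
            unfolding M_def using J False by (intro Max_in) auto
          then obtain k where k: "k \<in> J" "M = c * W (\<tau> k, t - s)" by auto
          have "\<bar>Bd j (t - s) (\<lambda>k. v k (\<tau> k, t - s)) - Bd j (t - s) (\<lambda>k. v' k (\<tau> k, t - s))\<bar> \<le> \<kappa>0 * M"
            using st that tau0 by (intro Blip j order_trans[OF c M]) (auto simp: R_def)
          also have "\<dots> \<le> c / 4 * exp (\<gamma> * (t - s))" unfolding k(2) by (rule Wout[OF k(1) c0])
          also have "\<dots> \<le> c / 4 * W (s, t)" using Win[of s t] st c0 by (intro mult_left_mono) auto
          finally show ?thesis .
        qed
        have "\<bar>integral {0..min s t} (\<lambda>u. F v j (s - u, t - u) - F v' j (s - u, t - u))\<bar>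
            \<le> (L * c) * exp (\<gamma> * t) / \<gamma>"
        proof (rule integral_exp_bound)
          fix u assume u: "u \<in> {0..min s t}"
          have "\<bar>F v j (s - u, t - u) - F v' j (s - u, t - u)\<bar> \<le> L * (c * exp (\<gamma> * (t - u)))"
          proof (rule Flip[OF Padm[OF P(1)] Padm[OF P(2)] j])
            fix k s' t' assume k: "k \<in> J" "s' \<in> {0..\<tau> k}" "t' \<in> {0..t - u}"
            then have "\<bar>v k (s', t') - v' k (s', t')\<bar> \<le> c * W (s', t')"
              using st u by (intro c) (auto simp: R_def)
            also have "\<dots> \<le> c * exp (\<gamma> * (t - u))" using k by (intro mult_left_mono exp_le c0) auto
            finally show "\<bar>v k (s', t') - v' k (s', t')\<bar> \<le> c * exp (\<gamma> * (t - u))" .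
          qed (use u st in auto)
          then show "\<bar>F v j (s - u, t - u) - F v' j (s - u, t - u)\<bar> \<le> L * c * exp (\<gamma> * (t - u))"
            by (simp add: mult.assoc)
        qed (use st \<gamma> L c0 in \<open>auto intro!: continuous_intros Fint P j\<close>)
        from order_trans[OF this Wsrc[OF j st(1) c0]]
        have src: "\<bar>integral {0..min s t} (\<lambda>u. F v j (s - u, t - u))
            - integral {0..min s t} (\<lambda>u. F v' j (s - u, t - u))\<bar> \<le> c / 4 * W (s, t)"
          by (subst integral_diff[symmetric]) (auto intro!: integrable_continuous_real Fint P j simp: st[simplified])
        show ?thesis
        proof (cases "s \<le> t")
          case True
          define b b' I I' where "b = Bd j (t - s) (\<lambda>k. v k (\<tau> k, t - s))"
            and "b' = Bd j (t - s) (\<lambda>k. v' k (\<tau> k, t - s))"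
            and "I = integral {0..min s t} (\<lambda>u. F v j (s - u, t - u))"
            and "I' = integral {0..min s t} (\<lambda>u. F v' j (s - u, t - u))"
          have "\<Phi> v j (s, t) - \<Phi> v' j (s, t) = (b - b') + (I - I')"
            using True by (simp add: \<Phi>_def mild_form_def b_def b'_def I_def I'_def)
          moreover have "\<bar>b - b'\<bar> \<le> c / 4 * W (s, t)" "\<bar>I - I'\<bar> \<le> c / 4 * W (s, t)"
            using foot[OF True] src unfolding b_def b'_def I_def I'_def by auto
          ultimately show ?thesis using abs_triangle_ineq[of "b - b'" "I - I'"] by linarith
        next
          case False
          have "0 \<le> c * W (s, t)" using c0 Wpos[of "(s, t)"] by simp
          then show ?thesis using False src by (simp add: \<Phi>_def mild_form_def)
        qed
      qed
      have bound: "\<bar>\<Phi> v j (s, t)\<bar> \<le> \<eta> * W (s, t)"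
        if P: "P v" and j: "j \<in> J" and st: "s \<in> {0..\<tau> j}" "t \<in> {0..T}" for v j s t
      proof -
        have v: "\<bar>v k p\<bar> \<le> \<eta> * W p" if "k \<in> J" "p \<in> R k" for k p using P that by (auto simp: P_def)
        have foot: "\<bar>Bd j (t - s) (\<lambda>k. v k (\<tau> k, t - s))\<bar> \<le> \<eta> / 4 * W (s, t) + \<delta>" if "s \<le> t"
        proof -
          define M where "M = Max ((\<lambda>k. \<eta> * W (\<tau> k, t - s)) ` J)"
          have M: "\<eta> * W (\<tau> k, t - s) \<le> M" if "k \<in> J" for k unfolding M_def using that J by (intro Max_ge) auto
          have "M \<in> (\<lambda>k. \<eta> * W (\<tau> k, t - s)) ` J"
            unfolding M_def using J False by (intro Max_in) auto
          then obtain k where k: "k \<in> J" "M = \<eta> * W (\<tau> k, t - s)" by auto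
          have "\<bar>v k (\<tau> k, t - s) - 0\<bar> \<le> M" if "k \<in> J" for k
            using st \<open>s \<le> t\<close> tau0[OF that] order_trans[OF v[OF that, of "(\<tau> k, t - s)"] M[OF that]]
            by (auto simp: R_def)
          then have "\<bar>Bd j (t - s) (\<lambda>k. v k (\<tau> k, t - s)) - Bd j (t - s) (\<lambda>_. 0)\<bar> \<le> \<kappa>0 * M"
            using st that by (intro Blip j) auto
          also have "\<dots> \<le> \<eta> / 4 * exp (\<gamma> * (t - s))" unfolding k(2) by (rule Wout[OF k(1) \<eta>(1)])
          also have "\<dots> \<le> \<eta> / 4 * W (s, t)" using Win[of s t] st \<eta> by (intro mult_left_mono) auto
          finally have "\<bar>Bd j (t - s) (\<lambda>k. v k (\<tau> k, t - s)) - Bd j (t - s) (\<lambda>_. 0)\<bar> \<le> \<eta> / 4 * W (s, t)" .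
          moreover have "\<bar>Bd j (t - s) (\<lambda>_. 0)\<bar> \<le> \<delta>" using Bbd[OF j, of "t - s"] st that by auto
          ultimately show ?thesis by linarith
        qed
        have "\<bar>integral {0..min s t} (\<lambda>u. F v j (s - u, t - u))\<bar> \<le> (L * \<eta>) * exp (\<gamma> * t) / \<gamma>"
        proof (rule integral_exp_bound)
          fix u assume u: "u \<in> {0..min s t}"
          have "\<bar>F v j (s - u, t - u)\<bar> \<le> L * (\<eta> * exp (\<gamma> * (t - u)))"
          proof (rule Fbd[OF Padm[OF P] j])
            fix k s' t' assume k: "k \<in> J" "s' \<in> {0..\<tau> k}" "t' \<in> {0..t - u}"
            then have "\<bar>v k (s', t')\<bar> \<le> \<eta> * W (s', t')"
              using st u by (intro v) (auto simp: R_def)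
            also have "\<dots> \<le> \<eta> * exp (\<gamma> * (t - u))" using k by (intro mult_left_mono exp_le \<eta>) auto
            finally show "\<bar>v k (s', t')\<bar> \<le> \<eta> * exp (\<gamma> * (t - u))" .
          qed (use u st in auto)
          then show "\<bar>F v j (s - u, t - u)\<bar> \<le> L * \<eta> * exp (\<gamma> * (t - u))"
            by (simp add: mult.assoc)
        qed (use st \<gamma> L \<eta> in \<open>auto intro!: continuous_intros Fint P j\<close>)
        from order_trans[OF this Wsrc[OF j st(1) \<eta>(1)]]
        have src: "\<bar>integral {0..min s t} (\<lambda>u. F v j (s - u, t - u))\<bar> \<le> \<eta> / 4 * W (s, t)" .
        have "\<bar>w0 j (s - t)\<bar> \<le> \<delta>" if "\<not> s \<le> t" using st that by (intro w0bd j) auto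
        then have "\<bar>if s \<le> t then Bd j (t - s) (\<lambda>k. v k (\<tau> k, t - s)) else w0 j (s - t)\<bar> \<le> \<eta> / 4 * W (s, t) + \<delta>"
          using foot mult_nonneg_nonneg[OF \<eta>(1) less_imp_le[OF Wpos[of "(s, t)"]]] by auto
        moreover have "\<delta> \<le> \<eta> / 2 * W (s, t)" using \<delta>W[OF j st(1), of t] st by simp
        ultimately show ?thesis
          using src unfolding \<Phi>_def mild_form_def prod.case by linarith
      qed
      have P\<Phi>: "P (\<Phi> v)" if "P v" for v
        unfolding P_def
      proof (intro ballI conjI \<Phi>cont that)
        fix j p assume "j \<in> J" "p \<in> R j"
        then show "\<bar>\<Phi> v j p\<bar> \<le> \<eta> * W p" using bound[OF that, of j "fst p" "snd p"] by (auto simp: R_def)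
      next
        fix j s assume js: "j \<in> J" "s \<in> {0..\<tau> j}"
        have "Bd j 0 (\<lambda>k. v k (\<tau> k, 0)) = w0 j 0"
        proof -
          have "\<bar>Bd j 0 (\<lambda>k. v k (\<tau> k, 0)) - Bd j 0 (\<lambda>k. w0 k (\<tau> k))\<bar> \<le> \<kappa>0 * 0"
            using that js T tau0 by (intro Blip) (auto simp: P_def)
          then show ?thesis using compat[OF js(1)] by simp
        qed
        then show "\<Phi> v j (s, 0) = w0 j s" using js by (auto simp: \<Phi>_def mild_form_def)
      qed
      \<comment> \<open>The iteration starts from the initial profile frozen in time, which already
        satisfies \<open>P\<close>.\<close>
      define u0 where "u0 j p = w0 j (fst p)" for j and p :: "real \<times> real"
      have Pu0: "P u0"
        unfolding P_def
      proof (intro ballI conjI)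
        fix j assume j: "j \<in> J"
        show "continuous_on (R j) (u0 j)"
          unfolding u0_def R_def by (intro continuous_on_compose2[OF w0cont[OF j]] continuous_intros) auto
        fix p assume p: "p \<in> R j"
        have "\<bar>u0 j p\<bar> \<le> \<delta>" using p by (auto simp: u0_def R_def intro!: w0bd j)
        also have "\<dots> \<le> \<eta> / 2 * W p" using \<delta>W[OF j, of "fst p" "snd p"] p by (auto simp: R_def)
        also have "\<dots> \<le> \<eta> * W p" using \<eta>(1) Wpos[of p] by (intro mult_right_mono) auto
        finally show "\<bar>u0 j p\<bar> \<le> \<eta> * W p" .
      qed (simp add: u0_def)
      have "\<exists>w. P w \<and> (\<forall>j\<in>J. \<forall>p\<in>R j. \<Phi> w j p = w j p)"
      proof (rule picard_fixed_point[where W = "\<lambda>_. W" and Wmax = "exp (\<gamma> * T)" and \<kappa> = "1 / 2"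
            and ?c0.0 = "2 * \<eta>", OF _ _ _ Pu0 P\<Phi>])
        fix j p assume "j \<in> J" "p \<in> R j"
        then show "0 \<le> W p \<and> W p \<le> exp (\<gamma> * T)" using Wpos[of p] Wle by auto
        have "\<bar>u0 j p\<bar> \<le> \<eta> * W p" "\<bar>\<Phi> u0 j p\<bar> \<le> \<eta> * W p"
          using Pu0 P\<Phi>[OF Pu0] \<open>j \<in> J\<close> \<open>p \<in> R j\<close> by (auto simp: P_def)
        then show "\<bar>\<Phi> u0 j p - u0 j p\<bar> \<le> 2 * \<eta> * W p" by linarith
      next
        fix u v c j p
        assume "P u" "P v" "\<And>k p. k \<in> J \<Longrightarrow> p \<in> R k \<Longrightarrow> \<bar>u k p - v k p\<bar> \<le> c * W p" "j \<in> J" "p \<in> R j"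
        then show "\<bar>\<Phi> u j p - \<Phi> v j p\<bar> \<le> 1 / 2 * c * W p"
          using contr[of u v c j "fst p" "snd p"] by (auto simp: R_def)
      next
        fix u w assume Pu: "\<And>n. P (u n)"
          and lim: "\<And>j. j \<in> J \<Longrightarrow> uniform_limit (R j) (\<lambda>n. u n j) (w j) sequentially"
        show "P w"
          unfolding P_def
        proof (intro ballI conjI)
          fix j assume j: "j \<in> J"
          show "continuous_on (R j) (w j)"
            using Pu j by (intro uniform_limit_theorem[OF _ lim[OF j]]) (auto simp: P_def)
          have pt: "(\<lambda>n. u n j p) \<longlonglongrightarrow> w j p" if "p \<in> R j" for p
            using tendsto_uniform_limitI[OF lim[OF j] that] .
          show "\<bar>w j p\<bar> \<le> \<eta> * W p" if "p \<in> R j" for p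
            using Pu j that by (intro tendsto_upperbound[OF tendsto_rabs[OF pt[OF that]]]) (auto simp: P_def)
          show "w j (s, 0) = w0 j s" if "s \<in> {0..\<tau> j}" for s
          proof -
            have "(s, 0) \<in> R j" using that T by (auto simp: R_def)
            from pt[OF this] show ?thesis
              using Pu j that by (auto simp: P_def LIMSEQ_const_iff)
          qed
        qed
      qed auto
      then obtain w where w: "P w" "\<And>j p. j \<in> J \<Longrightarrow> p \<in> R j \<Longrightarrow> \<Phi> w j p = w j p" by blast
      have "\<bar>w j p\<bar> \<le> C * \<delta>" if "j \<in> J" "p \<in> R j" for j p
      proof -
        have "\<bar>w j p\<bar> \<le> \<eta> * W p" using w(1) that by (auto simp: P_def)
        also have "\<dots> \<le> \<eta> * exp (\<gamma> * T)" using Wle[OF that(2)] \<eta>(1) by (intro mult_left_mono)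
        finally show ?thesis using \<eta>(2) by simp
      qed
      then show ?thesis using w unfolding P_def \<Phi>_def R_def by (intro exI[of _ w]) auto
    qed
  qed
qed

section \<open>Differentiability in space of time integrals\<close>

lemma integral_near_const:
  fixes g :: "real \<Rightarrow> real"
  assumes "a \<le> b" and g: "continuous_on {a..b} g" and le: "\<And>u. u \<in> {a..b} \<Longrightarrow> \<bar>g u - c\<bar> \<le> e"
  shows "\<bar>integral {a..b} g - (b - a) * c\<bar> \<le> (b - a) * e"
proof -
  have "integral {a..b} (\<lambda>u. g u - c) = integral {a..b} g - (b - a) * c"
    using assms(1) by (subst integral_diff) (auto intro: integrable_continuous_real[OF g])
  moreover have "norm (integral {a..b} (\<lambda>u. g u - c)) \<le> integral {a..b} (\<lambda>u. e)"
    using le by (intro integral_norm_bound_integral integrable_continuous_real continuous_intros g) auto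
  ultimately show ?thesis using assms(1) by simp
qed

lemma continuous_on_uniform2:
  fixes f g :: "'a::heine_borel \<Rightarrow> real"
  assumes "compact K" "continuous_on K f" "continuous_on K g" "e > 0"
  obtains d where "d > 0" "\<And>p q. p \<in> K \<Longrightarrow> q \<in> K \<Longrightarrow> dist p q < d \<Longrightarrow> \<bar>f p - f q\<bar> \<le> e \<and> \<bar>g p - g q\<bar> \<le> e"
proof -
  obtain d1 where "d1 > 0" and d1: "\<forall>x\<in>K. \<forall>x'\<in>K. dist x' x < d1 \<longrightarrow> dist (f x') (f x) < e"
    using compact_uniformly_continuous[OF assms(2,1)] assms(4) unfolding uniformly_continuous_on_def by blast
  obtain d2 where "d2 > 0" and d2: "\<forall>x\<in>K. \<forall>x'\<in>K. dist x' x < d2 \<longrightarrow> dist (g x') (g x) < e"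
    using compact_uniformly_continuous[OF assms(3,1)] assms(4) unfolding uniformly_continuous_on_def by blast
  show ?thesis
  proof (rule that[of "min d1 d2"])
    fix p q assume "p \<in> K" "q \<in> K" "dist p q < min d1 d2"
    then show "\<bar>f p - f q\<bar> \<le> e \<and> \<bar>g p - g q\<bar> \<le> e"
      using d1 d2 by (auto simp: dist_real_def less_imp_le)
  qed (use \<open>d1 > 0\<close> \<open>d2 > 0\<close> in auto)
qed

text \<open>Integrating \<open>\<partial>\<^sub>t w + \<partial>\<^sub>s w = F\<close> in time shows that a time antiderivative of a merely
  continuous mild solution is differentiable in space.\<close>

lemma time_integral_has_space_derivative:
  fixes w F :: "real \<times> real \<Rightarrow> real"
  assumes T: "0 \<le> T"
    and w: "continuous_on ({0..\<tau>} \<times> {0..T}) w" and F: "continuous_on ({0..\<tau>} \<times> {0..T}) F"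
    and shift: "\<And>s t h. 0 \<le> h \<Longrightarrow> 0 \<le> s \<Longrightarrow> 0 \<le> t \<Longrightarrow> s + h \<le> \<tau> \<Longrightarrow> t + h \<le> T \<Longrightarrow>
      w (s + h, t + h) = w (s, t) + integral {0..h} (\<lambda>u. F (s + h - u, t + h - u))"
    and s: "s \<in> {0..\<tau>}" and t: "t \<in> {0..T}"
  shows "((\<lambda>s. integral {0..t} (\<lambda>t'. w (s, t'))) has_vector_derivative
      w (s, 0) - w (s, t) + integral {0..t} (\<lambda>t'. F (s, t'))) (at s within {0..\<tau>})"
proof (cases "t = 0")
  case True
  then show ?thesis by simp
next
  case False
  let ?R = "{0..\<tau>} \<times> {0..T}"
  define V where "V s = integral {0..t} (\<lambda>t'. w (s, t'))" for s
  define X where "X = w (s, 0) - w (s, t) + integral {0..t} (\<lambda>t'. F (s, t'))"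
  have t0: "0 < t" using False t by simp
  have wc: "continuous_on {a..b} (\<lambda>t'. w (s', t'))" if "0 \<le> a" "b \<le> T" "s' \<in> {0..\<tau>}" for a b s'
    using that by (intro continuous_on_compose2[OF w] continuous_intros) auto
  have Fc: "continuous_on {a..b} (\<lambda>t'. F (s', t'))" if "0 \<le> a" "b \<le> T" "s' \<in> {0..\<tau>}" for a b s'
    using that by (intro continuous_on_compose2[OF F] continuous_intros) auto
  have R: "compact ?R" by (simp add: compact_Times)
  have "bounded (F ` ?R)" using R F by (intro compact_imp_bounded compact_continuous_image)
  then obtain Fm where Fm: "Fm > 0" "\<And>p. p \<in> ?R \<Longrightarrow> \<bar>F p\<bar> \<le> Fm"
    unfolding bounded_pos by auto
  \<comment> \<open>\<open>s\<close> may lie anywhere between \<open>s1\<close> and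
    \<open>s2\<close>, so that one estimate serves the difference quotients from the left and from
    the right.\<close>
  have incr: "\<bar>V s2 - V s1 - (s2 - s1) * X\<bar> \<le> e * (T + 3) * (s2 - s1)"
    if e: "e > 0" and d: "\<And>p q. p \<in> ?R \<Longrightarrow> q \<in> ?R \<Longrightarrow> dist p q < d \<Longrightarrow> \<bar>w p - w q\<bar> \<le> e \<and> \<bar>F p - F q\<bar> \<le> e"
      and s12: "0 \<le> s1" "s1 \<le> s2" "s2 \<le> \<tau>" and near: "s1 \<le> s" "s \<le> s2"
      and h: "s2 - s1 \<le> t" "2 * (s2 - s1) < d" "Fm * (s2 - s1) \<le> e" for e d s1 s2
  proof -
    define h where "h = s2 - s1"
    have h0: "0 \<le> h" "h \<le> t" "2 * h < d" "Fm * h \<le> e" using s12 h by (auto simp: h_def)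
    have s2: "s2 = s1 + h" by (simp add: h_def)
    have sR: "s1 \<in> {0..\<tau>}" "s2 \<in> {0..\<tau>}" "s \<in> {0..\<tau>}" using s12 s by auto
    have close: "\<bar>w (a, b) - w (s, b')\<bar> \<le> e \<and> \<bar>F (a, b) - F (s, b')\<bar> \<le> e"
      if "s1 \<le> a" "a \<le> s2" "\<bar>b - b'\<bar> \<le> h" "b \<in> {0..T}" "b' \<in> {0..T}" for a b b'
    proof (rule d)
      have "\<bar>a - s\<bar> \<le> h" using that near by (auto simp: h_def)
      then have "dist (a, b) (s, b') \<le> h + h"
        unfolding dist_Pair_Pair dist_real_def
        using sqrt_sum_squares_le_sum_abs[of "\<bar>a - s\<bar>" "\<bar>b - b'\<bar>"] that(3) by simp
      then show "dist (a, b) (s, b') < d" using h0 by simp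
    qed (use that s12 sR in auto)
    define I where "I t' = integral {0..h} (\<lambda>u. F (s1 + h - u, t' + h - u))" for t'
    have I: "I t' = w (s2, t' + h) - w (s1, t')" if "t' \<in> {0..t - h}" for t'
      using shift[of h s1 t'] that s12 h0 t unfolding I_def s2 by simp
    have wh: "continuous_on {0..t - h} (\<lambda>t'. w (s2, t' + h))"
      using h0 t sR by (intro continuous_on_compose2[OF w] continuous_intros) auto
    have Ic: "continuous_on {0..t - h} I"
    proof -
      have "continuous_on {0..t - h} (\<lambda>t'. w (s2, t' + h) - w (s1, t'))"
        using h0 t sR by (intro continuous_intros wh wc) auto
      then show ?thesis by (rule continuous_on_eq) (simp add: I)
    qed
    \<comment> \<open>The times after \<open>h\<close> at \<open>s2\<close> are matched along
      characteristics with the times before \<open>t - h\<close> at \<open>s1\<close>. What remains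
      are two slabs of width \<open>h\<close>, which yield \<open>w (s, 0)\<close> and
      \<open>w (s, t)\<close>, and the integral of the source.\<close>
    have "V s2 = integral {0..h} (\<lambda>t'. w (s2, t')) + integral {h..t} (\<lambda>t'. w (s2, t'))"
      unfolding V_def using h0 t sR
      by (intro Henstock_Kurzweil_Integration.integral_combine[symmetric] integrable_continuous_real wc) auto
    also have "integral {h..t} (\<lambda>t'. w (s2, t')) = integral {0..t - h} (\<lambda>t'. w (s2, t' + h))"
      using integral_shift[of 0 h "t - h" "\<lambda>t'. w (s2, t')"] wc[of h t s2] h0 t sR by (simp add: o_def)
    also have "\<dots> = integral {0..t - h} (\<lambda>t'. w (s1, t') + I t')"
      by (intro integral_cong) (simp add: I)
    also have "\<dots> = integral {0..t - h} (\<lambda>t'. w (s1, t')) + integral {0..t - h} I"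
      using h0 t sR by (intro integral_add integrable_continuous_real wc Ic) auto
    also have "integral {0..t - h} (\<lambda>t'. w (s1, t')) = V s1 - integral {t - h..t} (\<lambda>t'. w (s1, t'))"
      unfolding V_def using h0 t sR
        Henstock_Kurzweil_Integration.integral_combine[of 0 "t - h" t "\<lambda>t'. w (s1, t')"]
        integrable_continuous_real[OF wc[of 0 t s1]] by auto
    finally have V: "V s2 - V s1 = integral {0..h} (\<lambda>t'. w (s2, t'))
        - integral {t - h..t} (\<lambda>t'. w (s1, t')) + integral {0..t - h} I"
      by simp
    have 1: "\<bar>integral {0..h} (\<lambda>t'. w (s2, t')) - (h - 0) * w (s, 0)\<bar> \<le> (h - 0) * e"
    proof (rule integral_near_const)
      fix u assume u: "u \<in> {0..h}"
      have "\<bar>w (s2, u) - w (s, 0)\<bar> \<le> e \<and> \<bar>F (s2, u) - F (s, 0)\<bar> \<le> e"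
        by (rule close) (use u h0 t sR s12 in auto)
      then show "\<bar>w (s2, u) - w (s, 0)\<bar> \<le> e" ..
    qed (use h0 t sR in \<open>auto intro!: wc\<close>)
    have 2: "\<bar>integral {t - h..t} (\<lambda>t'. w (s1, t')) - (t - (t - h)) * w (s, t)\<bar> \<le> (t - (t - h)) * e"
    proof (rule integral_near_const)
      fix u assume u: "u \<in> {t - h..t}"
      have "\<bar>w (s1, u) - w (s, t)\<bar> \<le> e \<and> \<bar>F (s1, u) - F (s, t)\<bar> \<le> e"
        by (rule close) (use u h0 t sR s12 in auto)
      then show "\<bar>w (s1, u) - w (s, t)\<bar> \<le> e" ..
    qed (use h0 t sR in \<open>auto intro!: wc\<close>)
    have Inear: "\<bar>I t' - h * F (s, t')\<bar> \<le> h * e" if t': "t' \<in> {0..t - h}" for t'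
    proof -
      have "\<bar>integral {0..h} (\<lambda>u. F (s1 + h - u, t' + h - u)) - (h - 0) * F (s, t')\<bar> \<le> (h - 0) * e"
      proof (rule integral_near_const)
        fix u assume u: "u \<in> {0..h}"
        have "\<bar>w (s1 + h - u, t' + h - u) - w (s, t')\<bar> \<le> e \<and> \<bar>F (s1 + h - u, t' + h - u) - F (s, t')\<bar> \<le> e"
          by (rule close) (use u t' h0 t sR s12 in \<open>auto simp: h_def\<close>)
        then show "\<bar>F (s1 + h - u, t' + h - u) - F (s, t')\<bar> \<le> e" ..
      next
        show "continuous_on {0..h} (\<lambda>u. F (s1 + h - u, t' + h - u))"
          using t' h0 t sR s12 by (intro continuous_on_compose2[OF F] continuous_intros) (auto simp: s2)
      qed (use h0 in auto)
      then show ?thesis by (simp add: I_def)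
    qed
    have "norm (integral {0..t - h} (\<lambda>t'. I t' - h * F (s, t'))) \<le> integral {0..t - h} (\<lambda>_. h * e)"
      using Inear h0 t sR
      by (intro integral_norm_bound_integral integrable_continuous_real continuous_intros Ic Fc) auto
    also have "integral {0..t - h} (\<lambda>_. h * e) = (t - h) * (h * e)" using h0 by simp
    also have "\<dots> \<le> T * (h * e)" using h0 e t by (intro mult_right_mono) auto
    also have "integral {0..t - h} (\<lambda>t'. I t' - h * F (s, t'))
        = integral {0..t - h} I - h * integral {0..t - h} (\<lambda>t'. F (s, t'))"
      using h0 t sR
      by (subst integral_diff) (auto intro!: integrable_continuous_real continuous_intros Ic Fc)
    finally have 3: "\<bar>integral {0..t - h} I - h * integral {0..t - h} (\<lambda>t'. F (s, t'))\<bar> \<le> T * (h * e)"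
      by simp
    have "\<bar>integral {t - h..t} (\<lambda>t'. F (s, t')) - (t - (t - h)) * 0\<bar> \<le> (t - (t - h)) * Fm"
      using Fm(2) h0 t sR by (intro integral_near_const Fc) auto
    then have "\<bar>integral {t - h..t} (\<lambda>t'. F (s, t'))\<bar> \<le> e" using h0 by (simp add: mult.commute)
    then have 4: "\<bar>h * integral {t - h..t} (\<lambda>t'. F (s, t'))\<bar> \<le> h * e"
      using h0 by (simp add: abs_mult mult_left_mono)
    have "integral {0..t} (\<lambda>t'. F (s, t')) = integral {0..t - h} (\<lambda>t'. F (s, t')) + integral {t - h..t} (\<lambda>t'. F (s, t'))"
      using h0 t sR
      by (intro Henstock_Kurzweil_Integration.integral_combine[symmetric] integrable_continuous_real Fc) auto
    then have "V s2 - V s1 - h * X = (integral {0..h} (\<lambda>t'. w (s2, t')) - h * w (s, 0))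
        - (integral {t - h..t} (\<lambda>t'. w (s1, t')) - h * w (s, t))
        + (integral {0..t - h} I - h * integral {0..t - h} (\<lambda>t'. F (s, t')))
        - h * integral {t - h..t} (\<lambda>t'. F (s, t'))"
      unfolding V X_def by (simp add: algebra_simps)
    also have "\<bar>\<dots>\<bar> \<le> h * e + h * e + T * (h * e) + h * e"
      using 1 2 3 4 by (simp only: diff_zero diff_diff_eq2 add_diff_cancel_left' add_diff_cancel_right')
    also have "\<dots> = e * (T + 3) * h" by (simp add: algebra_simps)
    finally show ?thesis by (simp add: h_def)
  qed
  have "(V has_derivative (\<lambda>x. x *\<^sub>R X)) (at s within {0..\<tau>})"
    unfolding has_derivative_within_alt
  proof (intro conjI allI impI bounded_linear_scaleR_left)
    fix e :: real assume e: "e > 0"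
    \<comment> \<open>The errors per unit of length are \<open>e'\<close> for each of the two slabs,
      \<open>T * e'\<close> for the source and \<open>e'\<close> for the slab missing in its
      integral: in total \<open>(T + 3) * e'\<close>.\<close>
    define e' where "e' = e / (T + 3)"
    have e': "e' > 0" "e' * (T + 3) = e" using e T by (auto simp: e'_def field_simps)
    obtain d where d: "d > 0" "\<And>p q. p \<in> ?R \<Longrightarrow> q \<in> ?R \<Longrightarrow> dist p q < d \<Longrightarrow> \<bar>w p - w q\<bar> \<le> e' \<and> \<bar>F p - F q\<bar> \<le> e'"
      using continuous_on_uniform2[OF R w F e'(1)] by metis
    let ?d = "min t (min (d / 2) (e' / Fm))"
    show "\<exists>d>0. \<forall>y\<in>{0..\<tau>}. norm (y - s) < d \<longrightarrow> norm (V y - V s - (y - s) *\<^sub>R X) \<le> e * norm (y - s)"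
    proof (intro exI[of _ ?d] conjI ballI impI)
      show "?d > 0" using t0 d(1) e'(1) Fm(1) by simp
      fix y assume y: "y \<in> {0..\<tau>}" "norm (y - s) < ?d"
      then have y': "\<bar>y - s\<bar> \<le> t" "2 * \<bar>y - s\<bar> < d" "Fm * \<bar>y - s\<bar> \<le> e'"
        using Fm(1) by (auto simp: field_simps)
      show "norm (V y - V s - (y - s) *\<^sub>R X) \<le> e * norm (y - s)"
      proof (cases "s \<le> y")
        case True
        then have "\<bar>V y - V s - (y - s) * X\<bar> \<le> e' * (T + 3) * (y - s)"
          using y y' s by (intro incr[OF e'(1) d(2)]) auto
        then show ?thesis using True e' by simp
      next
        case False
        then have "\<bar>V s - V y - (s - y) * X\<bar> \<le> e' * (T + 3) * (s - y)"
          using y y' s by (intro incr[OF e'(1) d(2)]) auto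
        moreover have "V y - V s - (y - s) * X = - (V s - V y - (s - y) * X)" by (simp add: algebra_simps)
        ultimately show ?thesis using False e' by (simp add: abs_minus_commute)
      qed
    qed
  qed
  then show ?thesis by (simp add: has_vector_derivative_def V_def[abs_def] X_def)
qed

section \<open>Block vectors and nodal conditions\<close>

lemma bounded_linear_upper: "bounded_linear (upper :: real^('a::finite + 'b::finite) \<Rightarrow> real^'a)"
  unfolding linear_conv_bounded_linear[symmetric] by (intro linearI) (simp_all add: upper_def vec_eq_iff)

lemma bounded_linear_lower: "bounded_linear (lower :: real^('a::finite + 'b::finite) \<Rightarrow> real^'b)"
  unfolding linear_conv_bounded_linear[symmetric] by (intro linearI) (simp_all add: lower_def vec_eq_iff)

lemmas continuous_on_upper [continuous_intros] = bounded_linear.continuous_on[OF bounded_linear_upper]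
lemmas continuous_on_lower [continuous_intros] = bounded_linear.continuous_on[OF bounded_linear_lower]

lemma upper_lower_simps:
  "upper (u + v) = upper u + upper v" "lower (u + v) = lower u + lower v"
  "upper (u - v) = upper u - upper v" "lower (u - v) = lower u - lower v"
  "upper (- u) = - upper u" "lower (- u) = - lower u"
  "upper (c *\<^sub>R u) = c *\<^sub>R upper u" "lower (c *\<^sub>R u) = c *\<^sub>R lower u"
  "upper 0 = 0" "lower 0 = 0"
  by (simp_all add: upper_def lower_def vec_eq_iff)

lemma upper_lower_eq_iff: "u = v \<longleftrightarrow> upper u = upper v \<and> lower u = lower v"
  by (simp add: upper_def lower_def vec_eq_iff) (metis sum.exhaust)

lemma inner_upper_lower:
  fixes u v :: "real^('a::finite + 'b::finite)"
  shows "u \<bullet> v = upper u \<bullet> upper v + lower u \<bullet> lower v"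
  by (simp add: inner_vec_def upper_def lower_def sum.Plus UNIV_Plus_UNIV[symmetric] del: UNIV_Plus_UNIV)

lemma bounded_linear_block:
  "bounded_linear (\<lambda>(A, B, C, D). block A B C D :: real^('a::finite + 'b::finite)^('c::finite + 'd::finite))"
  unfolding linear_conv_bounded_linear[symmetric]
  by (intro linearI) (auto simp: block_def vec_eq_iff split: sum.split)

lemma continuous_on_block [continuous_intros]:
  assumes "continuous_on S A" "continuous_on S B" "continuous_on S C" "continuous_on S D"
  shows "continuous_on S (\<lambda>x. block (A x) (B x) (C x) (D x))"
  using bounded_linear.continuous_on[OF bounded_linear_block, of S "\<lambda>x. (A x, B x, C x, D x)"] assms
  by (simp add: continuous_on_Pair)

lemma has_vector_derivative_block:
  assumes "(A has_vector_derivative A') (at x within S)" "(B has_vector_derivative B') (at x within S)"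
    and "(C has_vector_derivative C') (at x within S)" "(D has_vector_derivative D') (at x within S)"
  shows "((\<lambda>x. block (A x) (B x) (C x) (D x)) has_vector_derivative block A' B' C' D') (at x within S)"
  using bounded_linear.has_vector_derivative[OF bounded_linear_block
      has_vector_derivative_Pair[OF assms(1) has_vector_derivative_Pair[OF assms(2) has_vector_derivative_Pair[OF assms(3,4)]]]]
  by simp

lemmas matrix_vector_mult_minus_left = bounded_bilinear.minus_left[OF bounded_bilinear_matrix_vector_mult]

lemma inner_matrix_transpose: "u \<bullet> (A *v v) = (transpose A *v u) \<bullet> (v :: real^'n)" for A :: "real^'n^'m"
  by (metis dot_lmul_matrix vector_transpose_matrix transpose_transpose inner_commute)

section \<open>Functions of class C^k on intervals and C^1 on rectangles\<close>

lemma Ck_on_imp_continuous_on: "Ck_on k S f \<Longrightarrow> continuous_on S f"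
  by (cases k) (auto simp: continuous_on_eq_continuous_within intro: has_vector_derivative_continuous)

lemma Ck_on_mono: "Ck_on (Suc k) S f \<Longrightarrow> Ck_on k S f"
  by (induction k arbitrary: f) (use Ck_on_imp_continuous_on[of 1 S] in \<open>auto simp: One_nat_def\<close>)

lemma Ck_continuous_on: "f \<in> Ck k S B \<Longrightarrow> continuous_on S f"
  unfolding Ck_def using Ck_on_imp_continuous_on by blast

lemma Ck_derivative:
  assumes "f \<in> Ck (Suc k) S B"
  obtains f' where "\<And>x. x \<in> S \<Longrightarrow> (f has_vector_derivative f' x) (at x within S)" "continuous_on S f'"
proof -
  obtain f' where "\<forall>x\<in>S. (f has_vector_derivative f' x) (at x within S)" "Ck_on k S f'"
    using assms by (auto simp: Ck_def)
  then show thesis using that Ck_on_imp_continuous_on by blast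
qed

lemma C1_xtD:
  assumes "y \<in> C1_xt l T"
  shows "continuous_on ({0..l} \<times> {0..T}) y"
    and "continuous_on ({0..l} \<times> {0..T}) (partial_x l y)"
    and "continuous_on ({0..l} \<times> {0..T}) (partial_t T y)"
    and "x \<in> {0..l} \<Longrightarrow> t \<in> {0..T} \<Longrightarrow>
      ((\<lambda>\<xi>. y (\<xi>, t)) has_vector_derivative partial_x l y (x, t)) (at x within {0..l})"
    and "x \<in> {0..l} \<Longrightarrow> t \<in> {0..T} \<Longrightarrow>
      ((\<lambda>s. y (x, s)) has_vector_derivative partial_t T y (x, t)) (at t within {0..T})"
  using assms unfolding C1_xt_def partial_x_def partial_t_def
  by (auto simp: vector_derivative_works[symmetric])

section \<open>Nodal identities and the incidence structure\<close>

lemma nodal_identities_iff: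
  "nodal_identities net w r \<longleftrightarrow>
     (\<forall>n\<in>multiple_nodes net. \<forall>i\<in>incident net n. \<forall>j\<in>incident net n.
        Rbar net i (node_pos net n i) *v upper (w i (node_pos net n i))
        = Rbar net j (node_pos net n j) *v upper (w j (node_pos net n j)))
   \<and> (\<forall>n\<in>multiple_nodes net. (\<Sum>i\<in>incident net n. node_sign net n i *\<^sub>R
        (Rbar net i (node_pos net n i) *v lower (w i (node_pos net n i)))) = r n)
   \<and> (\<forall>n\<in>neumann_nodes net. node_sign net n (first_beam net n) *\<^sub>R
        lower (w (first_beam net n) (node_pos net n (first_beam net n))) = r n)
   \<and> (\<forall>n\<in>dirichlet_nodes net. upper (w (first_beam net n) (node_pos net n (first_beam net n))) = r n)"
  by (simp add: nodal_identities_def Let_def)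

lemma nodal_identitiesD:
  assumes "nodal_identities net w r"
  shows "n \<in> multiple_nodes net \<Longrightarrow> i \<in> incident net n \<Longrightarrow> j \<in> incident net n \<Longrightarrow>
      Rbar net i (node_pos net n i) *v upper (w i (node_pos net n i))
      = Rbar net j (node_pos net n j) *v upper (w j (node_pos net n j))"
    and "n \<in> multiple_nodes net \<Longrightarrow> (\<Sum>i\<in>incident net n. node_sign net n i *\<^sub>R
        (Rbar net i (node_pos net n i) *v lower (w i (node_pos net n i)))) = r n"
    and "n \<in> neumann_nodes net \<Longrightarrow> node_sign net n (first_beam net n) *\<^sub>R
        lower (w (first_beam net n) (node_pos net n (first_beam net n))) = r n"
    and "n \<in> dirichlet_nodes net \<Longrightarrow>
        upper (w (first_beam net n) (node_pos net n (first_beam net n))) = r n"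
  using assms unfolding nodal_identities_iff by - (elim conjE, (drule (1) bspec)+, assumption)+

lemma nodal_identities_diff:
  assumes "nodal_identities net w r" "nodal_identities net w' r'"
  shows "nodal_identities net (\<lambda>i x. w i x - w' i x) (\<lambda>n. r n - r' n)"
  unfolding nodal_identities_iff
proof (intro conjI ballI, goal_cases)
  case (1 n i j)
  then show ?case
    unfolding upper_lower_simps matrix_vector_mult_diff_distrib
    by (simp only: nodal_identitiesD(1)[OF assms(1) 1] nodal_identitiesD(1)[OF assms(2) 1])
next
  case (2 n)
  show ?case
    unfolding upper_lower_simps matrix_vector_mult_diff_distrib scaleR_diff_right sum_subtractf
    by (simp only: nodal_identitiesD(2)[OF assms(1) 2] nodal_identitiesD(2)[OF assms(2) 2])
next
  case (3 n)
  show ?case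
    unfolding upper_lower_simps scaleR_diff_right
    by (simp only: nodal_identitiesD(3)[OF assms(1) 3] nodal_identitiesD(3)[OF assms(2) 3])
next
  case (4 n)
  show ?case
    unfolding upper_lower_simps
    by (simp only: nodal_identitiesD(4)[OF assms(1) 4] nodal_identitiesD(4)[OF assms(2) 4])
qed

lemma finite_incident: "finite (incident net n)"
  by (simp add: incident_def beams_def)

lemma incident_simple:
  assumes "n \<in> simple_nodes net"
  shows "incident net n = {first_beam net n}"
proof -
  have "card (incident net n) = 1" using assms by (simp add: simple_nodes_def degree_def)
  then obtain i where "incident net n = {i}" by (auto simp: card_1_singleton_iff)
  then show ?thesis by (simp add: first_beam_def)
qed

lemma first_beam_incident:
  assumes "n \<in> multiple_nodes net"
  shows "first_beam net n \<in> incident net n"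
proof -
  have "incident net n \<noteq> {}" using assms by (auto simp: multiple_nodes_def degree_def)
  then show ?thesis unfolding first_beam_def by (intro Min_in finite_incident)
qed

text \<open>A node without incident beams carries no condition and is excluded; any other node is
  subject to one of the three kinds of nodal condition.\<close>

lemma node_cases:
  assumes wf: "wf_network net" and n: "n \<in> nodes net" "incident net n \<noteq> {}"
  obtains "n \<in> multiple_nodes net"
  | "n \<in> neumann_nodes net" "n \<notin> multiple_nodes net" "n \<notin> dirichlet_nodes net" "incident net n = {first_beam net n}"
  | "n \<in> dirichlet_nodes net" "n \<notin> multiple_nodes net" "n \<notin> neumann_nodes net" "incident net n = {first_beam net n}"
proof -
  have "degree net n \<noteq> 0" using n(2) finite_incident[of net n] by (simp add: degree_def)
  then consider "degree net n \<ge> 2" | "degree net n = 1" by linarith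
  then show ?thesis
  proof cases
    case 2
    then have s: "n \<in> simple_nodes net" using n by (simp add: simple_nodes_def)
    moreover have "n \<notin> multiple_nodes net" using 2 by (simp add: multiple_nodes_def)
    ultimately show ?thesis
      using wf that(2,3) incident_simple[OF s] unfolding wf_network_def by (metis IntI Un_iff empty_iff)
  qed (use that(1) n in \<open>simp add: multiple_nodes_def\<close>)
qed

text \<open>\<open>solves_system\<close> compares velocities with that of the first beam, the
  compatibility conditions compare them pairwise. Since the first beam of a multiple node is
  incident with it, one predicate serves for both.\<close>

lemma solves_system_iff:
  "solves_system net T y0 q y \<longleftrightarrow>
     (\<forall>i\<in>beams net. \<forall>x\<in>{0<..<len net i}. \<forall>t\<in>{0<..<T}.
        partial_t T (y i) (x, t) + A_mat net i x *v partial_x (len net i) (y i) (x, t)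
          + B_mat net i x *v y i (x, t) = g_fun net i x (y i (x, t)))
   \<and> (\<forall>t\<in>{0<..<T}. nodal_identities net (\<lambda>i x. y i (x, t)) (\<lambda>n. q n t))
   \<and> (\<forall>i\<in>beams net. \<forall>x\<in>{0<..<len net i}. y i (x, 0) = y0 i x)"
proof -
  have "(\<forall>n\<in>multiple_nodes net. \<forall>i\<in>incident net n. f n i = f n (first_beam net n)) \<longleftrightarrow>
      (\<forall>n\<in>multiple_nodes net. \<forall>i\<in>incident net n. \<forall>j\<in>incident net n. f n i = f n j)"
    for f :: "nat \<Rightarrow> nat \<Rightarrow> vec6"
    using first_beam_incident by metis
  note this[of "\<lambda>n i. Rbar net i (node_pos net n i) *v upper (y i (node_pos net n i, t))" for t]
  then show ?thesis
    unfolding solves_system_def nodal_identities_def Let_def by simp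
qed

lemma Rbar_mult: "upper (Rbar net i x *v u) = rot net i x *v upper u"
  "lower (Rbar net i x *v u) = rot net i x *v lower u"
  by (simp_all add: Rbar_def upper_block_mult lower_block_mult)

lemma Rbar_orthogonal:
  assumes "rot net i x \<in> SO3"
  shows "(Rbar net i x *v u) \<bullet> (Rbar net i x *v v) = u \<bullet> v"
    and "transpose (Rbar net i x) *v (Rbar net i x *v u) = u"
    and "Rbar net i x *v (transpose (Rbar net i x) *v u) = u"
proof -
  have R: "orthogonal_matrix (rot net i x)" using assms by (simp add: SO3_def rotation_matrix_def)
  have "(rot net i x *v a) \<bullet> (rot net i x *v b) = a \<bullet> b" for a b
    using R by (simp add: inner_matrix_transpose matrix_vector_mul_assoc orthogonal_matrix_def)
  then show *: "(Rbar net i x *v u) \<bullet> (Rbar net i x *v v) = u \<bullet> v" for u v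
    by (simp add: inner_upper_lower Rbar_mult)
  have "(transpose (Rbar net i x) *v (Rbar net i x *v u)) \<bullet> v = u \<bullet> v" for u v
    using * inner_matrix_transpose by metis
  then have **: "transpose (Rbar net i x) *v (Rbar net i x *v u) = u" for u
    by (metis vector_eq_rdot)
  then show "transpose (Rbar net i x) *v (Rbar net i x *v u) = u" .
  have "transpose (Rbar net i x) ** Rbar net i x = mat 1"
    using ** by (simp add: matrix_eq matrix_vector_mul_assoc)
  then have "Rbar net i x ** transpose (Rbar net i x) = mat 1" by (simp add: matrix_left_right_inverse)
  then show "Rbar net i x *v (transpose (Rbar net i x) *v u) = u"
    by (metis matrix_vector_mul_assoc matrix_vector_mul_lid)
qed

text \<open>Double counting of pairs of a node and an incident beam: the two ends of a beam are
  distinct nodes, so each beam occurs exactly twice, whatever cycles the graph has.\<close>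

lemma sum_over_node_ends:
  assumes wf: "wf_network net"
  shows "(\<Sum>n\<in>nodes net. \<Sum>i\<in>incident net n. f n i)
      = (\<Sum>i\<in>beams net. f (init_node net i) i + f (end_node net i) i)"
proof -
  have fin: "finite (nodes net)" "finite (beams net)" by (auto simp: nodes_def beams_def)
  have "(\<Sum>n\<in>nodes net. \<Sum>i\<in>incident net n. f n i)
      = (\<Sum>n\<in>nodes net. \<Sum>i\<in>{i\<in>beams net. n = init_node net i \<or> n = end_node net i}. f n i)"
    by (simp add: incident_def eq_commute)
  also have "\<dots> = (\<Sum>i\<in>beams net. \<Sum>n\<in>{n\<in>nodes net. n = init_node net i \<or> n = end_node net i}. f n i)"
    by (rule sum.swap_restrict[OF fin])
  also have "\<dots> = (\<Sum>i\<in>beams net. f (init_node net i) i + f (end_node net i) i)"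
  proof (rule sum.cong[OF refl])
    fix i assume "i \<in> beams net"
    then have "{n\<in>nodes net. n = init_node net i \<or> n = end_node net i} = {init_node net i, end_node net i}"
      and "init_node net i \<noteq> end_node net i"
      using wf unfolding wf_network_def by auto
    then show "(\<Sum>n\<in>{n\<in>nodes net. n = init_node net i \<or> n = end_node net i}. f n i)
        = f (init_node net i) i + f (end_node net i) i" by simp
  qed
  finally show ?thesis .
qed

text \<open>The nodal conditions are conservative: with zero nodal data no energy enters the network.\<close>

lemma nodal_power_zero:
  assumes wf: "wf_network net" and rot: "\<And>i x. i \<in> beams net \<Longrightarrow> x \<in> {0..len net i} \<Longrightarrow> rot net i x \<in> SO3"
    and d: "nodal_identities net d (\<lambda>n. 0)"
  shows "(\<Sum>i\<in>beams net. upper (d i (len net i)) \<bullet> lower (d i (len net i)) - upper (d i 0) \<bullet> lower (d i 0)) = 0"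
proof -
  define p where "p n i = node_sign net n i * (upper (d i (node_pos net n i)) \<bullet> lower (d i (node_pos net n i)))" for n i
  have "(\<Sum>i\<in>incident net n. p n i) = 0" if n: "n \<in> nodes net" for n
  proof (cases "incident net n = {}")
    case False
    with wf n show ?thesis
    proof (cases rule: node_cases)
      case 1
      \<comment> \<open>The velocity common to all beams at the joint factors out of the sum of
        powers and leaves the total flux, which is zero. At a simple node one of the two factors of
        the power vanishes.\<close>
      define V where "V = Rbar net (first_beam net n) (node_pos net n (first_beam net n))
        *v upper (d (first_beam net n) (node_pos net n (first_beam net n)))"
      have "p n i = V \<bullet> (node_sign net n i *\<^sub>R (Rbar net i (node_pos net n i) *v lower (d i (node_pos net n i))))"
        if i: "i \<in> incident net n" for i
      proof -
        have "rot net i (node_pos net n i) \<in> SO3"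
          using i wf by (intro rot) (auto simp: incident_def node_pos_def wf_network_def intro: less_imp_le)
        moreover have "V = Rbar net i (node_pos net n i) *v upper (d i (node_pos net n i))"
          unfolding V_def by (rule nodal_identitiesD(1)[OF d 1 first_beam_incident[OF 1] i])
        ultimately show ?thesis by (simp add: p_def Rbar_orthogonal(1) del: transpose_matrix_vector)
      qed
      then have "(\<Sum>i\<in>incident net n. p n i) = V \<bullet> (\<Sum>i\<in>incident net n. node_sign net n i *\<^sub>R
          (Rbar net i (node_pos net n i) *v lower (d i (node_pos net n i))))"
        by (simp add: inner_sum_right)
      also have "\<dots> = 0" unfolding nodal_identitiesD(2)[OF d 1] by simp
      finally show ?thesis .
    next
      case 2
      have "node_sign net n (first_beam net n) *\<^sub>R lower (d (first_beam net n) (node_pos net n (first_beam net n))) = 0"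
        by (rule nodal_identitiesD(3)[OF d 2(1)])
      then have "p n (first_beam net n) = 0" by (auto simp: p_def)
      then show ?thesis unfolding 2(4) by simp
    next
      case 3
      have "upper (d (first_beam net n) (node_pos net n (first_beam net n))) = 0"
        by (rule nodal_identitiesD(4)[OF d 3(1)])
      then have "p n (first_beam net n) = 0" by (auto simp: p_def)
      then show ?thesis unfolding 3(4) by simp
    qed
  qed simp
  then have "0 = (\<Sum>n\<in>nodes net. \<Sum>i\<in>incident net n. p n i)" by simp
  also have "\<dots> = (\<Sum>i\<in>beams net. p (init_node net i) i + p (end_node net i) i)"
    by (rule sum_over_node_ends[OF wf])
  also have "\<dots> = (\<Sum>i\<in>beams net. upper (d i (len net i)) \<bullet> lower (d i (len net i)) - upper (d i 0) \<bullet> lower (d i 0))"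
    using wf by (intro sum.cong) (auto simp: p_def node_sign_def node_pos_def wf_network_def)
  finally show ?thesis by simp
qed

section \<open>Energy estimate and uniqueness\<close>

locale regular_network =
  fixes net :: beam_network
  assumes wf: "wf_network net"
    and rot: "\<And>i. i \<in> beams net \<Longrightarrow> rot net i \<in> Ck 2 {0..len net i} SO3"
    and assumption1: "assumption1 2 net"
begin

lemma len_pos: "i \<in> beams net \<Longrightarrow> len net i > 0"
  using wf by (simp add: wf_network_def)

lemma rot_SO3: "i \<in> beams net \<Longrightarrow> x \<in> {0..len net i} \<Longrightarrow> rot net i x \<in> SO3"
  using rot[of i] by (auto simp: Ck_def image_subset_iff)

lemma mass_flex:
  assumes "i \<in> beams net"
  shows "continuous_on {0..len net i} (mass net i)" "continuous_on {0..len net i} (flex net i)"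
    and "x \<in> {0..len net i} \<Longrightarrow> mass net i x \<in> SPD" "x \<in> {0..len net i} \<Longrightarrow> flex net i x \<in> SPD"
proof -
  have "mass net i \<in> Ck 2 {0..len net i} SPD" "flex net i \<in> Ck 2 {0..len net i} SPD"
    using assumption1 assms unfolding assumption1_def by blast+
  then show "continuous_on {0..len net i} (mass net i)" "continuous_on {0..len net i} (flex net i)"
    and "x \<in> {0..len net i} \<Longrightarrow> mass net i x \<in> SPD" "x \<in> {0..len net i} \<Longrightarrow> flex net i x \<in> SPD"
    using Ck_continuous_on by (auto simp: Ck_def)
qed

lemma Q_mult: "upper (Q_mat net i x *v u) = mass net i x *v upper u"
  "lower (Q_mat net i x *v u) = flex net i x *v lower u"
  by (simp_all add: Q_mat_def upper_block_mult lower_block_mult)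

lemma continuous_on_Q_mat: "i \<in> beams net \<Longrightarrow> continuous_on {0..len net i} (Q_mat net i)"
  unfolding Q_mat_def[abs_def] by (intro continuous_intros mass_flex)

lemma Q_SPD:
  assumes "i \<in> beams net" "x \<in> {0..len net i}"
  shows "Q_mat net i x \<in> SPD"
proof -
  note M = mass_flex(3)[OF assms] and C = mass_flex(4)[OF assms]
  have "transpose (Q_mat net i x) = Q_mat net i x"
    by (intro symmetric_matrixI) (simp add: inner_upper_lower[of "Q_mat net i x *v u" v for u v] inner_upper_lower[of u "Q_mat net i x *v v" for u v]
        Q_mult SPD_D(4)[OF M] SPD_D(4)[OF C])
  moreover have "v \<bullet> (Q_mat net i x *v v) > 0" if "v \<noteq> 0" for v
  proof -
    have "upper v \<noteq> 0 \<or> lower v \<noteq> 0" using that upper_lower_eq_iff[of v 0] by (auto simp: upper_lower_simps)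
    then show ?thesis
      using SPD_D(2)[OF M, of "upper v"] SPD_D(2)[OF C, of "lower v"]
        SPD_D(3)[OF M, of "upper v"] SPD_D(3)[OF C, of "lower v"]
      by (auto simp: inner_upper_lower[of v "Q_mat net i x *v v"] Q_mult intro: add_pos_nonneg add_nonneg_pos)
  qed
  ultimately show ?thesis by (simp add: SPD_def)
qed

text \<open>Multiplication by \<open>Q_mat\<close> removes the inverse from each coefficient: the
  transport term acts through a constant symmetric matrix, the zeroth-order term through an
  antisymmetric one.\<close>

lemma Q_mult_coefficients:
  assumes "i \<in> beams net" "x \<in> {0..len net i}"
  shows "Q_mat net i x *v (A_mat net i x *v u) = - (block 0 (mat 1) (mat 1) 0 *v u)"
    and "Q_mat net i x *v (B_mat net i x *v u)
      = block 0 (- E_mat net i x) (transpose (E_mat net i x)) 0 *v u"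
    and "Q_mat net i x *v g_fun net i x u = G_mat u *v (Q_mat net i x *v u)"
proof -
  have Q: "Q_mat net i x *v (matrix_inv (Q_mat net i x) *v w) = w" for w
    by (simp add: matrix_vector_mul_assoc SPD_invertible(2)[OF Q_SPD[OF assms]])
  show "Q_mat net i x *v (A_mat net i x *v u) = - (block 0 (mat 1) (mat 1) 0 *v u)"
    unfolding A_mat_def matrix_vector_mult_minus_left matrix_vector_mul_assoc[symmetric]
    by (simp add: bounded_bilinear.minus_right[OF bounded_bilinear_matrix_vector_mult] Q)
  show "Q_mat net i x *v (B_mat net i x *v u)
      = block 0 (- E_mat net i x) (transpose (E_mat net i x)) 0 *v u"
    unfolding B_mat_def matrix_vector_mul_assoc[symmetric] by (rule Q)
  show "Q_mat net i x *v g_fun net i x u = G_mat u *v (Q_mat net i x *v u)"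
    unfolding g_fun_def by (rule Q)
qed

end

section \<open>Algebra of the block coefficients\<close>

lemma hat_linear: "hat (u + v) = hat u + hat v" "hat (c *\<^sub>R u) = c *\<^sub>R hat u"
  by (simp_all add: matrix_eq hat_mult matrix_vector_mult_add_rdistrib cross_add_left cross_mult_left
      scaleR_matrix_vector_assoc[symmetric])

text \<open>Together with the linearity of \<open>Q_mat\<close> this makes the nonlinearity the
  diagonal of a bilinear map, the form in which both uniqueness and existence use it.\<close>

lemma bounded_linear_G_mat: "bounded_linear G_mat"
proof -
  have "G_mat (u + v) = G_mat u + G_mat v" "G_mat (c *\<^sub>R u) = c *\<^sub>R G_mat u" for u v c
    by (auto simp: G_mat_def Let_def upper_lower_simps hat_linear block_def vec_eq_iff split: sum.split)
  then show ?thesis unfolding linear_conv_bounded_linear[symmetric] by (intro linearI)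
qed

lemmas continuous_on_G_mat [continuous_intros] = bounded_linear.continuous_on[OF bounded_linear_G_mat]

lemma inner_swap_block: "u \<bullet> (block 0 (mat 1) (mat 1) 0 *v v) = upper u \<bullet> lower v + lower u \<bullet> upper v"
  for u v :: vec12
  by (simp add: inner_upper_lower upper_block_mult lower_block_mult)

lemma inner_skew_block: "u \<bullet> (block 0 (- E) (transpose E) 0 *v u) = 0" for u :: vec12
  by (simp add: inner_upper_lower[of u "block 0 (- E) (transpose E) 0 *v u"] upper_block_mult lower_block_mult
      matrix_vector_mult_minus_left inner_matrix_transpose[of "upper u" E "lower u"] inner_commute)

lemma continuous_on_bound:
  fixes f :: "'a::topological_space \<Rightarrow> 'b::real_normed_vector"
  assumes "compact K" "continuous_on K f"
  obtains c where "c > 0" "\<And>p. p \<in> K \<Longrightarrow> norm (f p) \<le> c"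
  using compact_imp_bounded[OF compact_continuous_image[OF assms(2,1)]] unfolding bounded_pos by auto

context regular_network
begin

text \<open>The antisymmetry of the zeroth-order terms is what makes the linear part of the energy
  balance consist of the boundary power only.\<close>

lemma energy_inequality:
  fixes y y' :: "real \<times> real \<Rightarrow> vec12"
  assumes T: "T > 0" and i: "i \<in> beams net"
    and y: "y \<in> C1_xt (len net i) T" "y' \<in> C1_xt (len net i) T"
    and pde: "\<And>x t. x \<in> {0<..<len net i} \<Longrightarrow> t \<in> {0<..<T} \<Longrightarrow>
        partial_t T y (x, t) + A_mat net i x *v partial_x (len net i) y (x, t)
          + B_mat net i x *v y (x, t) = g_fun net i x (y (x, t))"
    and pde': "\<And>x t. x \<in> {0<..<len net i} \<Longrightarrow> t \<in> {0<..<T} \<Longrightarrow>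
        partial_t T y' (x, t) + A_mat net i x *v partial_x (len net i) y' (x, t)
          + B_mat net i x *v y' (x, t) = g_fun net i x (y' (x, t))"
    and d_def: "d = (\<lambda>p. y p - y' p)"
    and E_def: "E = (\<lambda>t. integral {0..len net i} (\<lambda>x. d (x, t) \<bullet> (Q_mat net i x *v d (x, t))))"
  obtains k E' where "k \<ge> 0" "\<And>t. t \<in> {0..T} \<Longrightarrow> E t \<ge> 0"
    and "\<And>t. t \<in> {0..T} \<Longrightarrow> (E has_real_derivative E' t) (at t within {0..T})"
    and "\<And>t. t \<in> {0<..<T} \<Longrightarrow> E' t \<le> k * E t
      + 2 * (upper (d (len net i, t)) \<bullet> lower (d (len net i, t)) - upper (d (0, t)) \<bullet> lower (d (0, t)))"
    and "\<And>t x. t \<in> {0..T} \<Longrightarrow> x \<in> {0..len net i} \<Longrightarrow> E t = 0 \<Longrightarrow> d (x, t) = 0"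
proof -
  define l where "l = len net i"
  define Q where "Q = Q_mat net i"
  have l: "l > 0" using len_pos[OF i] by (simp add: l_def)
  let ?R = "{0..l} \<times> {0..T}"
  note yD = C1_xtD[OF y(1), folded l_def] and yD' = C1_xtD[OF y(2), folded l_def]
  define dt where "dt p = partial_t T y p - partial_t T y' p" for p
  define dx where "dx p = partial_x l y p - partial_x l y' p" for p
  have Qc: "continuous_on {0..l} Q" using continuous_on_Q_mat[OF i] by (simp add: Q_def l_def)
  have QSPD: "Q x \<in> SPD" if "x \<in> {0..l}" for x using Q_SPD[OF i] that by (simp add: Q_def l_def)
  have Qf: "continuous_on ?R (\<lambda>p. Q (fst p))"
    by (rule continuous_on_compose2[OF Qc]) (auto intro!: continuous_intros)
  have dc: "continuous_on ?R d" "continuous_on ?R dt" "continuous_on ?R dx"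
    unfolding d_def dt_def[abs_def] dx_def[abs_def] by (intro continuous_intros yD yD')+
  have slice: "continuous_on {0..l} (\<lambda>x. f (x, t))" if "continuous_on ?R f" "t \<in> {0..T}"
    for f :: "real \<times> real \<Rightarrow> 'z::topological_space" and t
    by (rule continuous_on_compose2[OF that(1)]) (use that in \<open>auto intro!: continuous_intros\<close>)
  have R: "compact ?R" by (simp add: compact_Times)
  define N where "N p = G_mat (y p) *v (Q (fst p) *v y p) - G_mat (y' p) *v (Q (fst p) *v y' p)" for p
  have Nc: "continuous_on ?R N" unfolding N_def[abs_def] by (intro continuous_intros yD yD' Qf)
  obtain \<mu> where \<mu>: "\<mu> > 0" "\<And>x v. x \<in> {0..l} \<Longrightarrow> \<mu> * (norm v)\<^sup>2 \<le> v \<bullet> (Q x *v v)"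
    using SPD_coercive_on[OF _ Qc QSPD] by auto
  obtain cy where cy: "cy > 0" "\<And>p. p \<in> ?R \<Longrightarrow> norm (y p) \<le> cy" using continuous_on_bound[OF R yD(1)] by blast
  obtain cy' where cy': "cy' > 0" "\<And>p. p \<in> ?R \<Longrightarrow> norm (y' p) \<le> cy'" using continuous_on_bound[OF R yD'(1)] by blast
  obtain cQ where cQ: "cQ > 0" "\<And>p. p \<in> ?R \<Longrightarrow> norm (Q (fst p)) \<le> cQ" using continuous_on_bound[OF R Qf] by blast
  obtain cG where cG: "cG > 0" "\<And>u. norm (G_mat u) \<le> norm u * cG"
    using bounded_linear.pos_bounded[OF bounded_linear_G_mat] by blast
  define c where "c = cG * cQ * (cy + cy')"
  have c: "c > 0" using cG cQ cy cy' by (simp add: c_def)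
  \<comment> \<open>The difference of the two quadratic terms splits into two terms linear in
    \<open>d\<close>. The constant depends on the bounds of both solutions, which is harmless for
    uniqueness.\<close>
  have Nle: "d p \<bullet> N p \<le> c * (norm (d p))\<^sup>2" if p: "p \<in> ?R" for p
  proof -
    have "N p = G_mat (d p) *v (Q (fst p) *v y p) + G_mat (y' p) *v (Q (fst p) *v d p)"
      by (simp add: N_def d_def linear_diff[OF bounded_linear.linear[OF bounded_linear_G_mat]] matrix_vector_mult_diff_rdistrib
          matrix_vector_mult_diff_distrib)
    also have "norm \<dots> \<le> norm (G_mat (d p)) * (norm (Q (fst p)) * norm (y p))
        + norm (G_mat (y' p)) * (norm (Q (fst p)) * norm (d p))"
      by (intro order_trans[OF norm_triangle_ineq] add_mono order_trans[OF norm_matrix_vector_le]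
          mult_left_mono norm_matrix_vector_le) auto
    also have "\<dots> \<le> (norm (d p) * cG) * (cQ * cy) + (cy' * cG) * (cQ * norm (d p))"
      using cG cQ cy cy' p
      by (intro add_mono mult_mono order_trans[OF cG(2)] order_refl mult_right_mono mult_nonneg_nonneg) auto
    also have "\<dots> = c * norm (d p)" by (simp add: c_def algebra_simps)
    finally have "norm (d p) * norm (N p) \<le> norm (d p) * (c * norm (d p))" by (intro mult_left_mono) auto
    then show ?thesis using norm_cauchy_schwarz[of "d p" "N p"] by (simp add: power2_eq_square mult_ac)
  qed
  define e where "e p = d p \<bullet> (Q (fst p) *v d p)" for p
  have ec: "continuous_on ?R e" unfolding e_def[abs_def] by (intro continuous_intros dc Qf)
  have E: "E t = integral {0..l} (\<lambda>x. e (x, t))" for t by (simp add: E_def e_def Q_def l_def)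
  define E' where "E' t = integral {0..l} (\<lambda>x. 2 * (d (x, t) \<bullet> (Q x *v dt (x, t))))" for t
  have e0: "e (x, t) \<ge> \<mu> * (norm (d (x, t)))\<^sup>2" if "x \<in> {0..l}" for x t using \<mu>(2)[OF that] by (simp add: e_def)
  have epos: "e (x, t) \<ge> 0" if "x \<in> {0..l}" for x t using SPD_D(3)[OF QSPD[OF that]] by (simp add: e_def)
  show thesis
  proof (rule that[of "2 * c / \<mu>" E'])
    show "2 * c / \<mu> \<ge> 0" using c \<mu>(1) by simp
    show "E t \<ge> 0" if "t \<in> {0..T}" for t
      unfolding E using epos by (intro integral_nonneg integrable_continuous_real slice[OF ec that]) auto
    show "(E has_real_derivative E' t) (at t within {0..T})" if t: "t \<in> {0..T}" for t
      unfolding E[abs_def] E'_def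
    proof (rule leibniz_rule_field_derivative[where a = 0 and b = l, unfolded cbox_interval, where U = "{0..T}" and fx = "\<lambda>t x. 2 * (d (x, t) \<bullet> (Q x *v dt (x, t)))"])
      fix s x assume s: "s \<in> {0..T}" "x \<in> {0..l}"
      have "((\<lambda>s. d (x, s)) has_vector_derivative dt (x, s)) (at s within {0..T})"
        unfolding d_def dt_def using s by (intro has_vector_derivative_diff yD yD') auto
      then have "((\<lambda>s. e (x, s)) has_vector_derivative d (x, s) \<bullet> (Q x *v dt (x, s)) + dt (x, s) \<bullet> (Q x *v d (x, s)))
          (at s within {0..T})"
        unfolding e_def fst_conv
        by (intro bounded_bilinear.has_vector_derivative[OF bounded_bilinear_inner]
            bounded_linear.has_vector_derivative[OF matrix_vector_mul_bounded_linear])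
      moreover have "dt (x, s) \<bullet> (Q x *v d (x, s)) = d (x, s) \<bullet> (Q x *v dt (x, s))"
        using SPD_D(4)[OF QSPD, of x "dt (x, s)" "d (x, s)"] s by (simp add: inner_commute)
      ultimately show "((\<lambda>s. e (x, s)) has_real_derivative 2 * (d (x, s) \<bullet> (Q x *v dt (x, s)))) (at s within {0..T})"
        by (simp add: has_real_derivative_iff_has_vector_derivative)
    next
      show "(\<lambda>x. e (x, s)) integrable_on {0..l}" if "s \<in> {0..T}" for s
        using integrable_continuous_real[OF slice[OF ec that]] by simp
      have "continuous_on ({0..T} \<times> {0..l}) (\<lambda>p. (\<lambda>p. 2 * (d p \<bullet> (Q (fst p) *v dt p))) (snd p, fst p))"
        by (rule continuous_on_compose2[where t = ?R]) (auto intro!: continuous_intros dc Qf)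
      then show "continuous_on ({0..T} \<times> {0..l}) (\<lambda>(t, x). 2 * (d (x, t) \<bullet> (Q x *v dt (x, t))))"
        by (simp add: case_prod_unfold)
    qed (use t in auto)
    show "E' t \<le> 2 * c / \<mu> * E t + 2 * (upper (d (len net i, t)) \<bullet> lower (d (len net i, t)) - upper (d (0, t)) \<bullet> lower (d (0, t)))"
      if t: "t \<in> {0<..<T}" for t
    proof -
      have tT: "t \<in> {0..T}" using t by auto
      define b where "b x = upper (d (x, t)) \<bullet> lower (d (x, t))" for x
      define b' where "b' x = upper (d (x, t)) \<bullet> lower (dx (x, t)) + upper (dx (x, t)) \<bullet> lower (d (x, t))" for x
      \<comment> \<open>Tested with \<open>d\<close>, the transport term is the space derivative of
        \<open>upper d \<bullet> lower d\<close>; integration leaves only the power at the two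
        ends.\<close>
      have "(b' has_integral b l - b 0) {0..l}"
      proof (rule fundamental_theorem_of_calculus)
        fix x assume "x \<in> {0..l}"
        then have "((\<lambda>x. d (x, t)) has_vector_derivative dx (x, t)) (at x within {0..l})"
          unfolding d_def dx_def using tT by (intro has_vector_derivative_diff yD yD') auto
        then show "(b has_vector_derivative b' x) (at x within {0..l})"
          unfolding b_def[abs_def] b'_def
          by (intro bounded_bilinear.has_vector_derivative[OF bounded_bilinear_inner]
              bounded_linear.has_vector_derivative[OF bounded_linear_upper]
              bounded_linear.has_vector_derivative[OF bounded_linear_lower])
      qed (use l in simp)
      moreover have "((\<lambda>x. d (x, t) \<bullet> N (x, t)) has_integral integral {0..l} (\<lambda>x. d (x, t) \<bullet> N (x, t))) {0..l}"
        by (intro integrable_integral integrable_continuous_real continuous_intros slice[OF dc(1) tT] slice[OF Nc tT])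
      ultimately have "((\<lambda>x. 2 * (b' x + d (x, t) \<bullet> N (x, t))) has_integral
          2 * (b l - b 0 + integral {0..l} (\<lambda>x. d (x, t) \<bullet> N (x, t)))) {0..l}"
        by (intro has_integral_mult_right has_integral_add)
      moreover have "integral {0..l} (\<lambda>x. 2 * (b' x + d (x, t) \<bullet> N (x, t))) = E' t"
        unfolding E'_def
      \<comment> \<open>The equation is given at interior points only; the two end points form a
        negligible set.\<close>
      proof (rule integral_spike[where S = "{0, l}"])
        fix x assume "x \<in> {0..l} - {0, l}"
        then have x: "x \<in> {0<..<l}" "x \<in> {0..l}" by auto
        have Qt: "Q x *v partial_t T z (x, t) = block 0 (mat 1) (mat 1) 0 *v partial_x l z (x, t)
            - block 0 (- E_mat net i x) (transpose (E_mat net i x)) 0 *v z (x, t)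
            + G_mat (z (x, t)) *v (Q x *v z (x, t))"
          if "partial_t T z (x, t) + A_mat net i x *v partial_x (len net i) z (x, t)
          + B_mat net i x *v z (x, t) = g_fun net i x (z (x, t))" for z :: "real \<times> real \<Rightarrow> vec12"
        proof -
          have "partial_t T z (x, t) = g_fun net i x (z (x, t))
              - A_mat net i x *v partial_x l z (x, t) - B_mat net i x *v z (x, t)"
            using that by (simp add: algebra_simps l_def)
          then show ?thesis
            using Q_mult_coefficients[OF i, of x] x unfolding Q_def
            by (simp add: matrix_vector_mult_diff_distrib l_def)
        qed
        have "Q x *v dt (x, t) = block 0 (mat 1) (mat 1) 0 *v dx (x, t)
            - block 0 (- E_mat net i x) (transpose (E_mat net i x)) 0 *v d (x, t) + N (x, t)"
          using Qt[of y, OF pde] Qt[of y', OF pde'] x t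
          by (simp add: dt_def dx_def d_def N_def matrix_vector_mult_diff_distrib l_def)
        then show "2 * (d (x, t) \<bullet> (Q x *v dt (x, t))) = 2 * (b' x + d (x, t) \<bullet> N (x, t))"
          by (simp add: inner_add_right inner_diff_right inner_swap_block inner_skew_block b'_def inner_commute)
      qed simp
      ultimately have E': "E' t = 2 * (b l - b 0 + integral {0..l} (\<lambda>x. d (x, t) \<bullet> N (x, t)))"
        by (simp add: integral_unique)
      have "integral {0..l} (\<lambda>x. d (x, t) \<bullet> N (x, t)) \<le> integral {0..l} (\<lambda>x. c / \<mu> * e (x, t))"
      proof (rule integral_le)
        fix x assume x: "x \<in> {0..l}"
        have "d (x, t) \<bullet> N (x, t) \<le> c * (norm (d (x, t)))\<^sup>2" using Nle x tT by auto
        also have "\<dots> = c / \<mu> * (\<mu> * (norm (d (x, t)))\<^sup>2)" using \<mu>(1) by simp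
        also have "\<dots> \<le> c / \<mu> * e (x, t)" using e0[OF x] c \<mu>(1) by (intro mult_left_mono) auto
        finally show "d (x, t) \<bullet> N (x, t) \<le> c / \<mu> * e (x, t)" .
      qed (intro integrable_continuous_real continuous_intros slice[OF dc(1) tT] slice[OF Nc tT] slice[OF ec tT])+
      also have "\<dots> = c / \<mu> * E t" unfolding E by simp
      finally show ?thesis unfolding E' by (simp add: b_def l_def)
    qed
    show "d (x, t) = 0" if "t \<in> {0..T}" "x \<in> {0..len net i}" "E t = 0" for t x
    proof -
      have "e (x, t) = 0"
        using integral_eq_0_iff[OF slice[OF ec that(1)] l] that epos by (simp add: E l_def)
      moreover have "x \<in> {0..l}" using that by (simp add: l_def)
      ultimately have "\<mu> * (norm (d (x, t)))\<^sup>2 \<le> 0" using e0[of x t] by simp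
      then show ?thesis using \<mu>(1) by (simp add: mult_le_0_iff)
    qed
  qed
qed

text \<open>Gronwall's argument for the sum of the beam energies, in which the boundary powers
  cancel over the whole network. The growth constant may depend on the two solutions compared, so
  the conclusion covers solutions of any size.\<close>

theorem solution_unique:
  fixes y y' :: "nat \<Rightarrow> real \<times> real \<Rightarrow> vec12"
  assumes T: "T > 0"
    and y: "\<And>i. i \<in> beams net \<Longrightarrow> y i \<in> C1_xt (len net i) T" "solves_system net T y0 q y"
    and y': "\<And>i. i \<in> beams net \<Longrightarrow> y' i \<in> C1_xt (len net i) T" "solves_system net T y0 q y'"
    and i: "i \<in> beams net" and p: "p \<in> {0..len net i} \<times> {0..T}"
  shows "y i p = y' i p"
proof -
  define d where "d i = (\<lambda>p. y i p - y' i p)" for i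
  define E where "E i = (\<lambda>t. integral {0..len net i} (\<lambda>x. d i (x, t) \<bullet> (Q_mat net i x *v d i (x, t))))" for i
  have "\<forall>i\<in>beams net. \<exists>k E'. k \<ge> 0 \<and> (\<forall>t\<in>{0..T}. E i t \<ge> 0)
      \<and> (\<forall>t\<in>{0..T}. (E i has_real_derivative E' t) (at t within {0..T}))
      \<and> (\<forall>t\<in>{0<..<T}. E' t \<le> k * E i t + 2 * (upper (d i (len net i, t)) \<bullet> lower (d i (len net i, t))
            - upper (d i (0, t)) \<bullet> lower (d i (0, t))))
      \<and> (\<forall>t\<in>{0..T}. \<forall>x\<in>{0..len net i}. E i t = 0 \<longrightarrow> d i (x, t) = 0)"
  proof
    fix j assume j: "j \<in> beams net"
    show "\<exists>k E'. k \<ge> 0 \<and> (\<forall>t\<in>{0..T}. E j t \<ge> 0)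
      \<and> (\<forall>t\<in>{0..T}. (E j has_real_derivative E' t) (at t within {0..T}))
      \<and> (\<forall>t\<in>{0<..<T}. E' t \<le> k * E j t + 2 * (upper (d j (len net j, t)) \<bullet> lower (d j (len net j, t))
            - upper (d j (0, t)) \<bullet> lower (d j (0, t))))
      \<and> (\<forall>t\<in>{0..T}. \<forall>x\<in>{0..len net j}. E j t = 0 \<longrightarrow> d j (x, t) = 0)"
    proof (rule energy_inequality[OF T j y(1)[OF j] y'(1)[OF j]])
      show "d j = (\<lambda>p. y j p - y' j p)" by (simp add: d_def)
      show "E j = (\<lambda>t. integral {0..len net j} (\<lambda>x. d j (x, t) \<bullet> (Q_mat net j x *v d j (x, t))))"
        by (simp add: E_def)
    next
      fix k E' assume *: "k \<ge> 0" "\<And>t. t \<in> {0..T} \<Longrightarrow> E j t \<ge> 0"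
        "\<And>t. t \<in> {0..T} \<Longrightarrow> (E j has_real_derivative E' t) (at t within {0..T})"
        "\<And>t. t \<in> {0<..<T} \<Longrightarrow> E' t \<le> k * E j t + 2 * (upper (d j (len net j, t)) \<bullet> lower (d j (len net j, t))
            - upper (d j (0, t)) \<bullet> lower (d j (0, t)))"
        "\<And>t x. t \<in> {0..T} \<Longrightarrow> x \<in> {0..len net j} \<Longrightarrow> E j t = 0 \<Longrightarrow> d j (x, t) = 0"
      show "\<exists>k E'. k \<ge> 0 \<and> (\<forall>t\<in>{0..T}. E j t \<ge> 0)
          \<and> (\<forall>t\<in>{0..T}. (E j has_real_derivative E' t) (at t within {0..T}))
          \<and> (\<forall>t\<in>{0<..<T}. E' t \<le> k * E j t + 2 * (upper (d j (len net j, t)) \<bullet> lower (d j (len net j, t))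
                - upper (d j (0, t)) \<bullet> lower (d j (0, t))))
          \<and> (\<forall>t\<in>{0..T}. \<forall>x\<in>{0..len net j}. E j t = 0 \<longrightarrow> d j (x, t) = 0)"
        by (intro exI conjI ballI impI) (rule *; assumption)+
    next
      fix x t assume "x \<in> {0<..<len net j}" "t \<in> {0<..<T}"
      then show "partial_t T (y j) (x, t) + A_mat net j x *v partial_x (len net j) (y j) (x, t)
          + B_mat net j x *v y j (x, t) = g_fun net j x (y j (x, t))"
        and "partial_t T (y' j) (x, t) + A_mat net j x *v partial_x (len net j) (y' j) (x, t)
          + B_mat net j x *v y' j (x, t) = g_fun net j x (y' j (x, t))"
        using y(2) y'(2) j unfolding solves_system_iff by blast+
    qed
  qed
  then obtain k E' where k: "\<And>i. i \<in> beams net \<Longrightarrow> k i \<ge> (0::real)"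
    and E0: "\<And>i t. i \<in> beams net \<Longrightarrow> t \<in> {0..T} \<Longrightarrow> E i t \<ge> 0"
    and E': "\<And>i t. i \<in> beams net \<Longrightarrow> t \<in> {0..T} \<Longrightarrow> (E i has_real_derivative E' i t) (at t within {0..T})"
    and E'le: "\<And>i t. i \<in> beams net \<Longrightarrow> t \<in> {0<..<T} \<Longrightarrow> E' i t \<le> k i * E i t
        + 2 * (upper (d i (len net i, t)) \<bullet> lower (d i (len net i, t)) - upper (d i (0, t)) \<bullet> lower (d i (0, t)))"
    and zero: "\<And>i t x. i \<in> beams net \<Longrightarrow> t \<in> {0..T} \<Longrightarrow> x \<in> {0..len net i} \<Longrightarrow> E i t = 0 \<Longrightarrow> d i (x, t) = 0"
    unfolding bchoice_iff by blast
  have fin: "finite (beams net)" by (simp add: beams_def)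
  \<comment> \<open>One growth rate for all beams: the sum dominates every \<open>k i\<close>, as
    all are nonnegative.\<close>
  define K where "K = (\<Sum>i\<in>beams net. k i)"
  have kK: "k j \<le> K" if "j \<in> beams net" for j
    unfolding K_def using fin that k by (intro member_le_sum) auto
  define F where "F t = (\<Sum>i\<in>beams net. E i t)" for t
  define F' where "F' t = (\<Sum>i\<in>beams net. E' i t)" for t
  have dF: "(F has_real_derivative F' t) (at t within {0..T})" if "t \<in> {0..T}" for t
    unfolding F_def[abs_def] F'_def using E' that by (intro DERIV_sum)
  have F'le: "F' t \<le> K * F t" if t: "t \<in> {0<..<T}" for t
  proof -
    have "nodal_identities net (\<lambda>i x. d i (x, t)) (\<lambda>n. q n t - q n t)"
      unfolding d_def using y(2) y'(2) t by (intro nodal_identities_diff) (auto simp: solves_system_iff)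
    then have "nodal_identities net (\<lambda>i x. d i (x, t)) (\<lambda>n. 0)" by simp
    note power = nodal_power_zero[OF wf rot_SO3 this]
    have "F' t \<le> (\<Sum>i\<in>beams net. K * E i t + 2 * (upper (d i (len net i, t)) \<bullet> lower (d i (len net i, t))
        - upper (d i (0, t)) \<bullet> lower (d i (0, t))))"
      unfolding F'_def
    proof (rule sum_mono)
      fix j assume j: "j \<in> beams net"
      have "k j * E j t \<le> K * E j t" using kK[OF j] E0[OF j, of t] t by (intro mult_right_mono) auto
      then show "E' j t \<le> K * E j t + 2 * (upper (d j (len net j, t)) \<bullet> lower (d j (len net j, t))
        - upper (d j (0, t)) \<bullet> lower (d j (0, t)))" using E'le[OF j t] by linarith
    qed
    also have "\<dots> = K * F t + 2 * (\<Sum>i\<in>beams net. upper (d i (len net i, t)) \<bullet> lower (d i (len net i, t))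
        - upper (d i (0, t)) \<bullet> lower (d i (0, t)))"
      by (simp add: sum.distrib F_def sum_distrib_left)
    finally show ?thesis using power by simp
  qed
  have F0: "F 0 = 0"
    unfolding F_def
  proof (rule sum.neutral, intro ballI)
    fix j assume j: "j \<in> beams net"
    have "integral {0..len net j} (\<lambda>x. d j (x, 0) \<bullet> (Q_mat net j x *v d j (x, 0))) = integral {0..len net j} (\<lambda>x. 0)"
      using y(2) y'(2) j by (intro integral_spike[where S = "{0, len net j}"]) (auto simp: solves_system_iff d_def)
    then show "E j 0 = 0" by (simp add: E_def)
  qed
  have Fle: "F t \<le> 0" if t: "t \<in> {0..T}" for t
  proof (cases "t = 0")
    case False
    then have t0: "0 < t" using t by simp
    \<comment> \<open>The nodal conditions, and with them the differential inequality, hold at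
      interior times only; monotonicity comes from the derivative on the open interval together with
      continuity up to the end points.\<close>
    define H where "H s = exp (- K * s) * F s" for s
    have "H t \<le> H 0"
    proof (rule DERIV_nonpos_imp_decreasing_open[OF less_imp_le[OF t0]])
      fix s assume s: "0 < s" "s < t"
      have "(F has_real_derivative F' s) (at s)"
        using dF[of s] s t at_within_Icc_at[of 0 s T] by auto
      then have "(H has_real_derivative exp (- K * s) * (F' s - K * F s)) (at s)"
        unfolding H_def by (auto intro!: derivative_eq_intros simp: algebra_simps)
      moreover have "exp (- K * s) * (F' s - K * F s) \<le> 0"
        using F'le[of s] s t by (intro mult_nonneg_nonpos) auto
      ultimately show "\<exists>z. (H has_real_derivative z) (at s) \<and> z \<le> 0" by blast
    next
      have "continuous_on {0..T} F"
        using dF by (meson DERIV_continuous continuous_on_eq_continuous_within)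
      then have "continuous_on {0..t} F" by (rule continuous_on_subset) (use t in auto)
      then show "continuous_on {0..t} H" unfolding H_def[abs_def] by (intro continuous_intros)
    qed
    then have "exp (- K * t) * F t \<le> 0" by (simp add: H_def F0)
    then show ?thesis by (simp add: mult_le_0_iff)
  qed (simp add: F0)
  obtain x t where xt: "p = (x, t)" "x \<in> {0..len net i}" "t \<in> {0..T}" using p by auto
  have "E i t \<le> F t" unfolding F_def using fin i E0 xt by (intro member_le_sum) auto
  then have "E i t = 0" using Fle[OF xt(3)] E0[OF i xt(3)] by simp
  then have "d i (x, t) = 0" by (rule zero[OF i xt(3,2)])
  then show ?thesis by (simp add: d_def xt(1))
qed

end

section \<open>Classical solutions of diagonal systems\<close>

text \<open>\<open>\<sigma>\<close> is the travel time, an antiderivative of \<open>1 / c\<close>,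
  and \<open>\<xi>\<close> its inverse. In the coordinate \<open>\<sigma>\<close> the wave moves
  with speed 1, the setting of \<open>mild_form\<close>.\<close>

lemma travel_time:
  fixes c :: "real \<Rightarrow> real"
  assumes l: "l > 0" and c: "continuous_on {0..l} c" "\<And>x. x \<in> {0..l} \<Longrightarrow> c x > 0"
  obtains \<sigma> \<xi> \<tau> where "\<tau> > 0" "continuous_on {0..\<tau>} \<xi>"
    and "\<And>s. s \<in> {0..\<tau>} \<Longrightarrow> \<xi> s \<in> {0..l} \<and> \<sigma> (\<xi> s) = s"
    and "\<And>x. x \<in> {0..l} \<Longrightarrow> \<sigma> x \<in> {0..\<tau>} \<and> \<xi> (\<sigma> x) = x"
    and "\<sigma> 0 = 0" "\<sigma> l = \<tau>"
    and "\<And>x. x \<in> {0..l} \<Longrightarrow> (\<sigma> has_real_derivative 1 / c x) (at x within {0..l})"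
proof -
  define \<sigma> where "\<sigma> x = integral {0..x} (\<lambda>x. 1 / c x)" for x
  have ci: "continuous_on {0..l} (\<lambda>x. 1 / c x)"
    using c(2) by (intro continuous_intros c(1)) fastforce
  have der: "(\<sigma> has_real_derivative 1 / c x) (at x within {0..l})" if "x \<in> {0..l}" for x
    unfolding \<sigma>_def[abs_def] by (rule integral_has_real_derivative[OF ci that])
  have cont: "continuous_on {0..l} \<sigma>"
    using der by (meson DERIV_continuous continuous_on_eq_continuous_within)
  have mono: "\<sigma> x < \<sigma> y" if "0 \<le> x" "x < y" "y \<le> l" for x y
  proof (rule DERIV_pos_imp_increasing_open[OF that(2)])
    fix z assume z: "x < z" "z < y"
    then have "(\<sigma> has_real_derivative 1 / c z) (at z)"
      using der[of z] that at_within_Icc_at[of 0 z l] by auto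
    then show "\<exists>d. (\<sigma> has_real_derivative d) (at z) \<and> d > 0"
      using c(2)[of z] z that by (intro exI[of _ "1 / c z"]) auto
  qed (use that in \<open>auto intro: continuous_on_subset[OF cont]\<close>)
  have inj: "inj_on \<sigma> {0..l}"
    by (rule linorder_inj_onI) (use mono in \<open>fastforce+\<close>)
  define \<tau> where "\<tau> = \<sigma> l"
  have \<sigma>0: "\<sigma> 0 = 0" by (simp add: \<sigma>_def)
  have \<tau>: "\<tau> > 0" using mono[of 0 l] l \<sigma>0 by (simp add: \<tau>_def)
  have img: "\<sigma> x \<in> {0..\<tau>}" if "x \<in> {0..l}" for x
    using mono[of 0 x] mono[of x l] that \<sigma>0 by (cases "x = 0"; cases "x = l") (auto simp: \<tau>_def less_imp_le)
  have surj: "\<sigma> ` {0..l} = {0..\<tau>}"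
  proof
    show "{0..\<tau>} \<subseteq> \<sigma> ` {0..l}"
    proof
      fix s assume "s \<in> {0..\<tau>}"
      then obtain x where "0 \<le> x" "x \<le> l" "\<sigma> x = s"
        using IVT'[of \<sigma> 0 s l] \<sigma>0 l cont by (auto simp: \<tau>_def)
      then show "s \<in> \<sigma> ` {0..l}" by auto
    qed
  qed (use img in auto)
  define \<xi> where "\<xi> = inv_into {0..l} \<sigma>"
  have \<xi>\<sigma>: "\<xi> (\<sigma> x) = x" if "x \<in> {0..l}" for x
    unfolding \<xi>_def by (rule inv_into_f_f[OF inj that])
  have contx: "continuous_on {0..\<tau>} \<xi>"
    using continuous_on_inv[OF cont compact_Icc, of \<xi>] \<xi>\<sigma> surj by simp
  have inv: "\<xi> s \<in> {0..l} \<and> \<sigma> (\<xi> s) = s" if "s \<in> {0..\<tau>}" for s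
  proof -
    have "s \<in> \<sigma> ` {0..l}" using that surj by simp
    then obtain x where x: "x \<in> {0..l}" "s = \<sigma> x" by blast
    then show ?thesis using \<xi>\<sigma>[OF x(1)] by simp
  qed
  have "\<sigma> x \<in> {0..\<tau>} \<and> \<xi> (\<sigma> x) = x" if "x \<in> {0..l}" for x
    using img[OF that] \<xi>\<sigma>[OF that] by blast
  from that[OF \<tau> contx inv this \<sigma>0 \<tau>_def[symmetric] der] show thesis .
qed

definition entrance :: "real \<Rightarrow> real \<Rightarrow> real" where "entrance \<epsilon> l = (if \<epsilon> > 0 then 0 else l)"
definition exit_pos :: "real \<Rightarrow> real \<Rightarrow> real" where "exit_pos \<epsilon> l = (if \<epsilon> > 0 then l else 0)"

lemma oriented_travel_time:
  fixes c :: "real \<Rightarrow> real"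
  assumes l: "l > 0" and c: "continuous_on {0..l} c" "\<And>x. x \<in> {0..l} \<Longrightarrow> c x > 0" and \<epsilon>: "\<epsilon> = 1 \<or> \<epsilon> = -1"
  shows "\<exists>\<sigma> \<xi> \<tau>. \<tau> > 0 \<and> continuous_on {0..\<tau>} \<xi>
    \<and> (\<forall>s\<in>{0..\<tau>}. \<xi> s \<in> {0..l} \<and> \<sigma> (\<xi> s) = s)
    \<and> (\<forall>x\<in>{0..l}. \<sigma> x \<in> {0..\<tau>} \<and> \<xi> (\<sigma> x) = x)
    \<and> \<sigma> (entrance \<epsilon> l) = 0 \<and> \<sigma> (exit_pos \<epsilon> l) = \<tau>
    \<and> (\<forall>x\<in>{0..l}. (\<sigma> has_real_derivative \<epsilon> / c x) (at x within {0..l}))"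
proof -
  obtain \<sigma> \<xi> \<tau> where t: "\<tau> > 0" "continuous_on {0..\<tau>} \<xi>"
    "\<And>s. s \<in> {0..\<tau>} \<Longrightarrow> \<xi> s \<in> {0..l} \<and> \<sigma> (\<xi> s) = s"
    "\<And>x. x \<in> {0..l} \<Longrightarrow> \<sigma> x \<in> {0..\<tau>} \<and> \<xi> (\<sigma> x) = x"
    "\<sigma> 0 = 0" "\<sigma> l = \<tau>"
    "\<And>x. x \<in> {0..l} \<Longrightarrow> (\<sigma> has_real_derivative 1 / c x) (at x within {0..l})"
  proof (rule travel_time[OF l c(1)], goal_cases)
    case (1 x)
    show ?case by (rule c(2)[OF 1(2)])
  next
    case 2
    show ?case by (rule 2(1)[OF 2(2-)])
  qed
  show ?thesis
  proof (cases "\<epsilon> = 1")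
    case True
    then show ?thesis using t by (intro exI[of _ \<sigma>] exI[of _ \<xi>] exI[of _ \<tau>]) (auto simp: entrance_def exit_pos_def)
  next
    case False
    then have \<epsilon>: "\<epsilon> = -1" using \<epsilon> by simp
    \<comment> \<open>For a wave moving to the left the travel time is counted from the right end,
      so that the coordinate vanishes at the entrance for either orientation.\<close>
    have "continuous_on {0..\<tau>} (\<lambda>s. \<xi> (\<tau> - s))"
      by (rule continuous_on_compose2[OF t(2)]) (auto intro!: continuous_intros)
    moreover have "\<xi> (\<tau> - s) \<in> {0..l} \<and> \<tau> - \<sigma> (\<xi> (\<tau> - s)) = s" if "s \<in> {0..\<tau>}" for s
      using t(3)[of "\<tau> - s"] that by auto
    moreover have "\<tau> - \<sigma> x \<in> {0..\<tau>} \<and> \<xi> (\<tau> - (\<tau> - \<sigma> x)) = x" if "x \<in> {0..l}" for x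
      using t(4)[OF that] by auto
    moreover have "((\<lambda>x. \<tau> - \<sigma> x) has_real_derivative \<epsilon> / c x) (at x within {0..l})" if "x \<in> {0..l}" for x
      using t(7)[OF that] \<epsilon> by (auto intro!: derivative_eq_intros)
    ultimately show ?thesis using t(1,5,6) \<epsilon>
      by (intro exI[of _ "\<lambda>x. \<tau> - \<sigma> x"] exI[of _ "\<lambda>s. \<xi> (\<tau> - s)"] exI[of _ \<tau>])
        (auto simp: entrance_def exit_pos_def)
  qed
qed

lemma has_vector_derivative_vecI:
  fixes f :: "real \<Rightarrow> real^'m"
  assumes "\<And>m. ((\<lambda>x. f x $ m) has_vector_derivative D $ m) (at x within S)"
  shows "(f has_vector_derivative D) (at x within S)"
  unfolding has_vector_derivative_iff_quotient
  by (rule vec_tendstoI) (use assms in \<open>simp add: has_vector_derivative_iff_quotient\<close>)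

lemma norm_vec_le_card:
  fixes v :: "real^'m"
  assumes "\<And>m. \<bar>v $ m\<bar> \<le> M"
  shows "norm v \<le> real CARD('m) * M"
proof -
  have "norm v \<le> (\<Sum>m\<in>UNIV. \<bar>v $ m\<bar>)" by (rule norm_le_l1_cart)
  also have "\<dots> \<le> (\<Sum>m\<in>(UNIV :: 'm set). M)" by (intro sum_mono assms)
  finally show ?thesis by simp
qed

lemma uniform_bound_family:
  fixes f :: "'i \<Rightarrow> 'a::topological_space \<Rightarrow> 'b::real_normed_vector"
  assumes "finite I" "\<And>i. i \<in> I \<Longrightarrow> compact (K i)" "\<And>i. i \<in> I \<Longrightarrow> continuous_on (K i) (f i)"
  obtains b where "b > 0" "\<And>i p. i \<in> I \<Longrightarrow> p \<in> K i \<Longrightarrow> norm (f i p) \<le> b"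
proof -
  have "bounded (f i ` K i)" if "i \<in> I" for i
    using assms that by (intro compact_imp_bounded compact_continuous_image)
  then have "bounded (\<Union>i\<in>I. f i ` K i)" using assms(1) by (intro bounded_UN) auto
  then obtain b where "b > 0" "\<forall>x\<in>(\<Union>i\<in>I. f i ` K i). norm x \<le> b" unfolding bounded_pos by blast
  then show thesis using that[of b] by blast
qed

text \<open>\<open>w0\<close> is the time derivative at time \<open>0\<close> of a solution with initial profile \<open>r0\<close>; \<open>Bd\<close> acts on
  time derivatives.\<close>

locale transport_problem =
  fixes I :: "'i set" and l :: "'i \<Rightarrow> real" and c :: "'i \<Rightarrow> 'm::finite \<Rightarrow> real \<Rightarrow> real" and \<epsilon> :: "'m \<Rightarrow> real"
    and B :: "'i \<Rightarrow> real \<Rightarrow> real^'m^'m" and N :: "'i \<Rightarrow> real \<Rightarrow> real^'m \<Rightarrow> real^'m \<Rightarrow> real^'m" and T \<kappa>0 :: real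
    and Bd :: "'i \<Rightarrow> 'm \<Rightarrow> real \<Rightarrow> ('i \<Rightarrow> 'm \<Rightarrow> real) \<Rightarrow> real" and r0 r0' w0 :: "'i \<Rightarrow> real \<Rightarrow> real^'m" and \<delta> :: real
  assumes \<delta>: "\<delta> \<ge> 0"
    and r0: "\<And>i x. i \<in> I \<Longrightarrow> x \<in> {0..l i} \<Longrightarrow> (r0 i has_vector_derivative r0' i x) (at x within {0..l i})"
    and w0: "\<And>i. i \<in> I \<Longrightarrow> continuous_on {0..l i} (w0 i)"
    and r0_le: "\<And>i x. i \<in> I \<Longrightarrow> x \<in> {0..l i} \<Longrightarrow> norm (r0 i x) \<le> \<delta>"
    and w0_le: "\<And>i x. i \<in> I \<Longrightarrow> x \<in> {0..l i} \<Longrightarrow> norm (w0 i x) \<le> \<delta>"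
    and w0_eq: "\<And>i x m. i \<in> I \<Longrightarrow> x \<in> {0..l i} \<Longrightarrow>
      w0 i x $ m + \<epsilon> m * c i m x * r0' i x $ m = (B i x *v r0 i x + N i x (r0 i x) (r0 i x)) $ m"
    and Bcont: "\<And>o' i m. (\<And>k m'. k \<in> I \<Longrightarrow> continuous_on {0..T} (o' k m')) \<Longrightarrow> i \<in> I
      \<Longrightarrow> continuous_on {0..T} (\<lambda>t. Bd i m t (\<lambda>k m'. o' k m' t))"
    and Blip: "\<And>i m t o1 o2 M. i \<in> I \<Longrightarrow> t \<in> {0..T} \<Longrightarrow> (\<And>k m'. k \<in> I \<Longrightarrow> \<bar>o1 k m' - o2 k m'\<bar> \<le> M)
      \<Longrightarrow> \<bar>Bd i m t o1 - Bd i m t o2\<bar> \<le> \<kappa>0 * M"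
    and Bbd: "\<And>i m t. i \<in> I \<Longrightarrow> t \<in> {0..T} \<Longrightarrow> \<bar>Bd i m t (\<lambda>_ _. 0)\<bar> \<le> \<delta>"
    and compat: "\<And>i m. i \<in> I \<Longrightarrow>
      Bd i m 0 (\<lambda>k m'. w0 k (exit_pos (\<epsilon> m') (l k)) $ m') = w0 i (entrance (\<epsilon> m) (l i)) $ m"

text \<open>\<open>w\<close> and \<open>\<rho>\<close> are the time and space derivatives of
  \<open>r\<close>. The boundary condition is imposed on \<open>w\<close>; the conditions on
  \<open>r\<close> itself are regained later by integration in time.\<close>

locale transport_solution =
  fixes I :: "'i set" and l :: "'i \<Rightarrow> real" and c :: "'i \<Rightarrow> 'm::finite \<Rightarrow> real \<Rightarrow> real" and \<epsilon> :: "'m \<Rightarrow> real"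
    and B :: "'i \<Rightarrow> real \<Rightarrow> real^'m^'m" and N :: "'i \<Rightarrow> real \<Rightarrow> real^'m \<Rightarrow> real^'m \<Rightarrow> real^'m" and T :: real
    and Bd :: "'i \<Rightarrow> 'm \<Rightarrow> real \<Rightarrow> ('i \<Rightarrow> 'm \<Rightarrow> real) \<Rightarrow> real" and r0 :: "'i \<Rightarrow> real \<Rightarrow> real^'m" and M :: real
    and r w \<rho> :: "'i \<Rightarrow> real \<times> real \<Rightarrow> real^'m"
  assumes rc: "\<And>i. i \<in> I \<Longrightarrow> continuous_on ({0..l i} \<times> {0..T}) (r i)"
    and wc: "\<And>i. i \<in> I \<Longrightarrow> continuous_on ({0..l i} \<times> {0..T}) (w i)"
    and \<rho>c: "\<And>i. i \<in> I \<Longrightarrow> continuous_on ({0..l i} \<times> {0..T}) (\<rho> i)"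
    and rt: "\<And>i x t. i \<in> I \<Longrightarrow> x \<in> {0..l i} \<Longrightarrow> t \<in> {0..T} \<Longrightarrow>
      ((\<lambda>t. r i (x, t)) has_vector_derivative w i (x, t)) (at t within {0..T})"
    and rx: "\<And>i x t. i \<in> I \<Longrightarrow> x \<in> {0..l i} \<Longrightarrow> t \<in> {0..T} \<Longrightarrow>
      ((\<lambda>x. r i (x, t)) has_vector_derivative \<rho> i (x, t)) (at x within {0..l i})"
    and pde: "\<And>i x t m. i \<in> I \<Longrightarrow> x \<in> {0..l i} \<Longrightarrow> t \<in> {0..T} \<Longrightarrow>
      w i (x, t) $ m + \<epsilon> m * c i m x * \<rho> i (x, t) $ m = (B i x *v r i (x, t) + N i x (r i (x, t)) (r i (x, t))) $ m"
    and rb: "\<And>i x t. i \<in> I \<Longrightarrow> x \<in> {0..l i} \<Longrightarrow> t \<in> {0..T} \<Longrightarrow> norm (r i (x, t)) \<le> M"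
      "\<And>i x t. i \<in> I \<Longrightarrow> x \<in> {0..l i} \<Longrightarrow> t \<in> {0..T} \<Longrightarrow> norm (w i (x, t)) \<le> M"
      "\<And>i x t. i \<in> I \<Longrightarrow> x \<in> {0..l i} \<Longrightarrow> t \<in> {0..T} \<Longrightarrow> norm (\<rho> i (x, t)) \<le> M"
    and r_0: "\<And>i x. i \<in> I \<Longrightarrow> x \<in> {0..l i} \<Longrightarrow> r i (x, 0) = r0 i x"
    and bc: "\<And>i t m. i \<in> I \<Longrightarrow> t \<in> {0..T} \<Longrightarrow>
      w i (entrance (\<epsilon> m) (l i), t) $ m = Bd i m t (\<lambda>k m'. w k (exit_pos (\<epsilon> m') (l k), t) $ m')"

text \<open>The unknown of the fixed point problem is \<open>w = \<partial>\<^sub>t r\<close>; the profile itself is recovered as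
  \<open>r = r0 + \<integral> w\<close>. Since the speeds do not depend on time, \<open>w\<close> solves the
  time-differentiated system, which is again of the same form.\<close>

theorem transport_network_solution:
  fixes I :: "'i set" and l :: "'i \<Rightarrow> real" and c :: "'i \<Rightarrow> 'm::finite \<Rightarrow> real \<Rightarrow> real" and \<epsilon> :: "'m \<Rightarrow> real"
    and B :: "'i \<Rightarrow> real \<Rightarrow> real^'m^'m" and N :: "'i \<Rightarrow> real \<Rightarrow> real^'m \<Rightarrow> real^'m \<Rightarrow> real^'m"
  assumes I: "finite I" and l: "\<And>i. i \<in> I \<Longrightarrow> l i > 0" and T: "T > 0" and \<kappa>0: "\<kappa>0 \<ge> 0"
    and c: "\<And>i m. i \<in> I \<Longrightarrow> continuous_on {0..l i} (c i m)" "\<And>i m x. i \<in> I \<Longrightarrow> x \<in> {0..l i} \<Longrightarrow> c i m x > 0"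
    and \<epsilon>: "\<And>m. \<epsilon> m = 1 \<or> \<epsilon> m = -1"
    and B: "\<And>i. i \<in> I \<Longrightarrow> continuous_on {0..l i} (B i)"
    and N: "\<And>i x. i \<in> I \<Longrightarrow> x \<in> {0..l i} \<Longrightarrow> bounded_bilinear (N i x)"
      "\<And>i. i \<in> I \<Longrightarrow> continuous_on ({0..l i} \<times> UNIV \<times> UNIV) (\<lambda>(x, u, v). N i x u v)"
      "\<And>i x u v. i \<in> I \<Longrightarrow> x \<in> {0..l i} \<Longrightarrow> norm (N i x u v) \<le> \<nu> * norm u * norm v" "\<nu> \<ge> 0"
  obtains C where "C > 0" and
    "\<And>Bd r0 r0' w0 \<delta>. transport_problem I l c \<epsilon> B N T \<kappa>0 Bd r0 r0' w0 \<delta> \<Longrightarrow> C * \<delta> \<le> 1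
      \<Longrightarrow> \<exists>r w \<rho>. transport_solution I l c \<epsilon> B N T Bd r0 (C * \<delta>) r w \<rho>"
proof -
  define n where "n = real CARD('m)"
  have n: "n \<ge> 1" by (simp add: n_def Suc_le_eq)
  have "\<forall>j\<in>I \<times> (UNIV :: 'm set). \<exists>\<sigma> \<xi> \<tau>. \<tau> > 0 \<and> continuous_on {0..\<tau>} \<xi>
    \<and> (\<forall>s\<in>{0..\<tau>}. \<xi> s \<in> {0..l (fst j)} \<and> \<sigma> (\<xi> s) = s)
    \<and> (\<forall>x\<in>{0..l (fst j)}. \<sigma> x \<in> {0..\<tau>} \<and> \<xi> (\<sigma> x) = x)
    \<and> \<sigma> (entrance (\<epsilon> (snd j)) (l (fst j))) = 0 \<and> \<sigma> (exit_pos (\<epsilon> (snd j)) (l (fst j))) = \<tau>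
    \<and> (\<forall>x\<in>{0..l (fst j)}. (\<sigma> has_real_derivative \<epsilon> (snd j) / c (fst j) (snd j) x) (at x within {0..l (fst j)}))"
    by (intro ballI oriented_travel_time) (use l c \<epsilon> in \<open>auto\<close>)
  then obtain \<sigma> \<xi> \<tau> where travel: "\<forall>j\<in>I \<times> (UNIV :: 'm set). \<tau> j > 0 \<and> continuous_on {0..\<tau> j} (\<xi> j)
    \<and> (\<forall>s\<in>{0..\<tau> j}. \<xi> j s \<in> {0..l (fst j)} \<and> \<sigma> j (\<xi> j s) = s)
    \<and> (\<forall>x\<in>{0..l (fst j)}. \<sigma> j x \<in> {0..\<tau> j} \<and> \<xi> j (\<sigma> j x) = x)
    \<and> \<sigma> j (entrance (\<epsilon> (snd j)) (l (fst j))) = 0 \<and> \<sigma> j (exit_pos (\<epsilon> (snd j)) (l (fst j))) = \<tau> j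
    \<and> (\<forall>x\<in>{0..l (fst j)}. (\<sigma> j has_real_derivative \<epsilon> (snd j) / c (fst j) (snd j) x) (at x within {0..l (fst j)}))"
    unfolding bchoice_iff by blast
  have \<tau>: "\<tau> (i, m) > 0" and \<xi>: "continuous_on {0..\<tau> (i, m)} (\<xi> (i, m))"
    and \<xi>_in: "\<And>s. s \<in> {0..\<tau> (i, m)} \<Longrightarrow> \<xi> (i, m) s \<in> {0..l i}" "\<And>s. s \<in> {0..\<tau> (i, m)} \<Longrightarrow> \<sigma> (i, m) (\<xi> (i, m) s) = s"
    and \<sigma>_in: "\<And>x. x \<in> {0..l i} \<Longrightarrow> \<sigma> (i, m) x \<in> {0..\<tau> (i, m)}" "\<And>x. x \<in> {0..l i} \<Longrightarrow> \<xi> (i, m) (\<sigma> (i, m) x) = x"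
    and \<sigma>_ends: "\<sigma> (i, m) (entrance (\<epsilon> m) (l i)) = 0" "\<sigma> (i, m) (exit_pos (\<epsilon> m) (l i)) = \<tau> (i, m)"
    and \<sigma>_der: "\<And>x. x \<in> {0..l i} \<Longrightarrow> (\<sigma> (i, m) has_real_derivative \<epsilon> m / c i m x) (at x within {0..l i})"
    if "i \<in> I" for i m
    using bspec[OF travel, of "(i, m)"] that by auto
  have \<sigma>_cont: "continuous_on {0..l i} (\<sigma> (i, m))" if "i \<in> I" for i m
    using \<sigma>_der[OF that] by (meson DERIV_continuous continuous_on_eq_continuous_within)
  obtain b where b: "b > 0" "\<And>i x. i \<in> I \<Longrightarrow> x \<in> {0..l i} \<Longrightarrow> norm (B i x) \<le> b"
    using uniform_bound_family[of I "\<lambda>i. {0..l i}" B] I B by auto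
  obtain ci where ci: "ci > 0" "\<And>i m x. i \<in> I \<Longrightarrow> x \<in> {0..l i} \<Longrightarrow> \<bar>1 / c i m x\<bar> \<le> ci"
  proof -
    have "continuous_on {0..l (fst j)} (\<lambda>x. 1 / c (fst j) (snd j) x)" if "j \<in> I \<times> (UNIV :: 'm set)" for j
    proof -
      have "c (fst j) (snd j) x \<noteq> 0" if "x \<in> {0..l (fst j)}" for x
        using c(2)[of "fst j" x "snd j"] that \<open>j \<in> I \<times> (UNIV :: 'm set)\<close> by auto
      then show ?thesis using that by (intro continuous_intros c(1)) auto
    qed
    then obtain b where "b > 0" "\<And>j x. j \<in> I \<times> (UNIV :: 'm set) \<Longrightarrow> x \<in> {0..l (fst j)} \<Longrightarrow> norm (1 / c (fst j) (snd j) x) \<le> b"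
      using uniform_bound_family[of "I \<times> (UNIV :: 'm set)" "\<lambda>j. {0..l (fst j)}" "\<lambda>j x. 1 / c (fst j) (snd j) x"] I
      by auto
    then show thesis using that[of b] by fastforce
  qed
  \<comment> \<open>Lipschitz constant of the source on the unit ball. The linear term gives
    \<open>b * n\<close>. In the bilinear term \<open>r\<close> is bounded by
    \<open>1 + T * n\<close> and \<open>w\<close> by \<open>n\<close>, while their differences are
    at most \<open>T * n\<close> and \<open>n\<close> times that of the components.\<close>
  define L where "L = b * n + 2 * \<nu> * ((1 + T * n) * n + T * n * n)"
  have L: "L \<ge> 0" using b N(4) n T by (simp add: L_def)
  \<comment> \<open>The time derivative of \<open>f i x\<close> along a curve with value
    \<open>\<rho>\<close> and velocity \<open>\<omega>\<close>: the right-hand side of the system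
    differentiated in time.\<close>
  define Df where "Df i x \<rho> \<omega> = B i x *v \<omega> + (N i x \<rho> \<omega> + N i x \<omega> \<rho>)" for i x \<rho> \<omega>
  define f where "f i x u = B i x *v u + N i x u u" for i x u
  \<comment> \<open>Back from the travel-time coordinates, which differ from component to component,
    to one vector at a common position.\<close>
  define Wv where "Wv w i p = (\<chi> m. w (i, m) (\<sigma> (i, m) (fst p), snd p))" for w :: "'i \<times> 'm \<Rightarrow> real \<times> real \<Rightarrow> real" and i p
  let ?J = "I \<times> (UNIV :: 'm set)"
  have J: "finite ?J" using I by simp
  have \<tau>J: "\<tau> j > 0" if "j \<in> ?J" for j using \<tau>[of "fst j" "snd j"] that by auto
  obtain C0 where C0: "C0 > 0" and mild: "\<And>F Bd w0 \<delta>. mild_problem ?J \<tau> T L \<kappa>0 F Bd w0 \<delta> \<Longrightarrow> C0 * \<delta> \<le> 1 \<Longrightarrow>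
    \<exists>w. \<forall>j\<in>?J. continuous_on ({0..\<tau> j} \<times> {0..T}) (w j)
      \<and> (\<forall>p\<in>{0..\<tau> j} \<times> {0..T}. \<bar>w j p\<bar> \<le> C0 * \<delta>
           \<and> w j p = mild_form (\<lambda>t. Bd j t (\<lambda>k. w k (\<tau> k, t))) (w0 j) (F w j) p)
      \<and> (\<forall>s\<in>{0..\<tau> j}. w j (s, 0) = w0 j s)"
  proof (rule mild_solution_exists[where \<tau> = \<tau>, OF J _ T L \<kappa>0], goal_cases)
    case (1 j)
    then show "\<tau> j > 0" by (intro \<tau>J)
  next
    case (2 C)
    show thesis by (rule 2(1)[OF 2(2)], rule 2(3))
  qed
  \<comment> \<open>\<open>C1 * \<delta>\<close> bounds \<open>r\<close>, which starts below
    \<open>\<delta>\<close> and changes at a rate of at most \<open>n * C0 * \<delta>\<close>, as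
    well as \<open>w\<close>. The last summand of \<open>C\<close> bounds the space derivative, read
    off from the equation.\<close>
  define C1 where "C1 = 1 + n * C0 * (1 + T)"
  have C1: "C1 \<ge> 1" using C0 n T by (simp add: C1_def)
  define C where "C = C1 + C0 + n * (ci * ((b + \<nu>) * C1 + C1))"
  have C: "C \<ge> C1" "C \<ge> C0" "C \<ge> 1" "C \<ge> n * (ci * ((b + \<nu>) * C1 + C1))"
  proof -
    have "0 \<le> n * (ci * ((b + \<nu>) * C1 + C1))"
      using C1 n b(1) ci(1) N(4) by (intro mult_nonneg_nonneg add_nonneg_nonneg) auto
    then show "C \<ge> C1" "C \<ge> C0" "C \<ge> 1" "C \<ge> n * (ci * ((b + \<nu>) * C1 + C1))"
      using C1 C0 unfolding C_def by linarith+
  qed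
  have Wv_cont: "continuous_on ({0..l i} \<times> {0..T}) (Wv w i)"
    if i: "i \<in> I" and w: "\<And>m. continuous_on ({0..\<tau> (i, m)} \<times> {0..T}) (w (i, m))" for w i
    unfolding Wv_def[abs_def]
  proof (intro continuous_on_vec_lambda)
    fix m
    have s: "continuous_on ({0..l i} \<times> {0..T}) (\<lambda>p. \<sigma> (i, m) (fst p))"
      by (rule continuous_on_compose2[OF \<sigma>_cont[OF i]]) (auto intro!: continuous_intros)
    show "continuous_on ({0..l i} \<times> {0..T}) (\<lambda>p. w (i, m) (\<sigma> (i, m) (fst p), snd p))"
      by (rule continuous_on_compose2[OF w])
        (use \<sigma>_in(1)[OF i] in \<open>auto intro!: continuous_intros s\<close>)
  qed
  have N_cont: "continuous_on S (\<lambda>p. N i (\<alpha> p) (u p) (v p))"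
    if "i \<in> I" "continuous_on S \<alpha>" "\<alpha> ` S \<subseteq> {0..l i}" "continuous_on S u" "continuous_on S v"
    for S :: "(real \<times> real) set" and \<alpha> u v i
  proof -
    have "continuous_on S (\<lambda>p. (\<lambda>(x, u, v). N i x u v) (\<alpha> p, u p, v p))"
      by (rule continuous_on_compose2[OF N(2)[OF that(1)]]) (use that in \<open>auto intro!: continuous_intros\<close>)
    then show ?thesis by simp
  qed
  show thesis
  proof (rule that[of C])
    show "C > 0" using C by simp
    fix Bd :: "'i \<Rightarrow> 'm \<Rightarrow> real \<Rightarrow> ('i \<Rightarrow> 'm \<Rightarrow> real) \<Rightarrow> real" and r0 r0' w0 \<delta>
    assume "transport_problem I l c \<epsilon> B N T \<kappa>0 Bd r0 r0' w0 \<delta>" and C\<delta>: "C * \<delta> \<le> 1"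
    then interpret transport_problem I l c \<epsilon> B N T \<kappa>0 Bd r0 r0' w0 \<delta> by simp
    have \<delta>1: "\<delta> \<le> 1" "C0 * \<delta> \<le> 1" "C1 * \<delta> \<le> C * \<delta>"
      using \<delta> C\<delta> C mult_right_mono[of 1 C \<delta>] mult_right_mono[of C0 C \<delta>] mult_right_mono[of C1 C \<delta>] by auto
    have r0_cont: "continuous_on {0..l i} (r0 i)" if "i \<in> I" for i
      using r0[OF that] has_vector_derivative_continuous continuous_on_eq_continuous_within by blast
    \<comment> \<open>The profile at time \<open>t\<close> depends on all earlier values of
      \<open>w\<close>. This is why sources are causal functionals of the whole unknown rather than
      functions of its present value.\<close>
    define Rv where "Rv w i p = r0 i (fst p) + integral {0..snd p} (\<lambda>t'. Wv w i (fst p, t'))" for w i p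
    define F where "F w j p = Df (fst j) (\<xi> j (fst p)) (Rv w (fst j) (\<xi> j (fst p), snd p))
        (Wv w (fst j) (\<xi> j (fst p), snd p)) $ snd j" for w and j :: "'i \<times> 'm" and p :: "real \<times> real"
    define Bd' where "Bd' j t o' = Bd (fst j) (snd j) t (\<lambda>k m'. o' (k, m'))" for j :: "'i \<times> 'm" and t and o' :: "'i \<times> 'm \<Rightarrow> real"
    define w0' where "w0' j s = w0 (fst j) (\<xi> j s) $ snd j" for j :: "'i \<times> 'm" and s
    let ?adm = "admissible ?J \<tau> T"
    have slice: "continuous_on {0..t} (\<lambda>t'. g (x, t'))"
      if "continuous_on ({0..l i} \<times> {0..T}) g" "x \<in> {0..l i}" "t \<le> T"
      for g :: "real \<times> real \<Rightarrow> real^'m" and x t i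
      by (rule continuous_on_compose2[OF that(1)]) (use that in \<open>auto intro!: continuous_intros\<close>)
    have admW: "continuous_on ({0..l i} \<times> {0..T}) (Wv w i)" if "?adm w" "i \<in> I" for w i
      using that by (intro Wv_cont) (auto simp: admissible_def)
    have Rv_cont: "continuous_on ({0..l i} \<times> {0..T}) (Rv w i)"
      if i: "i \<in> I" and w: "continuous_on ({0..l i} \<times> {0..T}) (Wv w i)" for w i
      unfolding Rv_def[abs_def]
    proof (intro continuous_on_add continuous_on_integral_moving)
      show "continuous_on ({0..l i} \<times> {0..T}) (\<lambda>p. r0 i (fst p))"
        by (rule continuous_on_compose2[OF r0_cont[OF i]]) (auto intro!: continuous_intros)
      show "continuous_on {(p, u). p \<in> {0..l i} \<times> {0..T} \<and> u \<in> {0..snd p}} (\<lambda>(p, u). Wv w i (fst p, u))"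
        unfolding case_prod_unfold
        by (rule continuous_on_compose2[OF w]) (auto intro!: continuous_intros)
    qed (auto intro!: continuous_intros)
    have Df_cont: "continuous_on S (\<lambda>p. Df i (\<alpha> p) (u p) (v p))"
      if "i \<in> I" "continuous_on S \<alpha>" "\<alpha> ` S \<subseteq> {0..l i}" "continuous_on S u" "continuous_on S v"
      for S :: "(real \<times> real) set" and \<alpha> u v i
      unfolding Df_def using that
      by (intro continuous_on_add N_cont continuous_on_matrix_vector_mult continuous_on_compose2[OF B[OF that(1)] that(2)])
    have F_cont: "continuous_on ({0..\<tau> j} \<times> {0..T}) (F w j)" if aw: "?adm w" and jJ: "j \<in> ?J" for w j
    proof -
      obtain i m where j: "j = (i, m)" "i \<in> I" using jJ by auto
      have x: "continuous_on ({0..\<tau> j} \<times> {0..T}) (\<lambda>p. \<xi> (i, m) (fst p))"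
        unfolding j by (rule continuous_on_compose2[OF \<xi>[OF j(2)]]) (auto intro!: continuous_intros)
      have sub: "(\<lambda>p. \<xi> (i, m) (fst p)) ` ({0..\<tau> j} \<times> {0..T}) \<subseteq> {0..l i}"
        using \<xi>_in(1)[OF j(2)] by (auto simp: j)
      have p: "continuous_on ({0..\<tau> j} \<times> {0..T}) (\<lambda>p. (\<xi> (i, m) (fst p), snd p))"
        by (intro continuous_intros x)
      have psub: "(\<lambda>p. (\<xi> (i, m) (fst p), snd p)) ` ({0..\<tau> j} \<times> {0..T}) \<subseteq> {0..l i} \<times> {0..T}"
        using sub by auto
      show ?thesis
        unfolding F_def[abs_def] j fst_conv snd_conv
        using x sub p psub unfolding j
        by (intro continuous_on_component Df_cont j(2)
            continuous_on_compose2[OF Rv_cont[OF j(2) admW[OF aw j(2)]]]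
            continuous_on_compose2[OF admW[OF aw j(2)]])
    qed
    have Wv_le: "norm (Wv w i (x, t) - Wv w' i (x, t)) \<le> n * M"
      if "i \<in> I" "x \<in> {0..l i}" "\<And>m s. s \<in> {0..\<tau> (i, m)} \<Longrightarrow> \<bar>w (i, m) (s, t) - w' (i, m) (s, t)\<bar> \<le> M" for w w' i x t M
      unfolding n_def by (rule norm_vec_le_card) (use that \<sigma>_in(1)[OF that(1)] in \<open>simp add: Wv_def\<close>)
    have Wv0: "Wv (\<lambda>_ _. 0) i p = 0" for i p by (simp add: Wv_def vec_eq_iff)
    have Wv_le0: "norm (Wv w i (x, t)) \<le> n * M"
      if "i \<in> I" "x \<in> {0..l i}" "\<And>m s. s \<in> {0..\<tau> (i, m)} \<Longrightarrow> \<bar>w (i, m) (s, t)\<bar> \<le> M" for w i x t M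
      using Wv_le[OF that(1,2), of w t "\<lambda>_ _. 0" M] that(3) by (simp add: Wv0)
    have int_le: "norm (integral {0..t} (\<lambda>t'. g (x, t'))) \<le> T * K"
      if "continuous_on ({0..l i} \<times> {0..T}) g" "x \<in> {0..l i}" "t \<in> {0..T}" "\<And>t'. t' \<in> {0..t} \<Longrightarrow> norm (g (x, t')) \<le> K" "K \<ge> 0"
      for g :: "real \<times> real \<Rightarrow> real^'m" and x t i K
    proof -
      have "norm (integral {0..t} (\<lambda>t'. g (x, t'))) \<le> integral {0..t} (\<lambda>_. K)"
        using that by (intro integral_norm_bound_integral integrable_continuous_real slice[OF that(1)]) auto
      also have "\<dots> = t * K" using that by simp
      also have "\<dots> \<le> T * K" using that by (intro mult_right_mono) auto
      finally show ?thesis .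
    qed
    have Rv_le: "norm (Rv w i (x, t)) \<le> \<delta> + T * (n * M)"
      if "i \<in> I" "x \<in> {0..l i}" "t \<in> {0..T}" "continuous_on ({0..l i} \<times> {0..T}) (Wv w i)" "M \<ge> 0"
        "\<And>m s t'. s \<in> {0..\<tau> (i, m)} \<Longrightarrow> t' \<in> {0..t} \<Longrightarrow> \<bar>w (i, m) (s, t')\<bar> \<le> M" for w i x t M
      unfolding Rv_def fst_conv snd_conv
      using that n
      by (intro order_trans[OF norm_triangle_ineq] add_mono r0_le int_le[OF that(4)] Wv_le0) auto
    have Df_diff: "\<bar>Df i x \<rho> \<omega> $ m - Df i x \<rho>' \<omega>' $ m\<bar> \<le> b * norm (\<omega> - \<omega>')
        + 2 * \<nu> * (norm \<rho> * norm (\<omega> - \<omega>') + norm (\<rho> - \<rho>') * norm \<omega>')"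
      if i: "i \<in> I" and x: "x \<in> {0..l i}" for i x \<rho> \<omega> \<rho>' \<omega>' m
    proof -
      interpret N: bounded_bilinear "N i x" by (rule N(1)[OF i x])
      have eq: "Df i x \<rho> \<omega> - Df i x \<rho>' \<omega>' = B i x *v (\<omega> - \<omega>') + ((N i x \<rho> (\<omega> - \<omega>') + N i x (\<rho> - \<rho>') \<omega>')
          + (N i x (\<omega> - \<omega>') \<rho> + N i x \<omega>' (\<rho> - \<rho>')))"
        by (simp add: Df_def matrix_vector_mult_diff_distrib N.diff_left N.diff_right)
      have Bn: "norm (B i x *v (\<omega> - \<omega>')) \<le> b * norm (\<omega> - \<omega>')"
        by (rule order_trans[OF norm_matrix_vector_le]) (intro mult_right_mono b i x norm_ge_zero)
      have "norm (Df i x \<rho> \<omega> - Df i x \<rho>' \<omega>') \<le> b * norm (\<omega> - \<omega>')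
          + ((\<nu> * norm \<rho> * norm (\<omega> - \<omega>') + \<nu> * norm (\<rho> - \<rho>') * norm \<omega>')
          + (\<nu> * norm (\<omega> - \<omega>') * norm \<rho> + \<nu> * norm \<omega>' * norm (\<rho> - \<rho>')))"
        unfolding eq by (intro order_trans[OF norm_triangle_ineq] add_mono Bn N(3) i x)
      also have "\<dots> = b * norm (\<omega> - \<omega>') + 2 * \<nu> * (norm \<rho> * norm (\<omega> - \<omega>') + norm (\<rho> - \<rho>') * norm \<omega>')"
        by (simp add: algebra_simps)
      finally show ?thesis using component_le_norm_cart[of "Df i x \<rho> \<omega> - Df i x \<rho>' \<omega>'" m] by simp
    qed
    have adm_le: "\<bar>w (i, m) (s, t)\<bar> \<le> 1" if "?adm w" "i \<in> I" "s \<in> {0..\<tau> (i, m)}" "t \<in> {0..T}" for w i m s t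
      using that by (auto simp: admissible_def)
    have F_lip: "\<bar>F w j (s, t) - F w' j (s, t)\<bar> \<le> L * M"
      if w: "?adm w" "?adm w'" and j': "j \<in> ?J" and s: "s \<in> {0..\<tau> j}" and t: "t \<in> {0..T}"
        and M: "\<And>k s t'. k \<in> ?J \<Longrightarrow> s \<in> {0..\<tau> k} \<Longrightarrow> t' \<in> {0..t} \<Longrightarrow> \<bar>w k (s, t') - w' k (s, t')\<bar> \<le> M"
      for w w' j s t M
    proof -
      obtain i m where j: "j = (i, m)" "i \<in> I" using j' by auto
      define x where "x = \<xi> (i, m) s"
      have x: "x \<in> {0..l i}" using \<xi>_in(1)[OF j(2)] s by (simp add: x_def j)
      have M0: "M \<ge> 0" using M[OF j' s, of t] t by auto
      have W: "norm (Wv w i (x, t') - Wv w' i (x, t')) \<le> n * M" if "t' \<in> {0..t}" for t'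
        using that by (intro Wv_le j x M) (use j in auto)
      have W1: "norm (Wv w' i (x, t)) \<le> n * 1"
        using t by (intro Wv_le0 j x adm_le[OF w(2)])
      have R: "norm (Rv w i (x, t)) \<le> 1 + T * (n * 1)"
        using \<delta>1(1) Rv_le[OF j(2) x t admW[OF w(1) j(2)], of 1] t adm_le[OF w(1) j(2)] by force
      have "Rv w i (x, t) - Rv w' i (x, t) = integral {0..t} (\<lambda>t'. Wv w i (x, t') - Wv w' i (x, t'))"
        using t x by (subst integral_diff)
          (auto simp: Rv_def intro!: integrable_continuous_real slice[OF admW[OF w(1) j(2)]] slice[OF admW[OF w(2) j(2)]])
      also have "norm \<dots> \<le> T * (n * M)"
        using W M0 n by (intro int_le[where g = "\<lambda>p. Wv w i p - Wv w' i p" and i = i] x t continuous_on_diff admW w j) auto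
      finally have Rd: "norm (Rv w i (x, t) - Rv w' i (x, t)) \<le> T * (n * M)" .
      have "\<bar>F w j (s, t) - F w' j (s, t)\<bar> \<le> b * norm (Wv w i (x, t) - Wv w' i (x, t))
        + 2 * \<nu> * (norm (Rv w i (x, t)) * norm (Wv w i (x, t) - Wv w' i (x, t)) + norm (Rv w i (x, t) - Rv w' i (x, t)) * norm (Wv w' i (x, t)))"
        unfolding F_def j fst_conv snd_conv x_def[symmetric] by (rule Df_diff[OF j(2) x])
      also have "\<dots> \<le> b * (n * M) + 2 * \<nu> * ((1 + T * (n * 1)) * (n * M) + (T * (n * M)) * (n * 1))"
        using W[of t] W1 R Rd t b N(4) T n M0 by (intro add_mono mult_left_mono mult_mono) auto
      also have "\<dots> = L * M" by (simp add: L_def algebra_simps)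
      finally show ?thesis .
    qed
    have F_bd: "\<bar>F w j (s, t)\<bar> \<le> L * M"
      if w: "?adm w" and j': "j \<in> ?J" and s: "s \<in> {0..\<tau> j}" and t: "t \<in> {0..T}"
        and M: "\<And>k s t'. k \<in> ?J \<Longrightarrow> s \<in> {0..\<tau> k} \<Longrightarrow> t' \<in> {0..t} \<Longrightarrow> \<bar>w k (s, t')\<bar> \<le> M"
      for w j s t M
    proof -
      obtain i m where j: "j = (i, m)" "i \<in> I" using j' by auto
      have M0: "M \<ge> 0" using M[OF j' s, of t] t by auto
      \<comment> \<open>\<open>Df\<close> vanishes for \<open>\<omega> = 0\<close> even though the
        profile is then \<open>r0\<close>, so the linear bound is the Lipschitz bound against
        zero.\<close>
      have "F (\<lambda>_ _. 0) j (s, t) = 0"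
      proof -
        have "\<xi> (i, m) s \<in> {0..l i}" using \<xi>_in(1)[OF j(2)] s by (simp add: j)
        then interpret N: bounded_bilinear "N i (\<xi> (i, m) s)" by (rule N(1)[OF j(2)])
        show ?thesis by (simp add: F_def j Df_def Wv0 N.zero_left N.zero_right)
      qed
      moreover have "?adm (\<lambda>_ _. 0)" by (simp add: admissible_def)
      ultimately show ?thesis using F_lip[OF w _ j' s t, of "\<lambda>_ _. 0" M] M by simp
    qed
    have "mild_problem ?J \<tau> T L \<kappa>0 F Bd' w0' \<delta>"
    proof (intro mild_problem.intro \<delta> F_cont F_lip F_bd)
      fix o' :: "'i \<times> 'm \<Rightarrow> real \<Rightarrow> real" and j assume "\<And>k. k \<in> ?J \<Longrightarrow> continuous_on {0..T} (o' k)" "j \<in> ?J"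
      then show "continuous_on {0..T} (\<lambda>t. Bd' j t (\<lambda>k. o' k t))"
        unfolding Bd'_def by (intro Bcont) auto
    next
      fix j t M and o1 o2 :: "'i \<times> 'm \<Rightarrow> real" assume "j \<in> ?J" "t \<in> {0..T}" "\<And>k. k \<in> ?J \<Longrightarrow> \<bar>o1 k - o2 k\<bar> \<le> M"
      then show "\<bar>Bd' j t o1 - Bd' j t o2\<bar> \<le> \<kappa>0 * M"
        unfolding Bd'_def by (intro Blip) auto
    next
      fix j t assume "j \<in> ?J" "t \<in> {0..T}"
      then show "\<bar>Bd' j t (\<lambda>_. 0)\<bar> \<le> \<delta>" unfolding Bd'_def by (intro Bbd) auto
    next
      fix j assume "j \<in> ?J"
      then obtain i m where j: "j = (i, m)" "i \<in> I" by auto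
      show "continuous_on {0..\<tau> j} (w0' j)"
        unfolding w0'_def[abs_def] j fst_conv snd_conv
        by (intro continuous_on_component continuous_on_compose2[OF w0[OF j(2)] \<xi>[OF j(2)]])
          (use \<xi>_in(1)[OF j(2)] in auto)
      have ex: "w0' (k, m') (\<tau> (k, m')) = w0 k (exit_pos (\<epsilon> m') (l k)) $ m'" if "k \<in> I" for k m'
      proof -
        have "exit_pos (\<epsilon> m') (l k) \<in> {0..l k}" using l[OF that] by (simp add: exit_pos_def)
        from \<sigma>_in(2)[OF that this, of m'] show ?thesis
          using \<sigma>_ends(2)[OF that, of m'] by (simp add: w0'_def)
      qed
      have en: "w0' (i, m) 0 = w0 i (entrance (\<epsilon> m) (l i)) $ m"
      proof -
        have "entrance (\<epsilon> m) (l i) \<in> {0..l i}" using l[OF j(2)] by (simp add: entrance_def)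
        from \<sigma>_in(2)[OF j(2) this, of m] show ?thesis
          using \<sigma>_ends(1)[OF j(2), of m] by (simp add: w0'_def)
      qed
      have "\<bar>Bd i m 0 (\<lambda>k m'. w0' (k, m') (\<tau> (k, m'))) - Bd i m 0 (\<lambda>k m'. w0 k (exit_pos (\<epsilon> m') (l k)) $ m')\<bar> \<le> \<kappa>0 * 0"
        using T by (intro Blip j) (auto simp: ex)
      then show "Bd' j 0 (\<lambda>k. w0' k (\<tau> k)) = w0' j 0"
        using compat[OF j(2), of m] by (simp add: Bd'_def j en)
    next
      fix j s assume "j \<in> ?J" "s \<in> {0..\<tau> j}"
      then obtain i m where j: "j = (i, m)" "i \<in> I" "s \<in> {0..\<tau> (i, m)}" by auto
      show "\<bar>w0' j s\<bar> \<le> \<delta>"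
        unfolding w0'_def j fst_conv snd_conv
        by (rule order_trans[OF component_le_norm_cart w0_le[OF j(2) \<xi>_in(1)[OF j(2,3)]]])
    qed
    from mild[OF this \<delta>1(2)] obtain w where W: "\<forall>j\<in>?J. continuous_on ({0..\<tau> j} \<times> {0..T}) (w j)
          \<and> (\<forall>p\<in>{0..\<tau> j} \<times> {0..T}. \<bar>w j p\<bar> \<le> C0 * \<delta>
               \<and> w j p = mild_form (\<lambda>t. Bd' j t (\<lambda>k. w k (\<tau> k, t))) (w0' j) (F w j) p)
          \<and> (\<forall>s\<in>{0..\<tau> j}. w j (s, 0) = w0' j s)" by blast
    have Wj: "(i, m) \<in> ?J" if "i \<in> I" for i m using that by simp
    have w_cont: "\<And>i m. i \<in> I \<Longrightarrow> continuous_on ({0..\<tau> (i, m)} \<times> {0..T}) (w (i, m))"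
      and w_le: "\<And>i m s t. i \<in> I \<Longrightarrow> s \<in> {0..\<tau> (i, m)} \<Longrightarrow> t \<in> {0..T} \<Longrightarrow> \<bar>w (i, m) (s, t)\<bar> \<le> C0 * \<delta>"
      and w_mild: "\<And>i m s t. i \<in> I \<Longrightarrow> s \<in> {0..\<tau> (i, m)} \<Longrightarrow> t \<in> {0..T} \<Longrightarrow> w (i, m) (s, t)
          = mild_form (\<lambda>t. Bd i m t (\<lambda>k m'. w (k, m') (\<tau> (k, m'), t))) (w0' (i, m)) (F w (i, m)) (s, t)"
      and w_0: "\<And>i m s. i \<in> I \<Longrightarrow> s \<in> {0..\<tau> (i, m)} \<Longrightarrow> w (i, m) (s, 0) = w0' (i, m) s"
      using bspec[OF W Wj] unfolding Bd'_def fst_conv snd_conv by (blast intro: SigmaI)+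
    have admw: "?adm w"
      unfolding admissible_def
    proof (intro ballI conjI)
      fix j p assume "j \<in> ?J" "p \<in> {0..\<tau> j} \<times> {0..T}"
      then show "\<bar>w j p\<bar> \<le> 1"
        using w_le[of "fst j" "fst p" "snd j" "snd p"] \<delta>1(2) by (cases j; cases p) auto
    qed (use w_cont in auto)
    \<comment> \<open>The equation solved for the space derivative. At this point it is only a
      candidate; \<open>der_x\<close> shows that \<open>Rv\<close> has it as its derivative.\<close>
    define \<rho> where "\<rho> i p = (\<chi> m. \<epsilon> m / c i m (fst p) * (f i (fst p) (Rv w i p) $ m - Wv w i p $ m))" for i p
    have RR: "Rv w i (x, 0) = r0 i x" for i x by (simp add: Rv_def)
    have der_t: "((\<lambda>t. Rv w i (x, t)) has_vector_derivative Wv w i (x, t)) (at t within {0..T})"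
      if "i \<in> I" "x \<in> {0..l i}" "t \<in> {0..T}" for i x t
    proof -
      have "((\<lambda>t. integral {0..t} (\<lambda>t'. Wv w i (x, t'))) has_vector_derivative Wv w i (x, t)) (at t within {0..T})"
        using slice[OF admW[OF admw that(1)] that(2) order_refl] that(3) by (rule integral_has_vector_derivative)
      then have "((\<lambda>t. r0 i x + integral {0..t} (\<lambda>t'. Wv w i (x, t'))) has_vector_derivative 0 + Wv w i (x, t)) (at t within {0..T})"
        by (intro has_vector_derivative_add has_vector_derivative_const)
      then show ?thesis by (simp add: Rv_def)
    qed
    have der_x: "((\<lambda>x. Rv w i (x, t)) has_vector_derivative \<rho> i (x, t)) (at x within {0..l i})"
      if i: "i \<in> I" and x: "x \<in> {0..l i}" and t: "t \<in> {0..T}" for i x t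
    proof (rule has_vector_derivative_vecI)
      fix m
      \<comment> \<open>Component \<open>m\<close> of the profile is its initial value plus
        \<open>V\<close> composed with the travel time, and \<open>V\<close> is differentiable in
        space although \<open>w\<close> is only continuous.\<close>
      define V where "V s = integral {0..t} (\<lambda>t'. w (i, m) (s, t'))" for s
      have Fc: "continuous_on ({0..\<tau> (i, m)} \<times> {0..T}) (F w (i, m))"
        using i by (intro F_cont[OF admw]) auto
      have V: "(V has_vector_derivative w (i, m) (s, 0) - w (i, m) (s, t) + integral {0..t} (\<lambda>t'. F w (i, m) (s, t')))
          (at s within {0..\<tau> (i, m)})" if s: "s \<in> {0..\<tau> (i, m)}" for s
        unfolding V_def
      proof (rule time_integral_has_space_derivative[OF _ w_cont[OF i] Fc _ s t])
        fix s t h :: real assume "0 \<le> h" "0 \<le> s" "0 \<le> t" "s + h \<le> \<tau> (i, m)" "t + h \<le> T"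
        then show "w (i, m) (s + h, t + h) = w (i, m) (s, t) + integral {0..h} (\<lambda>u. F w (i, m) (s + h - u, t + h - u))"
          using mild_form_shift[OF Fc, of h s t] by (simp add: w_mild i)
      qed (use T in simp)
      have \<sigma>x: "\<sigma> (i, m) x \<in> {0..\<tau> (i, m)}" by (rule \<sigma>_in(1)[OF i x])
      \<comment> \<open>At a fixed position \<open>F\<close> is the time derivative of
        \<open>f\<close> along the profile, so its integral is an increment of
        \<open>f\<close>.\<close>
      have "integral {0..t} (\<lambda>t'. F w (i, m) (\<sigma> (i, m) x, t')) = f i x (Rv w i (x, t)) $ m - f i x (r0 i x) $ m"
      proof -
        interpret N: bounded_bilinear "N i x" by (rule N(1)[OF i x])
        have "((\<lambda>t'. F w (i, m) (\<sigma> (i, m) x, t')) has_integral f i x (Rv w i (x, t)) $ m - f i x (Rv w i (x, 0)) $ m) {0..t}"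
        proof (rule fundamental_theorem_of_calculus)
          fix s assume s: "s \<in> {0..t}"
          have "((\<lambda>t. Rv w i (x, t)) has_vector_derivative Wv w i (x, s)) (at s within {0..t})"
            using der_t[OF i x, of s] s t by (intro has_vector_derivative_within_subset[OF der_t[OF i x]]) auto
          then have "((\<lambda>t. f i x (Rv w i (x, t))) has_vector_derivative Df i x (Rv w i (x, s)) (Wv w i (x, s))) (at s within {0..t})"
            unfolding f_def Df_def
            by (intro has_vector_derivative_add N.has_vector_derivative
                bounded_linear.has_vector_derivative[OF matrix_vector_mul_bounded_linear])
          from bounded_linear.has_vector_derivative[OF bounded_linear_vec_nth this, of m]
          show "((\<lambda>t. f i x (Rv w i (x, t)) $ m) has_vector_derivative F w (i, m) (\<sigma> (i, m) x, s)) (at s within {0..t})"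
            by (simp add: F_def \<sigma>_in(2)[OF i x])
        qed (use t in simp)
        then show ?thesis by (simp add: integral_unique RR)
      qed
      moreover have "w (i, m) (\<sigma> (i, m) x, 0) = w0 i x $ m"
        by (simp add: w_0[OF i \<sigma>x] w0'_def \<sigma>_in(2)[OF i x])
      \<comment> \<open>The equation at time 0 replaces \<open>w0\<close>: the values of
        \<open>f\<close> at the initial profile cancel, and the remaining \<open>r0'\<close> is
        compensated by the derivative of the summand \<open>r0\<close>.\<close>
      moreover have "w0 i x $ m = f i x (r0 i x) $ m - \<epsilon> m * c i m x * r0' i x $ m"
        using w0_eq[OF i x, of m] by (simp add: f_def)
      ultimately have X: "w (i, m) (\<sigma> (i, m) x, 0) - w (i, m) (\<sigma> (i, m) x, t) + integral {0..t} (\<lambda>t'. F w (i, m) (\<sigma> (i, m) x, t'))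
          = f i x (Rv w i (x, t)) $ m - Wv w i (x, t) $ m - \<epsilon> m * c i m x * r0' i x $ m"
        by (simp add: Wv_def)
      have "\<sigma> (i, m) ` {0..l i} \<subseteq> {0..\<tau> (i, m)}" using \<sigma>_in(1)[OF i] by auto
      then have "((V \<circ> \<sigma> (i, m)) has_vector_derivative (\<epsilon> m / c i m x) *\<^sub>R
          (f i x (Rv w i (x, t)) $ m - Wv w i (x, t) $ m - \<epsilon> m * c i m x * r0' i x $ m)) (at x within {0..l i})"
        using V[OF \<sigma>x, unfolded X] \<sigma>_der[OF i x, of m]
        by (intro vector_diff_chain_within)
          (auto simp: has_real_derivative_iff_has_vector_derivative intro: has_vector_derivative_within_subset)
      moreover have "((\<lambda>x. r0 i x $ m) has_vector_derivative r0' i x $ m) (at x within {0..l i})"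
        by (rule bounded_linear.has_vector_derivative[OF bounded_linear_vec_nth r0[OF i x]])
      ultimately have "((\<lambda>x. r0 i x $ m + (V \<circ> \<sigma> (i, m)) x) has_vector_derivative r0' i x $ m + (\<epsilon> m / c i m x) *\<^sub>R
          (f i x (Rv w i (x, t)) $ m - Wv w i (x, t) $ m - \<epsilon> m * c i m x * r0' i x $ m)) (at x within {0..l i})"
        by (intro has_vector_derivative_add)
      moreover have "r0' i x $ m + (\<epsilon> m / c i m x) *\<^sub>R
          (f i x (Rv w i (x, t)) $ m - Wv w i (x, t) $ m - \<epsilon> m * c i m x * r0' i x $ m) = \<rho> i (x, t) $ m"
      proof -
        have "\<epsilon> m * \<epsilon> m = 1" "c i m x \<noteq> 0" using \<epsilon>[of m] c(2)[OF i x, of m] by auto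
        then have "(\<epsilon> m / c i m x) * (\<epsilon> m * c i m x * r0' i x $ m) = r0' i x $ m" by (simp add: field_simps)
        then show ?thesis by (simp add: \<rho>_def right_diff_distrib)
      qed
      ultimately have dd: "((\<lambda>x. r0 i x $ m + (V \<circ> \<sigma> (i, m)) x) has_vector_derivative \<rho> i (x, t) $ m) (at x within {0..l i})"
        by simp
      have ee: "r0 i x' $ m + (V \<circ> \<sigma> (i, m)) x' = Rv w i (x', t) $ m" if x': "x' \<in> {0..l i}" for x'
      proof -
        have "(\<lambda>t'. Wv w i (x', t')) integrable_on {0..t}"
          using slice[OF admW[OF admw i] x', of t] t by (intro integrable_continuous_real) auto
        then have "integral {0..t} (\<lambda>t'. Wv w i (x', t')) $ m = integral {0..t} (\<lambda>t'. Wv w i (x', t') $ m)"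
          by (rule integral_component_eq_cart[symmetric])
        then show ?thesis by (simp add: Rv_def V_def Wv_def)
      qed
      show "((\<lambda>x. Rv w i (x, t) $ m) has_vector_derivative \<rho> i (x, t) $ m) (at x within {0..l i})"
        by (rule has_vector_derivative_transform_within[OF dd zero_less_one x ee])
    qed
    have bounds: "norm (Rv w i (x, t)) \<le> C1 * \<delta>" "norm (Wv w i (x, t)) \<le> C1 * \<delta>"
      if "i \<in> I" "x \<in> {0..l i}" "t \<in> {0..T}" for i x t
    proof -
      have "norm (Rv w i (x, t)) \<le> \<delta> + T * (n * (C0 * \<delta>))"
        using that C0 \<delta> by (intro Rv_le admW[OF admw] w_le) auto
      also have "\<dots> \<le> C1 * \<delta>" using C0 n \<delta> by (simp add: C1_def algebra_simps)
      finally show "norm (Rv w i (x, t)) \<le> C1 * \<delta>" .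
      have "norm (Wv w i (x, t)) \<le> n * (C0 * \<delta>)" using that by (intro Wv_le0 w_le)
      also have "\<dots> \<le> C1 * \<delta>" using C0 n \<delta> T by (simp add: C1_def algebra_simps)
      finally show "norm (Wv w i (x, t)) \<le> C1 * \<delta>" .
    qed
    have f_le: "norm (f i x (Rv w i (x, t))) \<le> (b + \<nu>) * (C1 * \<delta>)"
      if that: "i \<in> I" "x \<in> {0..l i}" "t \<in> {0..T}" for i x t
    proof -
      have R: "norm (Rv w i (x, t)) \<le> C1 * \<delta>" "norm (Rv w i (x, t)) \<le> 1"
        using bounds[OF that] \<delta>1(3) C\<delta> by auto
      have "norm (f i x (Rv w i (x, t))) \<le> norm (B i x) * norm (Rv w i (x, t)) + \<nu> * norm (Rv w i (x, t)) * norm (Rv w i (x, t))"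
        unfolding f_def by (intro order_trans[OF norm_triangle_ineq] add_mono norm_matrix_vector_le N(3) that)
      also have "\<dots> \<le> b * norm (Rv w i (x, t)) + \<nu> * norm (Rv w i (x, t)) * 1"
        using b(2)[OF that(1,2)] R N(4) by (intro add_mono mult_right_mono mult_left_mono) auto
      also have "\<dots> = (b + \<nu>) * norm (Rv w i (x, t))" by (simp add: algebra_simps)
      also have "\<dots> \<le> (b + \<nu>) * (C1 * \<delta>)" using R b N(4) by (intro mult_left_mono) auto
      finally show ?thesis .
    qed
    have \<rho>_le: "norm (\<rho> i (x, t)) \<le> C * \<delta>" if that: "i \<in> I" "x \<in> {0..l i}" "t \<in> {0..T}" for i x t
    proof -
      have "\<bar>\<rho> i (x, t) $ m\<bar> \<le> ci * ((b + \<nu>) * (C1 * \<delta>) + C1 * \<delta>)" for m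
      proof -
        have "\<bar>\<rho> i (x, t) $ m\<bar> = \<bar>1 / c i m x\<bar> * \<bar>f i x (Rv w i (x, t)) $ m - Wv w i (x, t) $ m\<bar>"
          using \<epsilon>[of m] by (auto simp: \<rho>_def abs_mult)
        also have "\<dots> \<le> ci * (\<bar>f i x (Rv w i (x, t)) $ m\<bar> + \<bar>Wv w i (x, t) $ m\<bar>)"
          using ci that by (intro mult_mono) auto
        also have "\<dots> \<le> ci * ((b + \<nu>) * (C1 * \<delta>) + C1 * \<delta>)"
          using ci(1) by (intro mult_left_mono add_mono order_trans[OF component_le_norm_cart] f_le bounds that) auto
        finally show ?thesis .
      qed
      then have "norm (\<rho> i (x, t)) \<le> n * (ci * ((b + \<nu>) * (C1 * \<delta>) + C1 * \<delta>))"
        unfolding n_def by (rule norm_vec_le_card)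
      also have "\<dots> = (n * (ci * ((b + \<nu>) * C1 + C1))) * \<delta>" by (simp add: algebra_simps)
      also have "\<dots> \<le> C * \<delta>" using C(4) \<delta> by (rule mult_right_mono)
      finally show ?thesis .
    qed
    have pde: "Wv w i (x, t) $ m + \<epsilon> m * c i m x * \<rho> i (x, t) $ m
        = (B i x *v Rv w i (x, t) + N i x (Rv w i (x, t)) (Rv w i (x, t))) $ m"
      if that: "i \<in> I" "x \<in> {0..l i}" "t \<in> {0..T}" for i x t m
    proof -
      have "\<epsilon> m * c i m x * (\<epsilon> m / c i m x) = 1"
        using \<epsilon>[of m] c(2)[OF that(1,2), of m] by auto
      then have "\<epsilon> m * c i m x * \<rho> i (x, t) $ m = f i x (Rv w i (x, t)) $ m - Wv w i (x, t) $ m"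
        unfolding \<rho>_def vec_lambda_beta fst_conv by (simp only: mult.assoc[symmetric] mult_1_left)
      then show ?thesis by (simp add: f_def)
    qed
    have \<rho>_cont: "continuous_on ({0..l i} \<times> {0..T}) (\<rho> i)" if i: "i \<in> I" for i
      unfolding \<rho>_def[abs_def]
    proof (intro continuous_on_vec_lambda continuous_on_mult continuous_on_divide continuous_on_diff continuous_on_component continuous_on_const)
      have fst: "continuous_on ({0..l i} \<times> {0..T}) (fst :: real \<times> real \<Rightarrow> real)"
        "(fst :: real \<times> real \<Rightarrow> real) ` ({0..l i} \<times> {0..T}) \<subseteq> {0..l i}" by (auto intro!: continuous_intros)
      show "continuous_on ({0..l i} \<times> {0..T}) (\<lambda>p. c i m (fst p))" for m
        by (rule continuous_on_compose2[OF c(1)[OF i] fst])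
      show "\<forall>p\<in>{0..l i} \<times> {0..T}. c i m (fst p) \<noteq> 0" for m
        using c(2)[OF i, of _ m] by (auto simp: order_less_le)
      note Rc = Rv_cont[OF i admW[OF admw i]]
      show "continuous_on ({0..l i} \<times> {0..T}) (\<lambda>p. f i (fst p) (Rv w i p))"
        unfolding f_def
        by (intro continuous_on_add N_cont[OF i fst] continuous_on_matrix_vector_mult
            continuous_on_compose2[OF B[OF i] fst] Rc)
      show "continuous_on ({0..l i} \<times> {0..T}) (Wv w i)" by (rule admW[OF admw i])
    qed
    have bc: "Wv w i (entrance (\<epsilon> m) (l i), t) $ m = Bd i m t (\<lambda>k m'. Wv w k (exit_pos (\<epsilon> m') (l k), t) $ m')"
      if i: "i \<in> I" and t: "t \<in> {0..T}" for i m t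
    proof -
      have "Wv w i (entrance (\<epsilon> m) (l i), t) $ m = w (i, m) (0, t)"
        by (simp add: Wv_def \<sigma>_ends[OF i])
      also have "\<dots> = Bd i m t (\<lambda>k m'. w (k, m') (\<tau> (k, m'), t))"
        using w_mild[OF i, of 0 m t] \<tau>[OF i, of m] t by (simp add: mild_form_def)
      also have "\<dots> = Bd i m t (\<lambda>k m'. Wv w k (exit_pos (\<epsilon> m') (l k), t) $ m')"
      proof -
        have "\<bar>Bd i m t (\<lambda>k m'. w (k, m') (\<tau> (k, m'), t)) - Bd i m t (\<lambda>k m'. Wv w k (exit_pos (\<epsilon> m') (l k), t) $ m')\<bar> \<le> \<kappa>0 * 0"
          using t by (intro Blip i) (auto simp: Wv_def \<sigma>_ends)
        then show ?thesis by simp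
      qed
      finally show ?thesis .
    qed
    have le: "C1 * \<delta> \<le> C * \<delta>" by (rule \<delta>1(3))
    have "transport_solution I l c \<epsilon> B N T Bd r0 (C * \<delta>) (Rv w) (Wv w) \<rho>"
    proof (intro transport_solution.intro Rv_cont admW[OF admw] \<rho>_cont der_t der_x pde \<rho>_le bc RR)
      show "norm (Rv w i (x, t)) \<le> C * \<delta>" "norm (Wv w i (x, t)) \<le> C * \<delta>"
        if "i \<in> I" "x \<in> {0..l i}" "t \<in> {0..T}" for i x t
        by (rule order_trans[OF bounds(1)[OF that] le], rule order_trans[OF bounds(2)[OF that] le])
    qed
    then show "\<exists>r w \<rho>. transport_solution I l c \<epsilon> B N T Bd r0 (C * \<delta>) r w \<rho>" by blast
  qed
qed

section \<open>Riemann invariants and scattering at the nodes\<close>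

lemma SPD_inverse:
  fixes A B :: "real^'n^'n"
  assumes A: "A \<in> SPD" and AB: "A ** B = mat 1"
  shows "B \<in> SPD"
proof -
  have AB': "A *v (B *v v) = v" for v by (simp add: matrix_vector_mul_assoc AB)
  have "(B *v u) \<bullet> v = u \<bullet> (B *v v)" for u v
    using SPD_D(4)[OF A, of "B *v u" "B *v v"] by (simp add: AB' inner_commute)
  then have "transpose B = B" by (rule symmetric_matrixI)
  moreover have "v \<bullet> (B *v v) > 0" if "v \<noteq> 0" for v
  proof -
    have "B *v v \<noteq> 0" using AB'[of v] that by (metis matrix_vector_mult_0_right)
    from SPD_D(2)[OF A this] show ?thesis by (simp add: AB' inner_commute)
  qed
  ultimately show ?thesis by (simp add: SPD_def)
qed

text \<open>The left inverse \<open>H\<close> makes \<open>G\<close> injective, so the form is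
  evaluated at nonzero vectors only.\<close>

lemma SPD_congruence:
  fixes A G H :: "real^'n^'n"
  assumes A: "A \<in> SPD" and HG: "H ** G = mat 1"
  shows "transpose G ** A ** G \<in> SPD"
proof -
  have eq: "u \<bullet> ((transpose G ** A ** G) *v v) = (G *v u) \<bullet> (A *v (G *v v))" for u v
    using inner_matrix_transpose[of u "transpose G" "A *v (G *v v)"]
    by (simp add: matrix_vector_mul_assoc[symmetric] del: transpose_matrix_vector)
  have "((transpose G ** A ** G) *v u) \<bullet> v = u \<bullet> ((transpose G ** A ** G) *v v)" for u v
    using eq[of u v] eq[of v u] SPD_D(4)[OF A, of "G *v u" "G *v v"] by (simp add: inner_commute)
  then have "transpose (transpose G ** A ** G) = transpose G ** A ** G" by (rule symmetric_matrixI)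
  moreover have "v \<bullet> ((transpose G ** A ** G) *v v) > 0" if "v \<noteq> 0" for v
  proof -
    have "H *v (G *v v) = v" by (simp add: matrix_vector_mul_assoc HG)
    then have "G *v v \<noteq> 0" using that by (metis matrix_vector_mult_0_right)
    from SPD_D(2)[OF A this] show ?thesis by (simp only: eq)
  qed
  ultimately show ?thesis by (simp add: SPD_def)
qed

lemma SPD_sum:
  fixes A :: "'a \<Rightarrow> real^'n^'n"
  assumes "finite I" "I \<noteq> {}" "\<And>i. i \<in> I \<Longrightarrow> A i \<in> SPD"
  shows "(\<Sum>i\<in>I. A i) \<in> SPD"
  using assms
proof (induction I rule: finite_ne_induct)
  case (insert i I)
  have add: "X + Y \<in> SPD" if "X \<in> SPD" "Y \<in> SPD" for X Y :: "real^'n^'n"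
  proof -
    have "transpose (X + Y) = transpose X + transpose Y" by (simp add: transpose_def vec_eq_iff)
    moreover have "v \<bullet> ((X + Y) *v v) > 0" if "v \<noteq> 0" for v
      using SPD_D(2)[OF \<open>X \<in> SPD\<close> that] SPD_D(2)[OF \<open>Y \<in> SPD\<close> that]
      by (simp add: matrix_vector_mult_add_rdistrib inner_add_right)
    ultimately show ?thesis using SPD_D(1)[OF that(1)] SPD_D(1)[OF that(2)] by (simp add: SPD_def)
  qed
  show ?case using insert by (simp add: add)
qed simp

section \<open>Calculus of C^1 matrix functions\<close>

lemma Ck1_iff: "Ck_on 1 S f \<longleftrightarrow>
    (\<exists>f'. (\<forall>x\<in>S. (f has_vector_derivative f' x) (at x within S)) \<and> continuous_on S f')"
  by (simp add: One_nat_def)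

lemma Ck1_bilinear:
  assumes "bounded_bilinear h" and f: "Ck_on 1 S f" and g: "Ck_on 1 S g"
  shows "Ck_on 1 S (\<lambda>x. h (f x) (g x))"
proof -
  interpret bounded_bilinear h by fact
  obtain f' g' where f': "\<And>x. x \<in> S \<Longrightarrow> (f has_vector_derivative f' x) (at x within S)" "continuous_on S f'"
    and g': "\<And>x. x \<in> S \<Longrightarrow> (g has_vector_derivative g' x) (at x within S)" "continuous_on S g'"
    using f g unfolding Ck1_iff by blast
  show ?thesis
    unfolding Ck1_iff
    by (intro exI[of _ "\<lambda>x. h (f x) (g' x) + h (f' x) (g x)"] conjI ballI has_vector_derivative f' g'
        continuous_intros continuous_on Ck_on_imp_continuous_on[OF f] Ck_on_imp_continuous_on[OF g])
qed

lemma Ck1_linear: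
  assumes h: "bounded_linear h" and f: "Ck_on 1 S f"
  shows "Ck_on 1 S (\<lambda>x. h (f x))"
proof -
  obtain f' where f': "\<And>x. x \<in> S \<Longrightarrow> (f has_vector_derivative f' x) (at x within S)" "continuous_on S f'"
    using f unfolding Ck1_iff by blast
  show ?thesis
    unfolding Ck1_iff
    by (intro exI[of _ "\<lambda>x. h (f' x)"] conjI ballI bounded_linear.has_vector_derivative[OF h]
        bounded_linear.continuous_on[OF h] f')
qed

lemmas Ck1_mult = Ck1_bilinear[OF bounded_bilinear_matrix_matrix_mult]

lemma bounded_linear_transpose: "bounded_linear (transpose :: real^'n^'m \<Rightarrow> real^'m^'n)"
  unfolding linear_conv_bounded_linear[symmetric] by (intro linearI) (simp_all add: transpose_def vec_eq_iff)

lemmas Ck1_transpose = Ck1_linear[OF bounded_linear_transpose]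

lemma Ck1_block:
  assumes "Ck_on 1 S A" "Ck_on 1 S B" "Ck_on 1 S C" "Ck_on 1 S D"
  shows "Ck_on 1 S (\<lambda>x. block (A x) (B x) (C x) (D x))"
proof -
  obtain A' B' C' D' where "\<And>x. x \<in> S \<Longrightarrow> (A has_vector_derivative A' x) (at x within S)" "continuous_on S A'"
    "\<And>x. x \<in> S \<Longrightarrow> (B has_vector_derivative B' x) (at x within S)" "continuous_on S B'"
    "\<And>x. x \<in> S \<Longrightarrow> (C has_vector_derivative C' x) (at x within S)" "continuous_on S C'"
    "\<And>x. x \<in> S \<Longrightarrow> (D has_vector_derivative D' x) (at x within S)" "continuous_on S D'"
    using assms unfolding Ck1_iff by blast
  then show ?thesis
    unfolding Ck1_iff
    by (intro exI[of _ "\<lambda>x. block (A' x) (B' x) (C' x) (D' x)"] conjI ballI has_vector_derivative_block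
        continuous_on_block)
qed

context regular_network
begin

text \<open>With \<open>S\<close> the square root of the flexibility, \<open>V = S U\<^sup>T\<close> and \<open>Z = S\<^sup>-\<^sup>1 U\<^sup>T D\<^sup>-\<^sup>1\<close>: the profiles
  \<open>V\<^sup>-\<^sup>1 v \<plusminus> Z\<^sup>-\<^sup>1 z\<close> are the Riemann invariants, moving with speeds \<open>\<minusplus>D\<close>.\<close>

lemma beam_diagonalisation:
  assumes i: "i \<in> beams net"
  obtains V Z Vi Zi D :: "real \<Rightarrow> mat6" where
    "Ck_on 1 {0..len net i} V" "Ck_on 1 {0..len net i} Z" "Ck_on 1 {0..len net i} Vi" "Ck_on 1 {0..len net i} Zi"
    "continuous_on {0..len net i} D"
    "\<And>x. x \<in> {0..len net i} \<Longrightarrow> V x ** Vi x = mat 1 \<and> Vi x ** V x = mat 1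
        \<and> Z x ** Zi x = mat 1 \<and> Zi x ** Z x = mat 1
        \<and> mass net i x ** V x ** D x = Z x \<and> flex net i x ** Z x ** D x = V x
        \<and> Z x ** Vi x \<in> SPD \<and> diagonal_matrix (D x) \<and> (\<forall>k. D x $ k $ k > 0)"
proof -
  define X where "X = {0..len net i}"
  obtain U D where
    U: "U \<in> Ck 2 X UNIV" and D: "D \<in> Ck 2 X UNIV"
    and UD: "\<forall>x\<in>X. Theta net i x = transpose (U x) ** (D x ** D x) ** U x
            \<and> D x \<in> SPD \<and> diagonal_matrix (D x)
            \<and> {D x $ k $ k |k. True} = sqrt ` eigenvalues (Theta net i x)
            \<and> orthogonal_matrix (U x)"
    and M2: "mass net i \<in> Ck 2 X SPD" and C2: "flex net i \<in> Ck 2 X SPD" and Th2: "Theta net i \<in> Ck 2 X SPD"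
    using assumption1 i unfolding assumption1_def X_def by blast
  have Ck1: "Ck_on 1 X f" if "f \<in> Ck 2 X B" for f :: "real \<Rightarrow> mat6" and B
    using that Ck_on_mono[of 1 X f] by (simp add: Ck_def numeral_2_eq_2 del: Ck_on.simps)
  define S where "S x = spd_sqrt (flex net i x)" for x
  have S: "S x \<in> SPD" "S x ** S x = flex net i x" if "x \<in> X" for x
    using spd_sqrt[of "flex net i x"] C2 that by (auto simp: S_def Ck_def)
  have S1: "Ck_on 1 X S"
  proof -
    have "Ck_on 1 X (flex net i)" using C2 by (rule Ck1)
    then obtain C' where C': "\<And>x. x \<in> X \<Longrightarrow> (flex net i has_vector_derivative C' x) (at x within X)" "continuous_on X C'"
      unfolding Ck1_iff by blast
    have "flex net i x \<in> SPD" if "x \<in> X" for x using C2 that by (auto simp: Ck_def)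
    then show ?thesis
      using spd_sqrt_C1[of X "flex net i" C'] C' unfolding Ck1_iff S_def by metis
  qed
  define M where "M = mass net i"
  define Th where "Th = Theta net i"
  define UT where "UT x = transpose (U x)" for x
  define W where "W x = S x ** M x ** S x" for x
  \<comment> \<open>As \<open>Th\<close> is the inverse of \<open>S M S\<close>, the product
    \<open>M S Th\<close> inverts \<open>S\<close>. Likewise \<open>U W UT\<close> is the inverse of
    \<open>D^2\<close>, so that \<open>Di\<close> inverts \<open>D\<close>. Written in this way the
    inverses are visibly C^1.\<close>
  define Si where "Si x = M x ** S x ** Th x" for x
  define Di where "Di x = D x ** (U x ** W x ** UT x)" for x
  have M1: "Ck_on 1 X M" and Th1: "Ck_on 1 X Th" and U1: "Ck_on 1 X U" and D1: "Ck_on 1 X D"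
    unfolding M_def Th_def by (rule Ck1[OF M2] Ck1[OF Th2] Ck1[OF U] Ck1[OF D])+
  have UT1: "Ck_on 1 X UT" unfolding UT_def[abs_def] by (rule Ck1_transpose[OF U1])
  have W1: "Ck_on 1 X W" and Si1: "Ck_on 1 X Si"
    unfolding W_def[abs_def] Si_def[abs_def] by (intro Ck1_mult S1 M1 Th1)+
  have Di1: "Ck_on 1 X Di" unfolding Di_def[abs_def] by (intro Ck1_mult U1 UT1 D1 W1)
  define V where "V x = S x ** UT x" for x
  define Z where "Z x = Si x ** UT x ** Di x" for x
  define Vi where "Vi x = U x ** Si x" for x
  define Zi where "Zi x = D x ** U x ** S x" for x
  show thesis
  proof (rule that[of V Z Vi Zi D, folded X_def])
    show "Ck_on 1 X V" "Ck_on 1 X Z" "Ck_on 1 X Vi" "Ck_on 1 X Zi"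
      unfolding V_def[abs_def] Z_def[abs_def] Vi_def[abs_def] Zi_def[abs_def]
      by (intro Ck1_mult S1 UT1 Si1 Di1 U1 D1)+
    show "continuous_on X D" by (rule Ck_on_imp_continuous_on[OF D1])
    fix x assume x: "x \<in> X"
    have Sx: "S x \<in> SPD" by (rule S(1)[OF x])
    have Mx: "M x \<in> SPD" using M2 x by (auto simp: Ck_def M_def)
    have Dx: "D x \<in> SPD" and dD: "diagonal_matrix (D x)" and oU: "orthogonal_matrix (U x)"
      and Thx: "Th x = UT x ** (D x ** D x) ** U x"
      using UD x by (auto simp: Th_def UT_def)
    have "matrix_inv (S x) ** S x = mat 1" by (rule SPD_invertible(1)[OF Sx])
    from SPD_congruence[OF Mx this] have Wx: "W x \<in> SPD" by (simp add: W_def SPD_D(1)[OF Sx])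
    have Th: "Th x = matrix_inv (W x)" by (simp add: Th_def Theta_def W_def S_def M_def)
    have v1: "W x *v (Th x *v v) = v" "Th x *v (W x *v v) = v" for v
      unfolding Th by (simp_all add: matrix_vector_mul_assoc SPD_invertible[OF Wx])
    have W: "W x *v v = S x *v (M x *v (S x *v v))" for v by (simp add: W_def matrix_vector_mul_assoc[symmetric])
    have U: "U x *v (UT x *v v) = v" "UT x *v (U x *v v) = v" for v
      using oU by (simp_all add: UT_def matrix_vector_mul_assoc orthogonal_matrix_def orthogonal_matrix del: transpose_matrix_vector)
    have Th': "Th x *v v = UT x *v (D x *v (D x *v (U x *v v)))" for v
      unfolding Thx by (simp add: matrix_vector_mul_assoc[symmetric])
    have Si: "Si x *v v = M x *v (S x *v (Th x *v v))" for v by (simp add: Si_def matrix_vector_mul_assoc[symmetric])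
    have Di: "Di x *v v = D x *v (U x *v (W x *v (UT x *v v)))" for v by (simp add: Di_def matrix_vector_mul_assoc[symmetric])
    have SSi: "S x *v (Si x *v v) = v" for v by (simp add: Si W[symmetric] v1)
    then have "S x ** Si x = mat 1" by (simp add: matrix_eq matrix_vector_mul_assoc)
    then have SiS0: "Si x ** S x = mat 1" by (simp add: matrix_left_right_inverse)
    then have SiS: "Si x *v (S x *v v) = v" for v by (simp add: matrix_vector_mul_assoc)
    have DDi: "D x *v (Di x *v v) = v" for v
    proof -
      have "D x *v (Di x *v v) = U x *v (UT x *v (D x *v (D x *v (U x *v (W x *v (UT x *v v))))))"
        by (simp add: Di U)
      also have "\<dots> = v" by (simp add: Th'[symmetric] v1 U)
      finally show ?thesis .
    qed
    then have DDi0: "D x ** Di x = mat 1" by (simp add: matrix_eq matrix_vector_mul_assoc)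
    then have "Di x ** D x = mat 1" by (simp add: matrix_left_right_inverse)
    then have DiD: "Di x *v (D x *v v) = v" for v by (simp add: matrix_vector_mul_assoc)
    have C: "flex net i x *v v = S x *v (S x *v v)" for v by (simp add: S(2)[OF x, symmetric] matrix_vector_mul_assoc)
    have 1: "V x ** Vi x = mat 1 \<and> Vi x ** V x = mat 1 \<and> Z x ** Zi x = mat 1 \<and> Zi x ** Z x = mat 1"
      by (simp add: matrix_eq V_def Vi_def Z_def Zi_def matrix_vector_mul_assoc[symmetric] U SSi SiS DDi DiD)
    have 2: "mass net i x ** V x ** D x = Z x"
      by (simp add: matrix_eq V_def Z_def matrix_vector_mul_assoc[symmetric] M_def[symmetric])
        (simp add: Si Th' U DDi)
    have 3: "flex net i x ** Z x ** D x = V x"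
      by (simp add: matrix_eq V_def Z_def matrix_vector_mul_assoc[symmetric] C SSi DiD)
    \<comment> \<open>Since \<open>Si\<close> is symmetric, the admittance \<open>Z Vi\<close>
      equals \<open>Si UT Di U Si\<close>, the congruence of \<open>Di\<close> by
      \<open>U Si\<close>.\<close>
    have "Di x \<in> SPD" by (rule SPD_inverse[OF Dx DDi0])
    moreover have "(S x ** UT x) ** (U x ** Si x) = mat 1"
      by (simp add: matrix_eq matrix_vector_mul_assoc[symmetric] U SSi)
    ultimately have "transpose (U x ** Si x) ** Di x ** (U x ** Si x) \<in> SPD" by (rule SPD_congruence)
    moreover have "transpose (Si x) = Si x"
      using SPD_inverse[OF Sx] \<open>S x ** Si x = mat 1\<close> SPD_D(1) by blast
    ultimately have 4: "Z x ** Vi x \<in> SPD"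
      by (simp add: Z_def Vi_def matrix_transpose_mul UT_def)
    have 5: "D x $ k $ k > 0" for k
    proof -
      have "axis k 1 \<bullet> (D x *v axis k 1) > 0" by (intro SPD_D(2)[OF Dx]) (simp add: axis_eq_0_iff)
      then show ?thesis by (simp add: inner_axis' matrix_vector_mult_basis column_def)
    qed
    show "V x ** Vi x = mat 1 \<and> Vi x ** V x = mat 1
        \<and> Z x ** Zi x = mat 1 \<and> Zi x ** Z x = mat 1
        \<and> mass net i x ** V x ** D x = Z x \<and> flex net i x ** Z x ** D x = V x
        \<and> Z x ** Vi x \<in> SPD \<and> diagonal_matrix (D x) \<and> (\<forall>k. D x $ k $ k > 0)"
      using 1 2 3 4 5 dD by blast
  qed
qed

end

text \<open>The velocity shared by the beams at a joint solves a system whose matrix is the sum of the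
  (symmetric positive definite) admittances \<open>Z V\<^sup>-\<^sup>1\<close> of the beams.\<close>

lemma joint_scattering:
  fixes V Vi Z R RT :: "'i \<Rightarrow> real^'n^'n" and p q' :: "'i \<Rightarrow> real^'n" and q :: "real^'n"
  assumes I: "finite I" "I \<noteq> {}"
    and inv: "\<And>i v. i \<in> I \<Longrightarrow> V i *v (Vi i *v v) = v" "\<And>i v. i \<in> I \<Longrightarrow> Vi i *v (V i *v v) = v"
    and R: "\<And>i v. i \<in> I \<Longrightarrow> R i *v (RT i *v v) = v" "\<And>i v. i \<in> I \<Longrightarrow> RT i *v (R i *v v) = v"
    and RT: "\<And>i. i \<in> I \<Longrightarrow> RT i = transpose (R i)"
    and Y: "\<And>i. i \<in> I \<Longrightarrow> Z i ** Vi i \<in> SPD"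
    and K: "K = (\<Sum>i\<in>I. R i ** (Z i ** Vi i) ** RT i)"
  shows "(\<forall>i\<in>I. p i = 2 *\<^sub>R (Vi i *v (RT i *v (matrix_inv K *v (q + (\<Sum>k\<in>I. R k *v (Z k *v o' k)))))) - o' i)
    \<longleftrightarrow> (\<forall>i\<in>I. \<forall>j\<in>I. R i *v ((1/2) *\<^sub>R (V i *v (p i + o' i))) = R j *v ((1/2) *\<^sub>R (V j *v (p j + o' j))))
      \<and> (\<Sum>i\<in>I. R i *v ((1/2) *\<^sub>R (Z i *v (p i - o' i)))) = q" (is "?L \<longleftrightarrow> ?N")
proof -
  have "K \<in> SPD"
    unfolding K
  proof (rule SPD_sum[OF I])
    fix i assume i: "i \<in> I"
    have "R i ** RT i = mat 1" using R(1)[OF i] by (simp add: matrix_eq matrix_vector_mul_assoc[symmetric])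
    from SPD_congruence[OF Y[OF i] this] show "R i ** (Z i ** Vi i) ** RT i \<in> SPD"
      by (simp add: RT[OF i])
  qed
  then have Kinv: "matrix_inv K *v (K *v v) = v" "K *v (matrix_inv K *v v) = v" for v
    by (simp_all add: matrix_vector_mul_assoc SPD_invertible)
  define s where "s = q + (\<Sum>k\<in>I. R k *v (Z k *v o' k))"
  have Kv: "K *v v = (\<Sum>i\<in>I. R i *v (Z i *v (Vi i *v (RT i *v v))))" for v
    unfolding K bounded_bilinear.sum_left[OF bounded_bilinear_matrix_vector_mult]
    by (simp add: matrix_vector_mul_assoc[symmetric])
  have half: "(1/2) *\<^sub>R (Z i *v (p i - o' i)) = Z i *v (Vi i *v (RT i *v v)) - Z i *v o' i"
    if "i \<in> I" "p i = 2 *\<^sub>R (Vi i *v (RT i *v v)) - o' i" for i v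
  proof -
    have "p i - o' i = 2 *\<^sub>R (Vi i *v (RT i *v v) - o' i)" using that(2) by (simp add: scaleR_2)
    then show ?thesis by (simp add: matrix_vector_mult_scaleR matrix_vector_mult_diff_distrib)
  qed
  \<comment> \<open>For entering waves of this form the flux balance becomes \<open>K v = s\<close>,
    a single equation for the common velocity.\<close>
  have flux: "(\<Sum>i\<in>I. R i *v ((1/2) *\<^sub>R (Z i *v (p i - o' i)))) = K *v v - (\<Sum>k\<in>I. R k *v (Z k *v o' k))"
    if "\<And>i. i \<in> I \<Longrightarrow> p i = 2 *\<^sub>R (Vi i *v (RT i *v v)) - o' i" for v
  proof -
    have "(\<Sum>i\<in>I. R i *v ((1/2) *\<^sub>R (Z i *v (p i - o' i))))
        = (\<Sum>i\<in>I. R i *v (Z i *v (Vi i *v (RT i *v v))) - R i *v (Z i *v o' i))"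
      using half that by (intro sum.cong) (auto simp: matrix_vector_mult_diff_distrib)
    then show ?thesis by (simp add: Kv sum_subtractf)
  qed
  \<comment> \<open>Once the joint velocity \<open>v\<close> is known, each entering wave is the
    reflection of the leaving one about the trace of \<open>v\<close> in that beam.\<close>
  have vel: "R i *v ((1/2) *\<^sub>R (V i *v (p i + o' i))) = v \<longleftrightarrow> p i = 2 *\<^sub>R (Vi i *v (RT i *v v)) - o' i"
    if i: "i \<in> I" for i v
  proof
    assume *: "R i *v ((1/2) *\<^sub>R (V i *v (p i + o' i))) = v"
    have "2 *\<^sub>R (Vi i *v (RT i *v v)) = p i + o' i"
      unfolding *[symmetric] R(2)[OF i] by (simp add: matrix_vector_mult_scaleR inv[OF i])
    then show "p i = 2 *\<^sub>R (Vi i *v (RT i *v v)) - o' i" by (simp add: algebra_simps)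
  next
    assume *: "p i = 2 *\<^sub>R (Vi i *v (RT i *v v)) - o' i"
    show "R i *v ((1/2) *\<^sub>R (V i *v (p i + o' i))) = v"
      unfolding * by (simp add: matrix_vector_mult_scaleR inv[OF i] R[OF i])
  qed
  show ?thesis
    unfolding s_def[symmetric]
  proof
    assume L: "\<forall>i\<in>I. p i = 2 *\<^sub>R (Vi i *v (RT i *v (matrix_inv K *v s))) - o' i"
    then have "R i *v ((1/2) *\<^sub>R (V i *v (p i + o' i))) = matrix_inv K *v s" if "i \<in> I" for i
      using vel[OF that] that by blast
    moreover have "(\<Sum>i\<in>I. R i *v ((1/2) *\<^sub>R (Z i *v (p i - o' i)))) = q"
      using flux[of "matrix_inv K *v s"] L by (simp add: Kinv s_def)
    ultimately show ?N by metis
  next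
    assume N: ?N
    obtain i0 where i0: "i0 \<in> I" using I by blast
    define v where "v = R i0 *v ((1/2) *\<^sub>R (V i0 *v (p i0 + o' i0)))"
    have "R i *v ((1/2) *\<^sub>R (V i *v (p i + o' i))) = v" if "i \<in> I" for i
      using N i0 that unfolding v_def by blast
    then have p: "p i = 2 *\<^sub>R (Vi i *v (RT i *v v)) - o' i" if "i \<in> I" for i
      using vel[OF that] that by blast
    have "K *v v = s" using flux[OF p] N by (simp add: s_def algebra_simps)
    then have "matrix_inv K *v s = v" using Kinv(1)[of v] by simp
    then show "\<forall>i\<in>I. p i = 2 *\<^sub>R (Vi i *v (RT i *v (matrix_inv K *v s))) - o' i" using p by simp
  qed
qed

lemma double_eq_iff:
  fixes p a b :: "'a::real_vector"
  shows "p = 2 *\<^sub>R a + b \<longleftrightarrow> (1/2) *\<^sub>R (p - b) = a" and "p = 2 *\<^sub>R a - b \<longleftrightarrow> (1/2) *\<^sub>R (p + b) = a"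
  by auto

context regular_network
begin

section \<open>Scattering at all nodes of a network\<close>

lemma node_pos_in:
  assumes "i \<in> incident net n"
  shows "i \<in> beams net" "node_pos net n i \<in> {0..len net i}"
  using assms len_pos[of i] by (auto simp: incident_def node_pos_def)

lemma special_nodes:
  "n \<in> multiple_nodes net \<Longrightarrow> n \<in> nodes net" "n \<in> neumann_nodes net \<Longrightarrow> n \<in> nodes net"
  "n \<in> dirichlet_nodes net \<Longrightarrow> n \<in> nodes net"
  "n \<in> neumann_nodes net \<Longrightarrow> n \<notin> multiple_nodes net \<and> n \<notin> dirichlet_nodes net"
  "n \<in> dirichlet_nodes net \<Longrightarrow> n \<notin> multiple_nodes net \<and> n \<notin> neumann_nodes net"
  "n \<in> neumann_nodes net \<Longrightarrow> incident net n = {first_beam net n}"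
  "n \<in> dirichlet_nodes net \<Longrightarrow> incident net n = {first_beam net n}"
proof -
  have s: "simple_nodes net = dirichlet_nodes net \<union> neumann_nodes net" "dirichlet_nodes net \<inter> neumann_nodes net = {}"
    using wf by (auto simp: wf_network_def)
  have sub: "simple_nodes net \<subseteq> nodes net" "multiple_nodes net \<subseteq> nodes net" "simple_nodes net \<inter> multiple_nodes net = {}"
    by (auto simp: multiple_nodes_def simple_nodes_def)
  show "n \<in> multiple_nodes net \<Longrightarrow> n \<in> nodes net" "n \<in> neumann_nodes net \<Longrightarrow> n \<in> nodes net"
    "n \<in> dirichlet_nodes net \<Longrightarrow> n \<in> nodes net"
    "n \<in> neumann_nodes net \<Longrightarrow> n \<notin> multiple_nodes net \<and> n \<notin> dirichlet_nodes net"
    "n \<in> dirichlet_nodes net \<Longrightarrow> n \<notin> multiple_nodes net \<and> n \<notin> neumann_nodes net"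
    using s sub by blast+
  show "n \<in> neumann_nodes net \<Longrightarrow> incident net n = {first_beam net n}"
    "n \<in> dirichlet_nodes net \<Longrightarrow> incident net n = {first_beam net n}"
    using s(1) by (auto intro!: incident_simple)
qed

text \<open>\<open>p\<close> collects the waves entering the beams at a node, \<open>o'\<close>
  those leaving them. Multiplying the stress by the node sign gives both ends of a beam the same
  relation, so that all nodal conditions take one affine form, expressing entering waves by leaving
  waves and nodal data.\<close>

lemma nodal_identities_scattering:
  fixes V Z Vi Zi :: "nat \<Rightarrow> real \<Rightarrow> mat6"
  assumes inv: "\<And>i x. i \<in> beams net \<Longrightarrow> x \<in> {0..len net i} \<Longrightarrow>
      V i x ** Vi i x = mat 1 \<and> Vi i x ** V i x = mat 1 \<and> Z i x ** Zi i x = mat 1 \<and> Zi i x ** Z i x = mat 1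
      \<and> Z i x ** Vi i x \<in> SPD"
  obtains A :: "nat \<Rightarrow> nat \<Rightarrow> nat \<Rightarrow> mat6" and Qm :: "nat \<Rightarrow> nat \<Rightarrow> mat6" where
    "\<And>w r p o'. (\<And>n i. n \<in> nodes net \<Longrightarrow> i \<in> incident net n \<Longrightarrow>
        upper (w i (node_pos net n i)) = (1/2) *\<^sub>R (V i (node_pos net n i) *v (p n i + o' n i))
        \<and> node_sign net n i *\<^sub>R lower (w i (node_pos net n i)) = (1/2) *\<^sub>R (Z i (node_pos net n i) *v (p n i - o' n i)))
      \<Longrightarrow> nodal_identities net w r \<longleftrightarrow> (\<forall>n\<in>nodes net. \<forall>i\<in>incident net n.
            p n i = Qm n i *v r n + (\<Sum>k\<in>incident net n. A n i k *v o' n k))"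
proof -
  define K where "K n = (\<Sum>i\<in>incident net n. Rbar net i (node_pos net n i) **
    (Z i (node_pos net n i) ** Vi i (node_pos net n i)) ** transpose (Rbar net i (node_pos net n i)))" for n
  define H where "H n i = Vi i (node_pos net n i) ** (transpose (Rbar net i (node_pos net n i)) ** matrix_inv (K n))" for n i
  \<comment> \<open>At a joint this is the formula of \<open>joint_scattering\<close>. At a Neumann
    node the stress fixes \<open>p - o'\<close>, at a Dirichlet node the velocity fixes
    \<open>p + o'\<close>; hence the reflection coefficients 1 and -1 in \<open>A\<close>.\<close>
  define Qm where "Qm n i = (if n \<in> multiple_nodes net then 2 *\<^sub>R H n i
    else if n \<in> neumann_nodes net then 2 *\<^sub>R Zi i (node_pos net n i) else 2 *\<^sub>R Vi i (node_pos net n i))" for n i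
  define A where "A n i k = (if n \<in> multiple_nodes net
      then 2 *\<^sub>R (H n i ** (Rbar net k (node_pos net n k) ** Z k (node_pos net n k))) - (if k = i then mat 1 else 0)
    else if n \<in> neumann_nodes net then mat 1 else - mat 1 :: mat6)" for n i k
  show thesis
  proof (rule that[of Qm A])
    fix w :: "nat \<Rightarrow> real \<Rightarrow> vec12" and r :: "nat \<Rightarrow> vec6" and p o' :: "nat \<Rightarrow> nat \<Rightarrow> vec6"
    assume po: "\<And>n i. n \<in> nodes net \<Longrightarrow> i \<in> incident net n \<Longrightarrow>
        upper (w i (node_pos net n i)) = (1/2) *\<^sub>R (V i (node_pos net n i) *v (p n i + o' n i))
        \<and> node_sign net n i *\<^sub>R lower (w i (node_pos net n i)) = (1/2) *\<^sub>R (Z i (node_pos net n i) *v (p n i - o' n i))"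
    let ?S = "\<lambda>n. \<forall>i\<in>incident net n. p n i = Qm n i *v r n + (\<Sum>k\<in>incident net n. A n i k *v o' n k)"
    have mult: "?S n \<longleftrightarrow> (\<forall>i\<in>incident net n. \<forall>j\<in>incident net n.
        Rbar net i (node_pos net n i) *v upper (w i (node_pos net n i))
        = Rbar net j (node_pos net n j) *v upper (w j (node_pos net n j)))
      \<and> (\<Sum>i\<in>incident net n. node_sign net n i *\<^sub>R
        (Rbar net i (node_pos net n i) *v lower (w i (node_pos net n i)))) = r n"
      if n: "n \<in> multiple_nodes net" for n
    proof -
      have nn: "n \<in> nodes net" by (rule special_nodes(1)[OF n])
      have ne: "incident net n \<noteq> {}" using first_beam_incident[OF n] by blast
      have S: "Qm n i *v r n + (\<Sum>k\<in>incident net n. A n i k *v o' n k)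
          = 2 *\<^sub>R (Vi i (node_pos net n i) *v (transpose (Rbar net i (node_pos net n i)) *v (matrix_inv (K n) *v
            (r n + (\<Sum>k\<in>incident net n. Rbar net k (node_pos net n k) *v (Z k (node_pos net n k) *v o' n k)))))) - o' n i"
        if i: "i \<in> incident net n" for i
      proof -
        have "A n i k *v o' n k = 2 *\<^sub>R (H n i *v (Rbar net k (node_pos net n k) *v (Z k (node_pos net n k) *v o' n k)))
            - (if k = i then o' n k else 0)" for k
          using n by (simp add: A_def matrix_vector_mult_diff_rdistrib matrix_vector_mul_assoc[symmetric] scaleR_matrix_vector_assoc[symmetric])
        then have "(\<Sum>k\<in>incident net n. A n i k *v o' n k)
            = 2 *\<^sub>R (H n i *v (\<Sum>k\<in>incident net n. Rbar net k (node_pos net n k) *v (Z k (node_pos net n k) *v o' n k))) - o' n i"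
          using i finite_incident[of net n]
          by (simp add: sum_subtractf scaleR_sum_right[symmetric] sum.delta
              linear_sum[OF matrix_vector_mul_linear, symmetric])
        moreover have "Qm n i *v r n = 2 *\<^sub>R (H n i *v r n)"
          using n by (simp add: Qm_def scaleR_matrix_vector_assoc[symmetric])
        moreover have "H n i *v v = Vi i (node_pos net n i) *v (transpose (Rbar net i (node_pos net n i)) *v (matrix_inv (K n) *v v))" for v
          by (simp add: H_def matrix_vector_mul_assoc[symmetric] del: transpose_matrix_vector)
        ultimately show ?thesis by (simp add: matrix_vector_right_distrib scaleR_add_right del: transpose_matrix_vector)
      qed
      have Rb: "Rbar net i (node_pos net n i) *v (transpose (Rbar net i (node_pos net n i)) *v v) = v"
        "transpose (Rbar net i (node_pos net n i)) *v (Rbar net i (node_pos net n i) *v v) = v"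
        if "i \<in> incident net n" for i v
        using Rbar_orthogonal(2,3)[OF rot_SO3[OF node_pos_in[OF that]]] by blast+
      have VVi: "V i (node_pos net n i) *v (Vi i (node_pos net n i) *v v) = v"
        "Vi i (node_pos net n i) *v (V i (node_pos net n i) *v v) = v"
        "Z i (node_pos net n i) ** Vi i (node_pos net n i) \<in> SPD" if "i \<in> incident net n" for i v
        using inv[OF node_pos_in[OF that]] by (simp_all add: matrix_vector_mul_assoc)
      have up: "Rbar net i (node_pos net n i) *v upper (w i (node_pos net n i))
          = Rbar net i (node_pos net n i) *v ((1/2) *\<^sub>R (V i (node_pos net n i) *v (p n i + o' n i)))"
        and lo: "node_sign net n i *\<^sub>R (Rbar net i (node_pos net n i) *v lower (w i (node_pos net n i)))
          = Rbar net i (node_pos net n i) *v ((1/2) *\<^sub>R (Z i (node_pos net n i) *v (p n i - o' n i)))"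
        if "i \<in> incident net n" for i
        using po[OF nn that] by (simp_all add: matrix_vector_mult_scaleR[symmetric] del: matrix_vector_mult_scaleR)
      have "?S n \<longleftrightarrow> (\<forall>i\<in>incident net n. p n i = 2 *\<^sub>R (Vi i (node_pos net n i) *v
          (transpose (Rbar net i (node_pos net n i)) *v (matrix_inv (K n) *v
            (r n + (\<Sum>k\<in>incident net n. Rbar net k (node_pos net n k) *v (Z k (node_pos net n k) *v o' n k)))))) - o' n i)"
        using S by simp
      also have "\<dots> \<longleftrightarrow> (\<forall>i\<in>incident net n. \<forall>j\<in>incident net n.
          Rbar net i (node_pos net n i) *v ((1/2) *\<^sub>R (V i (node_pos net n i) *v (p n i + o' n i)))
          = Rbar net j (node_pos net n j) *v ((1/2) *\<^sub>R (V j (node_pos net n j) *v (p n j + o' n j))))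
        \<and> (\<Sum>i\<in>incident net n. Rbar net i (node_pos net n i) *v ((1/2) *\<^sub>R (Z i (node_pos net n i) *v (p n i - o' n i)))) = r n"
        by (rule joint_scattering[OF finite_incident ne VVi(1) VVi(2) Rb(1) Rb(2) refl VVi(3) K_def])
      finally show ?thesis using up lo by simp
    qed
    have neu: "?S n \<longleftrightarrow> node_sign net n (first_beam net n) *\<^sub>R
        lower (w (first_beam net n) (node_pos net n (first_beam net n))) = r n"
      if n: "n \<in> neumann_nodes net" for n
    proof -
      let ?i = "first_beam net n"
      have inc: "incident net n = {?i}" by (rule special_nodes(6)[OF n])
      then have i: "?i \<in> incident net n" by simp
      let ?x = "node_pos net n ?i"
      have ZZ: "Z ?i ?x *v (Zi ?i ?x *v v) = v" "Zi ?i ?x *v (Z ?i ?x *v v) = v" for v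
        using inv[OF node_pos_in[OF i]] by (simp_all add: matrix_vector_mul_assoc)
      have "?S n \<longleftrightarrow> p n ?i = 2 *\<^sub>R (Zi ?i ?x *v r n) + o' n ?i"
        using special_nodes(4)[OF n] n by (simp add: inc Qm_def A_def scaleR_matrix_vector_assoc[symmetric])
      also have "\<dots> \<longleftrightarrow> (1/2) *\<^sub>R (p n ?i - o' n ?i) = Zi ?i ?x *v r n"
        by (rule double_eq_iff)
      also have "\<dots> \<longleftrightarrow> Z ?i ?x *v ((1/2) *\<^sub>R (p n ?i - o' n ?i)) = r n"
        using ZZ by metis
      also have "\<dots> \<longleftrightarrow> node_sign net n ?i *\<^sub>R lower (w ?i ?x) = r n"
        using po[OF special_nodes(2)[OF n] i] by (simp add: matrix_vector_mult_scaleR)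
      finally show ?thesis .
    qed
    have dir: "?S n \<longleftrightarrow> upper (w (first_beam net n) (node_pos net n (first_beam net n))) = r n"
      if n: "n \<in> dirichlet_nodes net" for n
    proof -
      let ?i = "first_beam net n"
      have inc: "incident net n = {?i}" by (rule special_nodes(7)[OF n])
      then have i: "?i \<in> incident net n" by simp
      let ?x = "node_pos net n ?i"
      have VV: "V ?i ?x *v (Vi ?i ?x *v v) = v" "Vi ?i ?x *v (V ?i ?x *v v) = v" for v
        using inv[OF node_pos_in[OF i]] by (simp_all add: matrix_vector_mul_assoc)
      have "?S n \<longleftrightarrow> p n ?i = 2 *\<^sub>R (Vi ?i ?x *v r n) - o' n ?i"
        using special_nodes(5)[OF n] n
        by (simp add: inc Qm_def A_def scaleR_matrix_vector_assoc[symmetric] matrix_vector_mult_minus_left)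
      also have "\<dots> \<longleftrightarrow> (1/2) *\<^sub>R (p n ?i + o' n ?i) = Vi ?i ?x *v r n"
        by (rule double_eq_iff)
      also have "\<dots> \<longleftrightarrow> V ?i ?x *v ((1/2) *\<^sub>R (p n ?i + o' n ?i)) = r n"
        using VV by metis
      also have "\<dots> \<longleftrightarrow> upper (w ?i ?x) = r n"
        using po[OF special_nodes(3)[OF n] i] by (simp add: matrix_vector_mult_scaleR)
      finally show ?thesis .
    qed
    show "nodal_identities net w r \<longleftrightarrow> (\<forall>n\<in>nodes net. ?S n)"
    proof
      assume N: "nodal_identities net w r"
      show "\<forall>n\<in>nodes net. ?S n"
      proof
        fix n assume n: "n \<in> nodes net"
        show "?S n"
        proof (cases "incident net n = {}")
          case False
          with wf n show ?thesis
          proof (cases rule: node_cases)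
            case 1
            show ?thesis unfolding mult[OF 1] using nodal_identitiesD(1,2)[OF N 1] by blast
          next
            case 2
            show ?thesis unfolding neu[OF 2(1)] by (rule nodal_identitiesD(3)[OF N 2(1)])
          next
            case 3
            show ?thesis unfolding dir[OF 3(1)] by (rule nodal_identitiesD(4)[OF N 3(1)])
          qed
        qed simp
      qed
    next
      assume S: "\<forall>n\<in>nodes net. ?S n"
      show "nodal_identities net w r"
        unfolding nodal_identities_iff
      proof (intro conjI ballI, goal_cases)
        case (1 n i j)
        then show ?case using mult[OF 1(1)] bspec[OF S special_nodes(1)[OF 1(1)]] by blast
      next
        case (2 n)
        then show ?case using mult[OF 2] bspec[OF S special_nodes(1)[OF 2]] by blast
      next
        case (3 n)
        then show ?case using neu[OF 3] bspec[OF S special_nodes(2)[OF 3]] by blast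
      next
        case (4 n)
        then show ?case using dir[OF 4] bspec[OF S special_nodes(3)[OF 4]] by blast
      qed
    qed
  qed
qed

section \<open>Recovering nodal identities from their time derivatives\<close>

lemma equal_if_derivatives_equal:
  fixes f g :: "real \<Rightarrow> 'b::real_normed_vector"
  assumes "\<And>t. t \<in> {0..T} \<Longrightarrow> (f has_vector_derivative h t) (at t within {0..T})"
    and "\<And>t. t \<in> {0..T} \<Longrightarrow> (g has_vector_derivative h t) (at t within {0..T})"
    and "f 0 = g 0" and t: "t \<in> {0..T}"
  shows "f t = g t"
proof -
  have "((\<lambda>t. f t - g t) has_vector_derivative 0) (at t within {0..T})" if "t \<in> {0..T}" for t
    using has_vector_derivative_diff[OF assms(1)[OF that] assms(2)[OF that]] by simp
  then obtain c where "\<And>t. t \<in> {0..T} \<Longrightarrow> f t - g t = c"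
    using has_vector_derivative_zero_constant[of "{0..T}" "\<lambda>t. f t - g t"] by auto
  from this[of 0] this[of t] show ?thesis using assms(3) t by auto
qed

text \<open>The identities are linear in the profile and the nodal values, with coefficients
  constant in time. Those for the time derivatives therefore integrate to those for
  \<open>y\<close>, with the zeroth-order compatibility conditions as initial values.\<close>

lemma nodal_identities_integrate:
  assumes y: "\<And>i x t. i \<in> beams net \<Longrightarrow> x \<in> {0..len net i} \<Longrightarrow> t \<in> {0..T} \<Longrightarrow>
      ((\<lambda>t. y i (x, t)) has_vector_derivative yt i (x, t)) (at t within {0..T})"
    and q: "\<And>n t. n \<in> nodes net \<Longrightarrow> t \<in> {0..T} \<Longrightarrow> (q n has_vector_derivative q' n t) (at t within {0..T})"
    and y0: "nodal_identities net (\<lambda>i x. y i (x, 0)) (\<lambda>n. q n 0)"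
    and yt: "\<And>t. t \<in> {0..T} \<Longrightarrow> nodal_identities net (\<lambda>i x. yt i (x, t)) (\<lambda>n. q' n t)"
    and t: "t \<in> {0..T}"
  shows "nodal_identities net (\<lambda>i x. y i (x, t)) (\<lambda>n. q n t)"
proof -
  note mv = bounded_linear.has_vector_derivative[OF matrix_vector_mul_bounded_linear]
    and up = bounded_linear.has_vector_derivative[OF bounded_linear_upper]
    and lo = bounded_linear.has_vector_derivative[OF bounded_linear_lower]
    and sc = bounded_linear.has_vector_derivative[OF bounded_linear_scaleR_right]
  have yn: "((\<lambda>t. y i (node_pos net n i, t)) has_vector_derivative yt i (node_pos net n i, t)) (at t within {0..T})"
    if "i \<in> incident net n" "t \<in> {0..T}" for i n t
    by (rule y[OF node_pos_in[OF that(1)] that(2)])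
  show ?thesis
    unfolding nodal_identities_iff
  proof (intro conjI ballI, goal_cases)
    case (1 n i j)
    show ?case
    proof (rule equal_if_derivatives_equal[where T = T
          and f = "\<lambda>t. Rbar net i (node_pos net n i) *v upper (y i (node_pos net n i, t))"
          and g = "\<lambda>t. Rbar net j (node_pos net n j) *v upper (y j (node_pos net n j, t))"])
      show "t \<in> {0..T}" by (rule t)
    next
      show "Rbar net i (node_pos net n i) *v upper (y i (node_pos net n i, 0)) = Rbar net j (node_pos net n j) *v upper (y j (node_pos net n j, 0))"
        by (rule nodal_identitiesD(1)[OF y0 1])
    next
      fix t assume t: "t \<in> {0..T}"
      show "((\<lambda>t. Rbar net i (node_pos net n i) *v upper (y i (node_pos net n i, t))) has_vector_derivative
          Rbar net i (node_pos net n i) *v upper (yt i (node_pos net n i, t))) (at t within {0..T})"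
        by (intro mv up yn 1 t)
      show "((\<lambda>t. Rbar net j (node_pos net n j) *v upper (y j (node_pos net n j, t))) has_vector_derivative
          Rbar net i (node_pos net n i) *v upper (yt i (node_pos net n i, t))) (at t within {0..T})"
        unfolding nodal_identitiesD(1)[OF yt[OF t] 1] by (intro mv up yn 1 t)
    qed
  next
    case (2 n)
    show ?case
    proof (rule equal_if_derivatives_equal[where T = T
          and f = "\<lambda>t. \<Sum>i\<in>incident net n. node_sign net n i *\<^sub>R (Rbar net i (node_pos net n i) *v lower (y i (node_pos net n i, t)))"
          and g = "\<lambda>t. q n t"])
      show "t \<in> {0..T}" by (rule t)
    next
      show "(\<Sum>i\<in>incident net n. node_sign net n i *\<^sub>R (Rbar net i (node_pos net n i) *v lower (y i (node_pos net n i, 0)))) = q n 0"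
        by (rule nodal_identitiesD(2)[OF y0 2])
    next
      fix t assume t: "t \<in> {0..T}"
      show "((\<lambda>t. \<Sum>i\<in>incident net n. node_sign net n i *\<^sub>R (Rbar net i (node_pos net n i) *v lower (y i (node_pos net n i, t))))
          has_vector_derivative q' n t) (at t within {0..T})"
        unfolding nodal_identitiesD(2)[OF yt[OF t] 2, symmetric]
        by (intro has_vector_derivative_sum sc mv lo yn t)
      show "((\<lambda>t. q n t) has_vector_derivative q' n t) (at t within {0..T})"
        by (rule q[OF special_nodes(1)[OF 2] t])
    qed
  next
    case (3 n)
    have i: "first_beam net n \<in> incident net n" using special_nodes(6)[OF 3] by simp
    show ?case
    proof (rule equal_if_derivatives_equal[where T = T
          and f = "\<lambda>t. node_sign net n (first_beam net n) *\<^sub>R lower (y (first_beam net n) (node_pos net n (first_beam net n), t))"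
          and g = "\<lambda>t. q n t"])
      show "t \<in> {0..T}" by (rule t)
    next
      show "node_sign net n (first_beam net n) *\<^sub>R lower (y (first_beam net n) (node_pos net n (first_beam net n), 0)) = q n 0"
        by (rule nodal_identitiesD(3)[OF y0 3])
    next
      fix t assume t: "t \<in> {0..T}"
      show "((\<lambda>t. node_sign net n (first_beam net n) *\<^sub>R lower (y (first_beam net n) (node_pos net n (first_beam net n), t)))
          has_vector_derivative q' n t) (at t within {0..T})"
        unfolding nodal_identitiesD(3)[OF yt[OF t] 3, symmetric] by (intro sc lo yn t i)
      show "((\<lambda>t. q n t) has_vector_derivative q' n t) (at t within {0..T})"
        by (rule q[OF special_nodes(2)[OF 3] t])
    qed
  next
    case (4 n)
    have i: "first_beam net n \<in> incident net n" using special_nodes(7)[OF 4] by simp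
    show ?case
    proof (rule equal_if_derivatives_equal[where T = T
          and f = "\<lambda>t. upper (y (first_beam net n) (node_pos net n (first_beam net n), t))"
          and g = "\<lambda>t. q n t"])
      show "t \<in> {0..T}" by (rule t)
    next
      show "upper (y (first_beam net n) (node_pos net n (first_beam net n), 0)) = q n 0"
        by (rule nodal_identitiesD(4)[OF y0 4])
    next
      fix t assume t: "t \<in> {0..T}"
      show "((\<lambda>t. upper (y (first_beam net n) (node_pos net n (first_beam net n), t)))
          has_vector_derivative q' n t) (at t within {0..T})"
        unfolding nodal_identitiesD(4)[OF yt[OF t] 4, symmetric] by (intro up yn t i)
      show "((\<lambda>t. q n t) has_vector_derivative q' n t) (at t within {0..T})"
        by (rule q[OF special_nodes(3)[OF 4] t])
    qed
  qed
qed

lemma continuous_on_E_mat: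
  assumes i: "i \<in> beams net"
  shows "continuous_on {0..len net i} (E_mat net i)"
proof -
  have "bounded_linear unhat"
    unfolding linear_conv_bounded_linear[symmetric] by (intro linearI) (simp_all add: unhat_def vec_eq_iff forall_3)
  note unhat = bounded_linear.continuous_on[OF this]
  have "bounded_linear hat"
    unfolding linear_conv_bounded_linear[symmetric] by (intro linearI hat_linear)
  note hat = bounded_linear.continuous_on[OF this]
  have r: "rot net i \<in> Ck (Suc 1) {0..len net i} SO3" using rot[OF i] by (simp add: numeral_2_eq_2)
  obtain R' where R': "\<And>x. x \<in> {0..len net i} \<Longrightarrow> (rot net i has_vector_derivative R' x) (at x within {0..len net i})"
    "continuous_on {0..len net i} R'"
    by (rule Ck_derivative[OF r]) blast
  have "vector_derivative (rot net i) (at x within {0..len net i}) = R' x" if "x \<in> {0..len net i}" for x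
    using vector_derivative_within_cbox[of 0 "len net i" x "rot net i" "R' x"] R'(1)[OF that] that len_pos[OF i] by simp
  then have "continuous_on {0..len net i} (\<lambda>x. vector_derivative (rot net i) (at x within {0..len net i}))"
    by (intro continuous_on_eq[OF R'(2)]) simp
  then have "continuous_on {0..len net i} (Upsilon net i)"
    unfolding Upsilon_def[abs_def]
    by (intro unhat continuous_intros Ck_continuous_on[OF rot[OF i]])
  then show ?thesis
    unfolding E_mat_def[abs_def] by (intro continuous_intros hat)
qed

end

section \<open>Explicit inverses, diagonal matrices and C^1 norms\<close>

lemma matrix_inv_SPD_eq:
  fixes A B :: "real^'n^'n"
  assumes "A \<in> SPD" "A ** B = mat 1"
  shows "matrix_inv A = B"
proof -
  have "matrix_inv A = matrix_inv A ** (A ** B)" by (simp add: assms(2))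
  also have "\<dots> = B" by (simp add: matrix_mul_assoc SPD_invertible(1)[OF assms(1)])
  finally show ?thesis .
qed

lemma diagonal_matrix_mult:
  assumes "diagonal_matrix D"
  shows "(D *v u) $ k = D $ k $ k * u $ k"
proof -
  have "(D *v u) $ k = (\<Sum>j\<in>UNIV. if j = k then D $ k $ k * u $ k else 0)"
    unfolding matrix_vector_mult_def vec_lambda_beta
    by (intro sum.cong) (use assms in \<open>auto simp: diagonal_matrix_def\<close>)
  then show ?thesis by simp
qed

lemma C1_xtI:
  fixes y yx yt :: "real \<times> real \<Rightarrow> 'b::real_normed_vector"
  assumes "l > 0" "T > 0"
    and cont: "continuous_on ({0..l} \<times> {0..T}) y" "continuous_on ({0..l} \<times> {0..T}) yx" "continuous_on ({0..l} \<times> {0..T}) yt"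
    and der: "\<And>x t. x \<in> {0..l} \<Longrightarrow> t \<in> {0..T} \<Longrightarrow> ((\<lambda>x. y (x, t)) has_vector_derivative yx (x, t)) (at x within {0..l})"
      "\<And>x t. x \<in> {0..l} \<Longrightarrow> t \<in> {0..T} \<Longrightarrow> ((\<lambda>t. y (x, t)) has_vector_derivative yt (x, t)) (at t within {0..T})"
  shows "y \<in> C1_xt l T" and "\<And>p. p \<in> {0..l} \<times> {0..T} \<Longrightarrow> partial_x l y p = yx p"
    and "\<And>p. p \<in> {0..l} \<times> {0..T} \<Longrightarrow> partial_t T y p = yt p"
proof -
  show px: "\<And>p. p \<in> {0..l} \<times> {0..T} \<Longrightarrow> partial_x l y p = yx p"
    using vector_derivative_within_cbox[OF assms(1), unfolded cbox_interval, OF _ der(1)]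
    by (auto simp: partial_x_def)
  show pt: "\<And>p. p \<in> {0..l} \<times> {0..T} \<Longrightarrow> partial_t T y p = yt p"
    using vector_derivative_within_cbox[OF assms(2), unfolded cbox_interval, OF _ der(2)]
    by (auto simp: partial_t_def)
  show "y \<in> C1_xt l T"
    unfolding C1_xt_def
  proof (intro CollectI conjI ballI)
    show "continuous_on ({0..l} \<times> {0..T}) (partial_x l y)" by (rule continuous_on_eq[OF cont(2)]) (simp add: px)
    show "continuous_on ({0..l} \<times> {0..T}) (partial_t T y)" by (rule continuous_on_eq[OF cont(3)]) (simp add: pt)
    fix x t assume "x \<in> {0..l}" "t \<in> {0..T}"
    then show "(\<lambda>\<xi>. y (\<xi>, t)) differentiable (at x within {0..l})" "(\<lambda>s. y (x, s)) differentiable (at t within {0..T})"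
      by (rule differentiableI_vector[OF der(1)], rule differentiableI_vector[OF der(2)])
  qed (rule cont(1))
qed

lemma C1_xt_norm_le:
  assumes "l > 0" "T > 0"
    and "\<And>p. p \<in> {0..l} \<times> {0..T} \<Longrightarrow> norm (y p) \<le> a" "\<And>p. p \<in> {0..l} \<times> {0..T} \<Longrightarrow> norm (partial_x l y p) \<le> b"
    and "\<And>p. p \<in> {0..l} \<times> {0..T} \<Longrightarrow> norm (partial_t T y p) \<le> c"
  shows "C1_xt_norm l T y \<le> a + b + c"
  unfolding C1_xt_norm_def using assms by (intro add_mono cSUP_least) auto

text \<open>The suprema in \<open>C1_norm\<close> dominate the values only if they are taken over
  sets bounded above; continuity on the compact interval provides this.\<close>

lemma C1_norm_bounds:
  fixes f :: "real \<Rightarrow> 'b::real_normed_vector"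
  assumes ab: "a < b" and f: "f \<in> Ck 1 {a..b} UNIV" and x: "x \<in> {a..b}"
  shows "norm (f x) \<le> C1_norm {a..b} f"
    and "norm (vector_derivative f (at x within {a..b})) \<le> C1_norm {a..b} f"
    and "(f has_vector_derivative vector_derivative f (at x within {a..b})) (at x within {a..b})"
    and "continuous_on {a..b} (\<lambda>x. vector_derivative f (at x within {a..b}))"
proof -
  obtain f' where f': "\<And>x. x \<in> {a..b} \<Longrightarrow> (f has_vector_derivative f' x) (at x within {a..b})" "continuous_on {a..b} f'"
    using f Ck_derivative[of f 0 "{a..b}" UNIV] by (auto simp: One_nat_def)
  have vd: "vector_derivative f (at x within {a..b}) = f' x" if "x \<in> {a..b}" for x
    using vector_derivative_within_cbox[of a b x f "f' x"] f'(1)[OF that] that ab by simp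
  show c: "continuous_on {a..b} (\<lambda>x. vector_derivative f (at x within {a..b}))"
    by (rule continuous_on_eq[OF f'(2)]) (simp add: vd)
  show "(f has_vector_derivative vector_derivative f (at x within {a..b})) (at x within {a..b})"
    using f'(1)[OF x] vd[OF x] by simp
  have bdd: "bdd_above ((\<lambda>x. norm (g x)) ` {a..b})" if "continuous_on {a..b} g" for g :: "real \<Rightarrow> 'b"
    using that by (intro bounded_imp_bdd_above compact_imp_bounded compact_continuous_image continuous_intros) auto
  have 1: "norm (f x) \<le> (SUP x\<in>{a..b}. norm (f x))" if "x \<in> {a..b}" for x
    by (rule cSUP_upper[OF that bdd[OF Ck_continuous_on[OF f]]])
  have 2: "norm (vector_derivative f (at x within {a..b})) \<le> (SUP x\<in>{a..b}. norm (vector_derivative f (at x within {a..b})))"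
    if "x \<in> {a..b}" for x
    by (rule cSUP_upper[OF that bdd[OF c]])
  have "0 \<le> (SUP x\<in>{a..b}. norm (f x))" "0 \<le> (SUP x\<in>{a..b}. norm (vector_derivative f (at x within {a..b})))"
    using order_trans[OF norm_ge_zero 1[OF x]] order_trans[OF norm_ge_zero 2[OF x]] by auto
  then show "norm (f x) \<le> C1_norm {a..b} f"
    and "norm (vector_derivative f (at x within {a..b})) \<le> C1_norm {a..b} f"
    using 1[OF x] 2[OF x] unfolding C1_norm_def by linarith+
qed

section \<open>Existence of solutions\<close>

context regular_network
begin

lemma nodal_identities_cong:
  assumes "\<And>i x. i \<in> beams net \<Longrightarrow> x \<in> {0..len net i} \<Longrightarrow> w i x = w' i x"
  shows "nodal_identities net w r \<longleftrightarrow> nodal_identities net w' r"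
proof -
  have eq: "w i (node_pos net n i) = w' i (node_pos net n i)" if "i \<in> incident net n" for n i
    using assms[OF node_pos_in[OF that]] .
  have "nodal_identities net w r" if w': "nodal_identities net w' r"
    and eq: "\<And>n i. i \<in> incident net n \<Longrightarrow> w i (node_pos net n i) = w' i (node_pos net n i)" for w w'
    unfolding nodal_identities_iff
  proof (intro conjI ballI, goal_cases)
    case (1 n i j)
    then show ?case using nodal_identitiesD(1)[OF w' 1] eq by simp
  next
    case (2 n)
    then show ?case using nodal_identitiesD(2)[OF w' 2] eq by simp
  next
    case (3 n)
    then show ?case using nodal_identitiesD(3)[OF w' 3] special_nodes(6)[OF 3] eq[of "first_beam net n" n] by simp
  next
    case (4 n)
    then show ?case using nodal_identitiesD(4)[OF w' 4] special_nodes(7)[OF 4] eq[of "first_beam net n" n] by simp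
  qed
  from this[of w' w] this[of w w'] eq show ?thesis by metis
qed

end

text \<open>Direction of propagation: the first half of the Riemann invariants moves towards the
  initial point of the beam, the second half towards the ending point.\<close>

definition sigma :: "('a + 'a) \<Rightarrow> real" where
  "sigma m = (case m of Inl _ \<Rightarrow> -1 | Inr _ \<Rightarrow> 1)"

text \<open>Each diagonal entry of \<open>D\<close> belongs to two opposite waves. The sign is kept
  apart in \<open>sigma\<close>, so that speeds are positive and travel times make sense.\<close>

definition wave_speed :: "real^('a::finite)^'a \<Rightarrow> ('a + 'a) \<Rightarrow> real" where
  "wave_speed D m = (case m of Inl k \<Rightarrow> D $ k $ k | Inr k \<Rightarrow> D $ k $ k)"

context regular_network
begin

text \<open>\<open>C\<close> depends on the network and on \<open>T\<close> only, and the bound is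
  linear in the data; \<open>C * \<delta> \<le> 1\<close> is the price of the quadratic
  term.\<close>

theorem solution_exists:
  assumes T: "T > 0"
  obtains C where "C > 0" and "\<And>y0 q \<delta>.
    \<lbrakk>\<delta> \<ge> 0; C * \<delta> \<le> 1;
     \<And>i. i \<in> beams net \<Longrightarrow> y0 i \<in> Ck 1 {0..len net i} UNIV; \<And>n. n \<in> nodes net \<Longrightarrow> q n \<in> Ck 1 {0..T} UNIV;
     \<And>i. i \<in> beams net \<Longrightarrow> C1_norm {0..len net i} (y0 i) \<le> \<delta>; \<And>n. n \<in> nodes net \<Longrightarrow> C1_norm {0..T} (q n) \<le> \<delta>;
     first_order_compatible net T y0 q\<rbrakk>
    \<Longrightarrow> \<exists>y. (\<forall>i\<in>beams net. y i \<in> C1_xt (len net i) T \<and> C1_xt_norm (len net i) T (y i) \<le> C * \<delta>)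
          \<and> solves_system net T y0 q y"
proof -
  have fin: "finite (beams net)" "finite (nodes net)" by (auto simp: beams_def nodes_def)
  define X where "X i = {0..len net i}" for i
  have Xc: "compact (X i)" for i by (simp add: X_def)
  have "\<forall>i\<in>beams net. \<exists>V Z Vi Zi (D :: real \<Rightarrow> mat6). Ck_on 1 (X i) V \<and> Ck_on 1 (X i) Z \<and> Ck_on 1 (X i) Vi \<and> Ck_on 1 (X i) Zi
      \<and> continuous_on (X i) D
      \<and> (\<forall>x\<in>X i. V x ** Vi x = mat 1 \<and> Vi x ** V x = mat 1
        \<and> Z x ** Zi x = mat 1 \<and> Zi x ** Z x = mat 1
        \<and> mass net i x ** V x ** D x = Z x \<and> flex net i x ** Z x ** D x = V x
        \<and> Z x ** Vi x \<in> SPD \<and> diagonal_matrix (D x) \<and> (\<forall>k. D x $ k $ k > 0))"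
  proof
    fix i assume "i \<in> beams net"
    show "\<exists>V Z Vi Zi (D :: real \<Rightarrow> mat6). Ck_on 1 (X i) V \<and> Ck_on 1 (X i) Z \<and> Ck_on 1 (X i) Vi \<and> Ck_on 1 (X i) Zi
      \<and> continuous_on (X i) D
      \<and> (\<forall>x\<in>X i. V x ** Vi x = mat 1 \<and> Vi x ** V x = mat 1
        \<and> Z x ** Zi x = mat 1 \<and> Zi x ** Z x = mat 1
        \<and> mass net i x ** V x ** D x = Z x \<and> flex net i x ** Z x ** D x = V x
        \<and> Z x ** Vi x \<in> SPD \<and> diagonal_matrix (D x) \<and> (\<forall>k. D x $ k $ k > 0))"
    proof (rule beam_diagonalisation[OF \<open>i \<in> beams net\<close>, folded X_def], goal_cases)
      case (1 V Z Vi Zi D)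
      show ?case
        by (rule exI[of _ V], rule exI[of _ Z], rule exI[of _ Vi], rule exI[of _ Zi], rule exI[of _ D])
          (simp add: 1 del: Ck_on.simps One_nat_def)
    qed
  qed
  then obtain V Z Vi Zi D :: "nat \<Rightarrow> real \<Rightarrow> mat6" where diag: "\<forall>i\<in>beams net. Ck_on 1 (X i) (V i) \<and> Ck_on 1 (X i) (Z i)
      \<and> Ck_on 1 (X i) (Vi i) \<and> Ck_on 1 (X i) (Zi i) \<and> continuous_on (X i) (D i)
      \<and> (\<forall>x\<in>X i. V i x ** Vi i x = mat 1 \<and> Vi i x ** V i x = mat 1
        \<and> Z i x ** Zi i x = mat 1 \<and> Zi i x ** Z i x = mat 1
        \<and> mass net i x ** V i x ** D i x = Z i x \<and> flex net i x ** Z i x ** D i x = V i x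
        \<and> Z i x ** Vi i x \<in> SPD \<and> diagonal_matrix (D i x) \<and> (\<forall>k. D i x $ k $ k > 0))"
    unfolding bchoice_iff by blast
  have V1: "Ck_on 1 (X i) (V i)" and Z1: "Ck_on 1 (X i) (Z i)" and Vi1: "Ck_on 1 (X i) (Vi i)"
    and Zi1: "Ck_on 1 (X i) (Zi i)" and Dc: "continuous_on (X i) (D i)" if "i \<in> beams net" for i
    using diag that by blast+
  have VVi: "V i x *v (Vi i x *v v) = v" "Vi i x *v (V i x *v v) = v"
    and ZZi: "Z i x *v (Zi i x *v v) = v" "Zi i x *v (Z i x *v v) = v"
    and MVD: "mass net i x *v (V i x *v (D i x *v v)) = Z i x *v v"
    and CZD: "flex net i x *v (Z i x *v (D i x *v v)) = V i x *v v"
    and Ddiag: "diagonal_matrix (D i x)" and Dpos: "D i x $ k $ k > 0"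
    if "i \<in> beams net" "x \<in> X i" for i x v k
    using bspec[OF diag that(1)] that(2) by (simp_all add: matrix_vector_mul_assoc matrix_mul_assoc)
  note cont1 = Ck_on_imp_continuous_on
  \<comment> \<open>\<open>L\<close> rebuilds the state from the invariants: the velocity is
    \<open>V\<close> times their half sum, the stress \<open>Z\<close> times their half difference.
    \<open>P\<close> is the inverse transformation.\<close>
  define L where "L i x = block ((1/2) *\<^sub>R V i x) ((1/2) *\<^sub>R V i x) ((1/2) *\<^sub>R Z i x) ((-1/2) *\<^sub>R Z i x)" for i x
  define P where "P i x = block (Vi i x) (Zi i x) (Vi i x) ((-1) *\<^sub>R Zi i x)" for i x
  have L1: "Ck_on 1 (X i) (L i)" and P1: "Ck_on 1 (X i) (P i)" if "i \<in> beams net" for i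
    unfolding L_def[abs_def] P_def[abs_def]
    by (intro Ck1_block Ck1_linear[OF bounded_linear_scaleR_right] V1 Z1 Vi1 Zi1 that)+
  have "\<forall>i\<in>beams net. \<exists>L'. (\<forall>x\<in>X i. (L i has_vector_derivative L' x) (at x within X i)) \<and> continuous_on (X i) L'"
    using L1 unfolding Ck1_iff by blast
  then obtain L' where L': "\<And>i x. i \<in> beams net \<Longrightarrow> x \<in> X i \<Longrightarrow> (L i has_vector_derivative L' i x) (at x within X i)"
    "\<And>i. i \<in> beams net \<Longrightarrow> continuous_on (X i) (L' i)"
    unfolding bchoice_iff by blast
  have "\<forall>i\<in>beams net. \<exists>P'. (\<forall>x\<in>X i. (P i has_vector_derivative P' x) (at x within X i)) \<and> continuous_on (X i) P'"
    using P1 unfolding Ck1_iff by blast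
  then obtain P' where P': "\<And>i x. i \<in> beams net \<Longrightarrow> x \<in> X i \<Longrightarrow> (P i has_vector_derivative P' i x) (at x within X i)"
    "\<And>i. i \<in> beams net \<Longrightarrow> continuous_on (X i) (P' i)"
    unfolding bchoice_iff by blast
  have Lu: "upper (L i x *v u) = (1/2) *\<^sub>R (V i x *v (upper u + lower u))"
    "lower (L i x *v u) = (1/2) *\<^sub>R (Z i x *v (upper u - lower u))" for i x u
    by (simp_all add: L_def upper_block_mult lower_block_mult scaleR_matrix_vector_assoc[symmetric]
        matrix_vector_right_distrib matrix_vector_mult_diff_distrib scaleR_add_right scaleR_diff_right
        matrix_vector_mult_minus_left)
  have Pu: "upper (P i x *v u) = Vi i x *v upper u + Zi i x *v lower u"
    "lower (P i x *v u) = Vi i x *v upper u - Zi i x *v lower u" for i x u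
    by (simp_all add: P_def upper_block_mult lower_block_mult scaleR_matrix_vector_assoc[symmetric] matrix_vector_mult_minus_left)
  have half: "(1/2) *\<^sub>R (a + b) + (1/2) *\<^sub>R (a - b) = a" "(1/2) *\<^sub>R (a + b) - (1/2) *\<^sub>R (a - b) = b"
    for a b :: vec6
    by (simp_all add: vec_eq_iff field_simps)
  have half_mult: "(1/2) *\<^sub>R (M *v ((a + b) + (a - b))) = M *v a" "(1/2) *\<^sub>R (M *v ((a + b) - (a - b))) = M *v b"
    for M :: mat6 and a b
    unfolding matrix_vector_mult_scaleR[symmetric]
    by (rule arg_cong[where f = "(*v) M"], simp add: vec_eq_iff)+
  have PL: "P i x *v (L i x *v u) = u" and LP: "L i x *v (P i x *v u) = u" if "i \<in> beams net" "x \<in> X i" for i x u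
    unfolding upper_lower_eq_iff[of _ u]
    by (simp_all only: Lu Pu matrix_vector_mult_scaleR VVi[OF that] ZZi[OF that] half half_mult simp_thms)
  \<comment> \<open>The relations \<open>M V D = Z\<close> and \<open>C Z D = V\<close> give the
    inverses of mass and flexibility as products; continuity of \<open>A_mat\<close> and
    \<open>B_mat\<close> follows from this explicit form.\<close>
  define Qi where "Qi i x = block (V i x ** D i x ** Zi i x) 0 0 (Z i x ** D i x ** Vi i x)" for i x
  have QQi: "Q_mat net i x *v (Qi i x *v u) = u" if "i \<in> beams net" "x \<in> X i" for i x u
    unfolding upper_lower_eq_iff[of _ u]
    by (simp add: Q_mult Qi_def upper_block_mult lower_block_mult matrix_vector_mul_assoc[symmetric]
        MVD[OF that] CZD[OF that] VVi[OF that] ZZi[OF that])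
  have Qinv: "matrix_inv (Q_mat net i x) = Qi i x" if "i \<in> beams net" "x \<in> X i" for i x
    using Q_SPD[OF that(1)] that(2) QQi[OF that]
    by (intro matrix_inv_SPD_eq) (auto simp: X_def matrix_eq matrix_vector_mul_assoc[symmetric])
  have Qic: "continuous_on (X i) (Qi i)" if "i \<in> beams net" for i
    unfolding Qi_def[abs_def] by (intro continuous_intros cont1[OF V1] cont1[OF Z1] cont1[OF Vi1] cont1[OF Zi1] Dc that)
  have Qc: "continuous_on (X i) (Q_mat net i)" if "i \<in> beams net" for i
    unfolding X_def by (rule continuous_on_Q_mat[OF that])
  have Ac: "continuous_on (X i) (A_mat net i)" and Bc: "continuous_on (X i) (B_mat net i)" if i: "i \<in> beams net" for i
  proof -
    have Qi': "continuous_on (X i) (\<lambda>x. matrix_inv (Q_mat net i x))"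
      by (rule continuous_on_eq[OF Qic[OF i]]) (simp add: Qinv i)
    show "continuous_on (X i) (A_mat net i)" "continuous_on (X i) (B_mat net i)"
      unfolding A_mat_def[abs_def] B_mat_def[abs_def]
      by (intro continuous_intros Qi' continuous_on_E_mat[OF i, folded X_def])+
  qed
  define \<Lambda> where "\<Lambda> i x u = (\<chi> m. sigma m * wave_speed (D i x) m * u $ m)" for i x and u :: vec12
  have \<Lambda>u: "upper (\<Lambda> i x u) = - (D i x *v upper u)" "lower (\<Lambda> i x u) = D i x *v lower u"
    if "i \<in> beams net" "x \<in> X i" for i x u
    by (simp_all add: \<Lambda>_def vec_eq_iff upper_def lower_def sigma_def wave_speed_def diagonal_matrix_mult[OF Ddiag[OF that]])
  \<comment> \<open>The columns of \<open>L\<close> are eigenvectors of \<open>A_mat\<close>. This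
    is checked after multiplication by \<open>Q_mat\<close>, which turns \<open>A_mat\<close> into a
    constant matrix, and \<open>Q_mat\<close> is cancelled at the end.\<close>
  have AL: "A_mat net i x *v (L i x *v u) = L i x *v \<Lambda> i x u" if ix: "i \<in> beams net" "x \<in> X i" for i x u
  proof -
    have x: "x \<in> {0..len net i}" using ix by (simp add: X_def)
    have "Q_mat net i x *v (L i x *v \<Lambda> i x u) = - (block 0 (mat 1) (mat 1) 0 *v (L i x *v u))"
      unfolding upper_lower_eq_iff[of "Q_mat net i x *v (L i x *v \<Lambda> i x u)"]
      by (simp add: upper_lower_simps Q_mult Lu upper_block_mult lower_block_mult \<Lambda>u[OF ix] matrix_vector_mult_scaleR
          matrix_vector_right_distrib matrix_vector_mult_diff_distrib MVD[OF ix] CZD[OF ix]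
          bounded_bilinear.minus_right[OF bounded_bilinear_matrix_vector_mult] scaleR_add_right scaleR_diff_right)
    then have "Q_mat net i x *v (A_mat net i x *v (L i x *v u)) = Q_mat net i x *v (L i x *v \<Lambda> i x u)"
      using Q_mult_coefficients(1)[OF ix(1) x] by simp
    then have "matrix_inv (Q_mat net i x) *v (Q_mat net i x *v (A_mat net i x *v (L i x *v u)))
        = matrix_inv (Q_mat net i x) *v (Q_mat net i x *v (L i x *v \<Lambda> i x u))" by simp
    moreover have "matrix_inv (Q_mat net i x) *v (Q_mat net i x *v w) = w" for w
      by (simp add: matrix_vector_mul_assoc SPD_invertible(1)[OF Q_SPD[OF ix(1) x]])
    ultimately show ?thesis by (simp only:)
  qed
  \<comment> \<open>Differentiating \<open>L r\<close> in space, the derivative of \<open>L\<close>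
    adds a zeroth-order term to that of the system.\<close>
  define Bm where "Bm i x = - (P i x ** (B_mat net i x ** L i x + A_mat net i x ** L' i x))" for i x
  define PQ where "PQ i x = P i x ** Qi i x" for i x
  define QL where "QL i x = Q_mat net i x ** L i x" for i x
  \<comment> \<open>The quadratic term with its two arguments separated; on the diagonal it is
    \<open>g_fun\<close> in the variables \<open>r\<close>.\<close>
  define N where "N i x u v = PQ i x *v (G_mat (L i x *v u) *v (QL i x *v v))" for i x u v
  have Bmc: "continuous_on (X i) (Bm i)" and PQc: "continuous_on (X i) (PQ i)" and QLc: "continuous_on (X i) (QL i)"
    if i: "i \<in> beams net" for i
    unfolding Bm_def[abs_def] PQ_def[abs_def] QL_def[abs_def]
    by (intro continuous_intros cont1[OF P1] cont1[OF L1] L' Ac Bc Qic Qc i)+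
  have Bmu: "Bm i x *v u = - (P i x *v (B_mat net i x *v (L i x *v u) + A_mat net i x *v (L' i x *v u)))" for i x u
    by (simp add: Bm_def matrix_vector_mult_minus_left matrix_vector_mul_assoc[symmetric] matrix_vector_mult_add_rdistrib)
  have Nu: "N i x u u = P i x *v g_fun net i x (L i x *v u)" if "i \<in> beams net" "x \<in> X i" for i x u
    by (simp add: N_def PQ_def QL_def g_fun_def Qinv[OF that] matrix_vector_mul_assoc[symmetric])
  have Nbil: "bounded_bilinear (N i x)" for i x
  proof -
    have G: "G_mat (u + v) = G_mat u + G_mat v" "G_mat (c *\<^sub>R u) = c *\<^sub>R G_mat u" for u v c
      using bounded_linear.linear[OF bounded_linear_G_mat] by (simp_all add: linear_add linear_scale)
    have "bilinear (N i x)"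
      unfolding bilinear_def N_def
      by (auto intro!: linearI simp: G matrix_vector_right_distrib matrix_vector_mult_add_rdistrib
          matrix_vector_mult_scaleR scaleR_matrix_vector_assoc[symmetric])
    then show ?thesis by (simp add: bilinear_conv_bounded_bilinear)
  qed
  have Ncont: "continuous_on (X i \<times> UNIV \<times> UNIV) (\<lambda>(x, u, v). N i x u v)" if i: "i \<in> beams net" for i
    unfolding N_def case_prod_unfold
    by (intro continuous_intros continuous_on_compose2[OF PQc[OF i]] continuous_on_compose2[OF cont1[OF L1[OF i]]]
        continuous_on_compose2[OF QLc[OF i]]) auto
  obtain cG where cG: "cG > 0" "\<And>u. norm (G_mat u) \<le> norm u * cG"
    using bounded_linear.pos_bounded[OF bounded_linear_G_mat] by blast
  have bnd: "\<exists>b>0. \<forall>i\<in>beams net. \<forall>x\<in>X i. norm (M i x) \<le> b"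
    if M: "\<And>i. i \<in> beams net \<Longrightarrow> continuous_on (X i) (M i)" for M :: "nat \<Rightarrow> real \<Rightarrow> mat12"
  proof (rule uniform_bound_family[of "beams net" X M])
    show "finite (beams net)" "\<And>i. i \<in> beams net \<Longrightarrow> compact (X i)" using fin Xc by auto
    fix b :: real assume "b > 0" "\<And>i p. i \<in> beams net \<Longrightarrow> p \<in> X i \<Longrightarrow> norm (M i p) \<le> b"
    then show ?thesis by blast
  qed (rule M)
  obtain bP where bP: "bP > 0" "\<And>i x. i \<in> beams net \<Longrightarrow> x \<in> X i \<Longrightarrow> norm (P i x) \<le> bP"
    using bnd[of P] cont1[OF P1] by blast
  obtain bL where bL: "bL > 0" "\<And>i x. i \<in> beams net \<Longrightarrow> x \<in> X i \<Longrightarrow> norm (L i x) \<le> bL"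
    using bnd[of L] cont1[OF L1] by blast
  obtain bL' where bL': "bL' > 0" "\<And>i x. i \<in> beams net \<Longrightarrow> x \<in> X i \<Longrightarrow> norm (L' i x) \<le> bL'"
    using bnd[of L'] L'(2) by blast
  obtain bA where bA: "bA > 0" "\<And>i x. i \<in> beams net \<Longrightarrow> x \<in> X i \<Longrightarrow> norm (A_mat net i x) \<le> bA"
    using bnd[of "A_mat net"] Ac by blast
  obtain bB where bB: "bB > 0" "\<And>i x. i \<in> beams net \<Longrightarrow> x \<in> X i \<Longrightarrow> norm (B_mat net i x) \<le> bB"
    using bnd[of "B_mat net"] Bc by blast
  obtain bQ where bQ: "bQ > 0" "\<And>i x. i \<in> beams net \<Longrightarrow> x \<in> X i \<Longrightarrow> norm (Q_mat net i x) \<le> bQ"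
    using bnd[of "Q_mat net"] Qc by blast
  obtain bQi where bQi: "bQi > 0" "\<And>i x. i \<in> beams net \<Longrightarrow> x \<in> X i \<Longrightarrow> norm (Qi i x) \<le> bQi"
    using bnd[of Qi] Qic by blast
  obtain bPQ where bPQ: "bPQ > 0" "\<And>i x. i \<in> beams net \<Longrightarrow> x \<in> X i \<Longrightarrow> norm (PQ i x) \<le> bPQ"
    using bnd[of PQ] PQc by blast
  obtain bQL where bQL: "bQL > 0" "\<And>i x. i \<in> beams net \<Longrightarrow> x \<in> X i \<Longrightarrow> norm (QL i x) \<le> bQL"
    using bnd[of QL] QLc by blast
  define \<nu> where "\<nu> = bPQ * (bL * cG) * bQL"
  have \<nu>: "\<nu> \<ge> 0" using bPQ bL cG bQL by (simp add: \<nu>_def)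
  have Nle: "norm (N i x u v) \<le> \<nu> * norm u * norm v" if ix: "i \<in> beams net" "x \<in> X i" for i x u v
  proof -
    have "norm (N i x u v) \<le> norm (PQ i x) * (norm (G_mat (L i x *v u)) * (norm (QL i x) * norm v))"
      unfolding N_def by (intro order_trans[OF norm_matrix_vector_le] mult_left_mono norm_matrix_vector_le) auto
    also have "\<dots> \<le> bPQ * (((bL * norm u) * cG) * (bQL * norm v))"
    proof (intro mult_mono bPQ(2) bQL(2) ix order_refl)
      have "norm (L i x *v u) * cG \<le> (bL * norm u) * cG"
        using cG(1) by (intro mult_right_mono order_trans[OF norm_matrix_vector_le] bL(2) ix) auto
      then show "norm (G_mat (L i x *v u)) \<le> (bL * norm u) * cG" using cG(2) order_trans by blast
    qed (use bPQ bL cG bQL in auto)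
    also have "\<dots> = \<nu> * norm u * norm v" by (simp add: \<nu>_def)
    finally show ?thesis .
  qed
  have "\<exists>(A :: nat \<Rightarrow> nat \<Rightarrow> nat \<Rightarrow> mat6) (Qm :: nat \<Rightarrow> nat \<Rightarrow> mat6). \<forall>w r p o'. (\<forall>n\<in>nodes net. \<forall>i\<in>incident net n.
        upper (w i (node_pos net n i)) = (1/2) *\<^sub>R (V i (node_pos net n i) *v (p n i + o' n i))
        \<and> node_sign net n i *\<^sub>R lower (w i (node_pos net n i)) = (1/2) *\<^sub>R (Z i (node_pos net n i) *v (p n i - o' n i)))
      \<longrightarrow> nodal_identities net w r = (\<forall>n\<in>nodes net. \<forall>i\<in>incident net n.
            p n i = Qm n i *v r n + (\<Sum>k\<in>incident net n. A n i k *v o' n k))"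
  proof (rule nodal_identities_scattering[where V = V and Vi = Vi and Z = Z and Zi = Zi], goal_cases)
    case (1 i x)
    then show ?case using diag by (auto simp: X_def)
  next
    case (2 Qm A)
    then show ?case by blast
  qed
  then obtain A :: "nat \<Rightarrow> nat \<Rightarrow> nat \<Rightarrow> mat6" and Qm :: "nat \<Rightarrow> nat \<Rightarrow> mat6" where
    scat_all: "\<forall>w r p o'. (\<forall>n\<in>nodes net. \<forall>i\<in>incident net n.
        upper (w i (node_pos net n i)) = (1/2) *\<^sub>R (V i (node_pos net n i) *v (p n i + o' n i))
        \<and> node_sign net n i *\<^sub>R lower (w i (node_pos net n i)) = (1/2) *\<^sub>R (Z i (node_pos net n i) *v (p n i - o' n i)))
      \<longrightarrow> nodal_identities net w r = (\<forall>n\<in>nodes net. \<forall>i\<in>incident net n.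
            p n i = Qm n i *v r n + (\<Sum>k\<in>incident net n. A n i k *v o' n k))" by (elim exE)
  have scat: "nodal_identities net w r \<longleftrightarrow> (\<forall>n\<in>nodes net. \<forall>i\<in>incident net n.
            p n i = Qm n i *v r n + (\<Sum>k\<in>incident net n. A n i k *v o' n k))"
    if "\<And>n i. n \<in> nodes net \<Longrightarrow> i \<in> incident net n \<Longrightarrow>
        upper (w i (node_pos net n i)) = (1/2) *\<^sub>R (V i (node_pos net n i) *v (p n i + o' n i))
        \<and> node_sign net n i *\<^sub>R lower (w i (node_pos net n i)) = (1/2) *\<^sub>R (Z i (node_pos net n i) *v (p n i - o' n i))"
    for w r p o'
    by (rule scat_all[rule_format]) (rule that)
  \<comment> \<open>Any common bound over nodes and beams will do, as \<open>\<kappa>0\<close> may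
    exceed 1. The cardinality 6 turns a bound on the components of a leaving wave into one on its
    norm.\<close>
  define \<kappa>0 where "\<kappa>0 = (\<Sum>n\<in>nodes net. \<Sum>i\<in>beams net. \<Sum>k\<in>beams net. norm (A n i k) * real CARD(3 + 3))"
  have \<kappa>0: "\<kappa>0 \<ge> 0" by (simp add: \<kappa>0_def sum_nonneg)
  have \<kappa>le: "(\<Sum>k\<in>incident net n. norm (A n i k) * real CARD(3 + 3)) \<le> \<kappa>0" if "n \<in> nodes net" "i \<in> beams net" for n i
  proof -
    have "(\<Sum>k\<in>incident net n. norm (A n i k) * real CARD(3 + 3)) \<le> (\<Sum>k\<in>beams net. norm (A n i k) * real CARD(3 + 3))"
      using fin by (intro sum_mono2) (auto simp: incident_def)
    also have "\<dots> \<le> (\<Sum>i\<in>beams net. \<Sum>k\<in>beams net. norm (A n i k) * real CARD(3 + 3))"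
      using fin that by (intro member_le_sum sum_nonneg) auto
    also have "\<dots> \<le> \<kappa>0"
      unfolding \<kappa>0_def using fin that by (intro member_le_sum sum_nonneg) auto
    finally show ?thesis .
  qed
  define bS where "bS = (\<Sum>n\<in>nodes net. \<Sum>i\<in>beams net. norm (Qm n i))"
  have bS: "bS \<ge> 0" by (simp add: bS_def sum_nonneg)
  have bSle: "norm (Qm n i) \<le> bS" if "n \<in> nodes net" "i \<in> beams net" for n i
  proof -
    have "norm (Qm n i) \<le> (\<Sum>i\<in>beams net. norm (Qm n i))"
      using fin that by (intro member_le_sum) auto
    also have "\<dots> \<le> bS" unfolding bS_def using fin that by (intro member_le_sum sum_nonneg) auto
    finally show ?thesis .
  qed
  \<comment> \<open>\<open>nd i m\<close> is the node at which component \<open>m\<close> enters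
    beam \<open>i\<close>: waves moving left enter at the end node, waves moving right at the
    initial node. Dually, \<open>ov\<close> selects the half of the components that leaves a beam at
    the given node.\<close>
  define nd where "nd i m = (case m of Inl _ \<Rightarrow> end_node net i | Inr _ \<Rightarrow> init_node net i)"
    for i and m :: "(3 + 3) + (3 + 3)"
  define ix where "ix m = (case m of Inl k \<Rightarrow> k | Inr k \<Rightarrow> k)" for m :: "(3 + 3) + (3 + 3)"
  define ov where "ov n o' k = (\<chi> \<kappa>. o' k (if init_node net k = n then Inl \<kappa> else Inr \<kappa>))"
    for n :: nat and o' :: "nat \<Rightarrow> (3 + 3) + (3 + 3) \<Rightarrow> real" and k
  have nd: "nd i m \<in> nodes net" if "i \<in> beams net" for i m
    using wf that by (auto simp: nd_def wf_network_def split: sum.split)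
  have ends: "init_node net i \<noteq> end_node net i" "init_node net i \<in> nodes net" "end_node net i \<in> nodes net"
    if "i \<in> beams net" for i
    using wf that by (auto simp: wf_network_def)
  let ?c = "\<lambda>i m x. wave_speed (D i x) m"
  obtain C0 where C0: "C0 > 0" and transport:
    "\<And>Bd r0 r0' w0 \<delta>. transport_problem (beams net) (len net) ?c sigma Bm N T \<kappa>0 Bd r0 r0' w0 \<delta> \<Longrightarrow> C0 * \<delta> \<le> 1
      \<Longrightarrow> \<exists>r w \<rho>. transport_solution (beams net) (len net) ?c sigma Bm N T Bd r0 (C0 * \<delta>) r w \<rho>"
  proof (rule transport_network_solution[where I = "beams net" and l = "len net" and T = T and ?\<kappa>0.0 = \<kappa>0
        and c = ?c and \<epsilon> = sigma and B = Bm and N = N and \<nu> = \<nu>, folded X_def])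
    show "continuous_on (X i) (\<lambda>x. wave_speed (D i x) m)" if "i \<in> beams net" for i m
      by (cases m) (auto simp: wave_speed_def intro!: continuous_intros Dc that)
    show "wave_speed (D i x) m > 0" if "i \<in> beams net" "x \<in> X i" for i m x
      using Dpos[OF that] by (auto simp: wave_speed_def split: sum.split)
    show "sigma m = 1 \<or> sigma m = -1" for m :: "(3 + 3) + (3 + 3)" by (auto simp: sigma_def split: sum.split)
  next
    fix C assume C: "C > 0" and *: "\<And>Bd r0 r0' w0 \<delta>. transport_problem (beams net) (len net) ?c sigma Bm N T \<kappa>0 Bd r0 r0' w0 \<delta>
      \<Longrightarrow> C * \<delta> \<le> 1 \<Longrightarrow> \<exists>r w \<rho>. transport_solution (beams net) (len net) ?c sigma Bm N T Bd r0 (C * \<delta>) r w \<rho>"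
    show thesis by (rule that[OF C], rule *)
  qed (use fin len_pos T \<kappa>0 Bmc Nbil Ncont Nle \<nu> in auto)
  \<comment> \<open>Conversion of the size of the data into that of the transport problem: the
    summands after 1 bound \<open>r0\<close>, \<open>w0\<close> and the inflow in the absence of
    leaving waves.\<close>
  define c1 where "c1 = 1 + bP + bP * (bA + bB + bQi * (cG * bQ)) + bS"
  have c1: "c1 \<ge> 1" "c1 \<ge> bP" "c1 \<ge> bP * (bA + bB + bQi * (cG * bQ))" "c1 \<ge> bS"
  proof -
    have "0 \<le> bP * (bA + bB + bQi * (cG * bQ))"
      using bP(1) bA(1) bB(1) bQi(1) cG(1) bQ(1) by (intro mult_nonneg_nonneg add_nonneg_nonneg) auto
    then show "c1 \<ge> 1" "c1 \<ge> bP" "c1 \<ge> bP * (bA + bB + bQi * (cG * bQ))" "c1 \<ge> bS"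
      using bP(1) bS unfolding c1_def by linarith+
  qed
  \<comment> \<open>The state and its time derivative cost \<open>bL\<close> each, the space
    derivative \<open>bL + bL'\<close>; hence the factor \<open>3 * bL + bL'\<close>.\<close>
  define C where "C = 1 + C0 * c1 + (3 * bL + bL') * (C0 * c1)"
  have C: "C \<ge> 1" "C \<ge> C0 * c1" "C \<ge> (3 * bL + bL') * (C0 * c1)"
  proof -
    have "0 \<le> C0 * c1" "0 \<le> (3 * bL + bL') * (C0 * c1)"
      using C0 c1(1) bL(1) bL'(1) by (auto intro!: mult_nonneg_nonneg add_nonneg_nonneg)
    then show "C \<ge> 1" "C \<ge> C0 * c1" "C \<ge> (3 * bL + bL') * (C0 * c1)" unfolding C_def by linarith+
  qed
  show thesis
  proof (rule that[of C])
    show "C > 0" using C(1) by simp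
    fix y0 :: "nat \<Rightarrow> real \<Rightarrow> vec12" and q :: "nat \<Rightarrow> real \<Rightarrow> vec6" and \<delta> :: real
    assume \<delta>: "\<delta> \<ge> 0" "C * \<delta> \<le> 1"
      and y0: "\<And>i. i \<in> beams net \<Longrightarrow> y0 i \<in> Ck 1 {0..len net i} UNIV" and q: "\<And>n. n \<in> nodes net \<Longrightarrow> q n \<in> Ck 1 {0..T} UNIV"
      and y0\<delta>: "\<And>i. i \<in> beams net \<Longrightarrow> C1_norm {0..len net i} (y0 i) \<le> \<delta>"
      and q\<delta>: "\<And>n. n \<in> nodes net \<Longrightarrow> C1_norm {0..T} (q n) \<le> \<delta>"
      and compat: "first_order_compatible net T y0 q"
    have \<delta>1: "\<delta> \<le> 1" "C0 * (c1 * \<delta>) \<le> 1"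
      using \<delta> mult_right_mono[OF C(1) \<delta>(1)] mult_right_mono[OF C(2) \<delta>(1)] by (auto simp: mult.assoc)
    define dy where "dy i x = vector_derivative (y0 i) (at x within X i)" for i x
    define q' where "q' n t = vector_derivative (q n) (at t within {0..T})" for n t
    have y0b: "norm (y0 i x) \<le> \<delta>" "norm (dy i x) \<le> \<delta>" "(y0 i has_vector_derivative dy i x) (at x within X i)"
      if "i \<in> beams net" "x \<in> X i" for i x
      using C1_norm_bounds(1-3)[OF len_pos[OF that(1)] y0[OF that(1)], of x] y0\<delta>[OF that(1)] that(2)
      by (auto simp: dy_def X_def)
    have dyc: "continuous_on (X i) (dy i)" if "i \<in> beams net" for i
      using C1_norm_bounds(4)[OF len_pos[OF that] y0[OF that], of 0] len_pos[OF that]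
      by (simp add: dy_def[abs_def] X_def)
    have y0c: "continuous_on (X i) (y0 i)" if "i \<in> beams net" for i
      using y0[OF that] unfolding X_def by (rule Ck_continuous_on)
    have qb: "norm (q' n t) \<le> \<delta>" "(q n has_vector_derivative q' n t) (at t within {0..T})"
      if "n \<in> nodes net" "t \<in> {0..T}" for n t
      using C1_norm_bounds(2,3)[OF T q[OF that(1)] that(2)] q\<delta>[OF that(1)] by (auto simp: q'_def)
    have qc: "continuous_on {0..T} (q' n)" if "n \<in> nodes net" for n
      using C1_norm_bounds(4)[OF T q[OF that], of 0] T by (simp add: q'_def[abs_def])
    define r0 where "r0 i x = P i x *v y0 i x" for i x
    define r0' where "r0' i x = P i x *v dy i x + P' i x *v y0 i x" for i x
    define y1 where "y1 i x = initial_velocity net y0 i x" for i x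
    define w0 where "w0 i x = P i x *v y1 i x" for i x
    have y1: "y1 i x = - (A_mat net i x *v dy i x) - B_mat net i x *v y0 i x + g_fun net i x (y0 i x)" for i x
      by (simp add: y1_def initial_velocity_def dy_def X_def)
    have r0der: "(r0 i has_vector_derivative r0' i x) (at x within X i)" if "i \<in> beams net" "x \<in> X i" for i x
      unfolding r0_def[abs_def] r0'_def
      by (rule bounded_bilinear.has_vector_derivative[OF bounded_bilinear_matrix_vector_mult P'(1)[OF that] y0b(3)[OF that]])
    \<comment> \<open>The product rule for \<open>y0 = L r0\<close>; it lets the initial velocity be
      rewritten as the transport equation at time 0.\<close>
    have dy: "dy i x = L i x *v r0' i x + L' i x *v r0 i x" if ix: "i \<in> beams net" "x \<in> X i" for i x
    proof -
      have "((\<lambda>x. L i x *v r0 i x) has_vector_derivative L i x *v r0' i x + L' i x *v r0 i x) (at x within X i)"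
        by (rule bounded_bilinear.has_vector_derivative[OF bounded_bilinear_matrix_vector_mult L'(1)[OF ix] r0der[OF ix]])
      then have "(y0 i has_vector_derivative L i x *v r0' i x + L' i x *v r0 i x) (at x within X i)"
        by (rule has_vector_derivative_transform_within[OF _ zero_less_one ix(2)]) (simp add: r0_def LP ix(1))
      from vector_derivative_within_cbox[OF len_pos[OF ix(1)] _ this[unfolded X_def cbox_interval[symmetric]]]
      show ?thesis using ix(2) by (simp add: dy_def X_def)
    qed
    have w0c: "continuous_on (X i) (w0 i)" if i: "i \<in> beams net" for i
    proof -
      have "continuous_on (X i) (\<lambda>x. Qi i x *v (G_mat (y0 i x) *v (Q_mat net i x *v y0 i x)))"
        by (intro continuous_intros Qic Qc y0c i)
      then have "continuous_on (X i) (\<lambda>x. g_fun net i x (y0 i x))"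
        by (rule continuous_on_eq) (simp add: g_fun_def Qinv i)
      then show ?thesis
        unfolding w0_def[abs_def] y1 by (intro continuous_intros cont1[OF P1] Ac Bc dyc y0c i)
    qed
    have r0b: "norm (r0 i x) \<le> c1 * \<delta>" if ix: "i \<in> beams net" "x \<in> X i" for i x
    proof -
      have "norm (r0 i x) \<le> bP * \<delta>"
        unfolding r0_def using bP(1) \<delta>
        by (intro order_trans[OF norm_matrix_vector_le] mult_mono bP(2) y0b ix) auto
      also have "\<dots> \<le> c1 * \<delta>" using c1 \<delta> by (intro mult_right_mono)
      finally show ?thesis .
    qed
    have w0b: "norm (w0 i x) \<le> c1 * \<delta>" if ix: "i \<in> beams net" "x \<in> X i" for i x
    proof -
      have a: "norm (A_mat net i x *v dy i x) \<le> bA * \<delta>" "norm (B_mat net i x *v y0 i x) \<le> bB * \<delta>"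
        using bA(1) bB(1) \<delta>
        by (intro order_trans[OF norm_matrix_vector_le] mult_mono bA(2) bB(2) y0b ix; auto)+
      have "norm (g_fun net i x (y0 i x)) \<le> norm (Qi i x) * (norm (G_mat (y0 i x)) * (norm (Q_mat net i x) * norm (y0 i x)))"
        unfolding g_fun_def Qinv[OF ix] by (intro order_trans[OF norm_matrix_vector_le] mult_left_mono norm_matrix_vector_le) auto
      \<comment> \<open>One factor of \<open>y0\<close> is estimated by
        \<open>\<delta> \<le> 1\<close>, so that the quadratic term is bounded linearly in
        \<open>\<delta>\<close>.\<close>
      also have "\<dots> \<le> bQi * ((1 * cG) * (bQ * \<delta>))"
      proof (intro mult_mono bQi(2) bQ(2) y0b ix)
        have "norm (y0 i x) * cG \<le> 1 * cG" using y0b(1)[OF ix] \<delta>1 cG(1) by (intro mult_right_mono) auto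
        then show "norm (G_mat (y0 i x)) \<le> 1 * cG" using cG(2) order_trans by blast
      qed (use bQi bQ cG \<delta> in auto)
      finally have g: "norm (g_fun net i x (y0 i x)) \<le> bQi * (cG * bQ) * \<delta>" by (simp add: mult_ac)
      have "norm (y1 i x) \<le> norm (A_mat net i x *v dy i x) + norm (B_mat net i x *v y0 i x) + norm (g_fun net i x (y0 i x))"
        unfolding y1 by (smt (verit) norm_minus_cancel norm_triangle_ineq norm_triangle_ineq4)
      also have "\<dots> \<le> (bA + bB + bQi * (cG * bQ)) * \<delta>" using a g by (simp add: algebra_simps)
      finally have "norm (w0 i x) \<le> bP * ((bA + bB + bQi * (cG * bQ)) * \<delta>)"
        unfolding w0_def using bP(1) by (intro order_trans[OF norm_matrix_vector_le] mult_mono bP(2) ix) auto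
      also have "\<dots> \<le> c1 * \<delta>" using mult_right_mono[OF c1(3) \<delta>(1)] by (simp add: mult.assoc)
      finally show ?thesis .
    qed
    have w0eq: "w0 i x $ m + sigma m * wave_speed (D i x) m * r0' i x $ m = (Bm i x *v r0 i x + N i x (r0 i x) (r0 i x)) $ m"
      if ix: "i \<in> beams net" "x \<in> X i" for i x m
    proof -
      have Lr0: "L i x *v r0 i x = y0 i x" by (simp add: r0_def LP[OF ix])
      have "w0 i x = P i x *v (- (A_mat net i x *v (L i x *v r0' i x)) - A_mat net i x *v (L' i x *v r0 i x)
          - B_mat net i x *v (L i x *v r0 i x) + g_fun net i x (L i x *v r0 i x))"
        unfolding w0_def y1 dy[OF ix] Lr0 by (simp add: matrix_vector_right_distrib algebra_simps)
      also have "\<dots> = - (P i x *v (L i x *v \<Lambda> i x (r0' i x))) + (Bm i x *v r0 i x + N i x (r0 i x) (r0 i x))"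
        unfolding AL[OF ix] Nu[OF ix] Bmu
        by (simp add: matrix_vector_right_distrib matrix_vector_mult_diff_distrib algebra_simps
            bounded_bilinear.minus_right[OF bounded_bilinear_matrix_vector_mult])
      finally have "w0 i x + \<Lambda> i x (r0' i x) = Bm i x *v r0 i x + N i x (r0 i x) (r0 i x)"
        by (simp add: PL[OF ix])
      from arg_cong[OF this, of "\<lambda>u. u $ m"] show ?thesis by (simp add: \<Lambda>_def)
    qed
    \<comment> \<open>The derivative of the nodal data appears because the boundary operator acts on
      time derivatives.\<close>
    define Bd where "Bd i m t o' = (Qm (nd i m) i *v q' (nd i m) t
        + (\<Sum>k\<in>incident net (nd i m). A (nd i m) i k *v ov (nd i m) o' k)) $ ix m" for i m t o'
    \<comment> \<open>The inflow conditions of the components and the scattering relations at the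
      nodes are the same equations, sorted by beam or by node: each component enters its beam at
      exactly one node.\<close>
    have Bd_iff: "(\<forall>i\<in>beams net. \<forall>m. W i (entrance (sigma m) (len net i)) $ m
          = Bd i m t (\<lambda>k m'. W k (exit_pos (sigma m') (len net k)) $ m'))
        \<longleftrightarrow> nodal_identities net (\<lambda>i x. L i x *v W i x) (\<lambda>n. q' n t)" for W t
    proof -
      define pin where "pin n i = (if init_node net i = n then lower (W i 0) else upper (W i (len net i)))" for n i
      define pout where "pout n i = (if init_node net i = n then upper (W i 0) else lower (W i (len net i)))" for n i
      have ovp: "ov n (\<lambda>k m'. W k (exit_pos (sigma m') (len net k)) $ m') k = pout n k" for n k
        by (simp add: ov_def pout_def vec_eq_iff exit_pos_def sigma_def upper_def lower_def)
      have "nodal_identities net (\<lambda>i x. L i x *v W i x) (\<lambda>n. q' n t) \<longleftrightarrow> (\<forall>n\<in>nodes net. \<forall>i\<in>incident net n.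
          pin n i = Qm n i *v q' n t + (\<Sum>k\<in>incident net n. A n i k *v pout n k))"
      proof (rule scat)
        fix n i
        show "upper (L i (node_pos net n i) *v W i (node_pos net n i))
            = (1/2) *\<^sub>R (V i (node_pos net n i) *v (pin n i + pout n i))
          \<and> node_sign net n i *\<^sub>R lower (L i (node_pos net n i) *v W i (node_pos net n i))
            = (1/2) *\<^sub>R (Z i (node_pos net n i) *v (pin n i - pout n i))"
          by (simp add: Lu pin_def pout_def node_pos_def node_sign_def add.commute matrix_vector_mult_diff_distrib
              scaleR_diff_right)
      qed
      also have "\<dots> \<longleftrightarrow> (\<forall>i\<in>beams net. \<forall>m. W i (entrance (sigma m) (len net i)) $ m
          = Bd i m t (\<lambda>k m'. W k (exit_pos (sigma m') (len net k)) $ m'))" (is "?S \<longleftrightarrow> ?B")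
      proof
        assume S: ?S
        show ?B
        proof (intro ballI allI)
          fix i m assume i: "i \<in> beams net"
          have "i \<in> incident net (nd i m)" using i by (auto simp: incident_def nd_def split: sum.split)
          then have "pin (nd i m) i $ ix m = Bd i m t (\<lambda>k m'. W k (exit_pos (sigma m') (len net k)) $ m')"
            using S nd[OF i, of m] by (simp add: Bd_def ovp)
          moreover have "pin (nd i m) i $ ix m = W i (entrance (sigma m) (len net i)) $ m"
            using ends(1)[OF i]
            by (auto simp: pin_def nd_def ix_def entrance_def sigma_def upper_def lower_def split: sum.split)
          ultimately show "W i (entrance (sigma m) (len net i)) $ m
              = Bd i m t (\<lambda>k m'. W k (exit_pos (sigma m') (len net k)) $ m')" by simp
        qed
      next
        assume B: ?B
        show ?S
        proof (intro ballI)
          fix n i assume n: "n \<in> nodes net" and inc: "i \<in> incident net n"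
          then have i: "i \<in> beams net" by (simp add: incident_def)
          show "pin n i = Qm n i *v q' n t + (\<Sum>k\<in>incident net n. A n i k *v pout n k)"
            unfolding vec_eq_iff
          proof
            fix \<kappa> :: "3 + 3"
            define m :: "(3 + 3) + (3 + 3)" where "m = (if init_node net i = n then Inr \<kappa> else Inl \<kappa>)"
            have m: "nd i m = n" "ix m = \<kappa>" using inc by (auto simp: m_def nd_def ix_def incident_def)
            have "pin n i $ \<kappa> = W i (entrance (sigma m) (len net i)) $ m"
              by (simp add: pin_def m_def entrance_def sigma_def upper_def lower_def)
            also have "\<dots> = Bd i m t (\<lambda>k m'. W k (exit_pos (sigma m') (len net k)) $ m')" using B i by blast
            also have "\<dots> = (Qm n i *v q' n t + (\<Sum>k\<in>incident net n. A n i k *v pout n k)) $ \<kappa>"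
              by (simp only: Bd_def m ovp)
            finally show "pin n i $ \<kappa> = (Qm n i *v q' n t + (\<Sum>k\<in>incident net n. A n i k *v pout n k)) $ \<kappa>" .
          qed
        qed
      qed
      finally show ?thesis by (rule sym)
    qed
    have "transport_problem (beams net) (len net) ?c sigma Bm N T \<kappa>0 Bd r0 r0' w0 (c1 * \<delta>)"
    proof (intro transport_problem.intro r0der[unfolded X_def] w0c[unfolded X_def] r0b[unfolded X_def]
        w0b[unfolded X_def] w0eq[unfolded X_def])
      show "0 \<le> c1 * \<delta>" using c1 \<delta> by simp
    next
      fix o' :: "nat \<Rightarrow> (3 + 3) + (3 + 3) \<Rightarrow> real \<Rightarrow> real" and i and m :: "(3 + 3) + (3 + 3)"
      assume o': "\<And>k m'. k \<in> beams net \<Longrightarrow> continuous_on {0..T} (o' k m')" and i: "i \<in> beams net"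
      have "continuous_on {0..T} (\<lambda>t. ov (nd i m) (\<lambda>k m'. o' k m' t) k)" if "k \<in> incident net (nd i m)" for k
        unfolding ov_def using that by (intro continuous_on_vec_lambda o') (simp add: incident_def)
      then show "continuous_on {0..T} (\<lambda>t. Bd i m t (\<lambda>k m'. o' k m' t))"
        unfolding Bd_def
        by (intro continuous_on_component continuous_on_add continuous_on_sum continuous_on_matrix_vector_mult
            continuous_on_const qc nd i)
    next
      fix i t M and m :: "(3 + 3) + (3 + 3)" and o1 o2 :: "nat \<Rightarrow> (3 + 3) + (3 + 3) \<Rightarrow> real"
      assume i: "i \<in> beams net" and o12: "\<And>k m'. k \<in> beams net \<Longrightarrow> \<bar>o1 k m' - o2 k m'\<bar> \<le> M"
      let ?n = "nd i m"
      have "M \<ge> 0" using o12[OF i] abs_ge_zero order_trans by blast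
      have "Bd i m t o1 - Bd i m t o2 = (\<Sum>k\<in>incident net ?n. A ?n i k *v (ov ?n o1 k - ov ?n o2 k)) $ ix m"
        by (simp add: Bd_def matrix_vector_mult_diff_distrib sum_subtractf)
      also have "\<bar>\<dots>\<bar> \<le> norm (\<Sum>k\<in>incident net ?n. A ?n i k *v (ov ?n o1 k - ov ?n o2 k))"
        by (rule component_le_norm_cart)
      also have "\<dots> \<le> (\<Sum>k\<in>incident net ?n. norm (A ?n i k) * real CARD(3 + 3) * M)"
      proof (intro sum_norm_le)
        fix k assume "k \<in> incident net ?n"
        then have k: "k \<in> beams net" by (simp add: incident_def)
        have "norm (ov ?n o1 k - ov ?n o2 k) \<le> real CARD(3 + 3) * M"
          by (rule norm_vec_le_card) (simp add: ov_def o12[OF k])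
        then show "norm (A ?n i k *v (ov ?n o1 k - ov ?n o2 k)) \<le> norm (A ?n i k) * real CARD(3 + 3) * M"
          unfolding mult.assoc by (intro order_trans[OF norm_matrix_vector_le] mult_left_mono) auto
      qed
      also have "\<dots> = (\<Sum>k\<in>incident net ?n. norm (A ?n i k) * real CARD(3 + 3)) * M" by (simp only: sum_distrib_right)
      also have "\<dots> \<le> \<kappa>0 * M" using \<open>M \<ge> 0\<close> by (intro mult_right_mono \<kappa>le nd i)
      finally show "\<bar>Bd i m t o1 - Bd i m t o2\<bar> \<le> \<kappa>0 * M" .
    next
      fix i t and m :: "(3 + 3) + (3 + 3)" assume i: "i \<in> beams net" and t: "t \<in> {0..T}"
      have "ov n (\<lambda>_ _. 0) k = 0" for n k by (simp add: ov_def vec_eq_iff)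
      then have "\<bar>Bd i m t (\<lambda>_ _. 0)\<bar> \<le> norm (Qm (nd i m) i *v q' (nd i m) t)"
        using component_le_norm_cart[of "Qm (nd i m) i *v q' (nd i m) t" "ix m"] by (simp add: Bd_def)
      also have "\<dots> \<le> bS * \<delta>"
        using bS \<delta> by (intro order_trans[OF norm_matrix_vector_le] mult_mono bSle nd i qb t) auto
      also have "\<dots> \<le> c1 * \<delta>" using c1 \<delta> by (intro mult_right_mono)
      finally show "\<bar>Bd i m t (\<lambda>_ _. 0)\<bar> \<le> c1 * \<delta>" .
    next
      fix i and m :: "(3 + 3) + (3 + 3)" assume i: "i \<in> beams net"
      \<comment> \<open>Here the compatibility conditions on the initial velocity and the derivative
        of the nodal data are used; those on \<open>y0\<close> and \<open>q\<close> at time 0 serve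
        in \<open>y0_nodal\<close>.\<close>
      have "nodal_identities net y1 (\<lambda>n. q' n 0)"
        using compat by (simp add: first_order_compatible_def y1_def[abs_def] q'_def)
      then have "nodal_identities net (\<lambda>i x. L i x *v w0 i x) (\<lambda>n. q' n 0)"
        by (subst nodal_identities_cong[of _ y1]) (auto simp: w0_def X_def[symmetric] LP simp del: atLeastAtMost_iff)
      then show "Bd i m 0 (\<lambda>k m'. w0 k (exit_pos (sigma m') (len net k)) $ m')
          = w0 i (entrance (sigma m) (len net i)) $ m"
        using Bd_iff[of w0 0] i by simp
    qed
    from transport[OF this \<delta>1(2)] obtain r w \<rho>
      where "transport_solution (beams net) (len net) ?c sigma Bm N T Bd r0 (C0 * (c1 * \<delta>)) r w \<rho>" by blast
    then interpret sol: transport_solution "beams net" "len net" ?c sigma Bm N T Bd r0 "C0 * (c1 * \<delta>)" r w \<rho> .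
    note rc = sol.rc[folded X_def] and wc = sol.wc[folded X_def] and \<rho>c = sol.\<rho>c[folded X_def]
      and rt = sol.rt[folded X_def] and rx = sol.rx[folded X_def] and pde = sol.pde[folded X_def]
      and rb = sol.rb[folded X_def] and r_0 = sol.r_0[folded X_def] and bc = sol.bc
    define y where "y i p = L i (fst p) *v r i p" for i p
    define yx where "yx i p = L i (fst p) *v \<rho> i p + L' i (fst p) *v r i p" for i p
    define yt where "yt i p = L i (fst p) *v w i p" for i p
    have fstc: "continuous_on (X i \<times> {0..T}) (\<lambda>p. M (fst p))" if "continuous_on (X i) M"
      for i and M :: "real \<Rightarrow> mat12"
      by (rule continuous_on_compose2[OF that]) (auto intro!: continuous_intros)
    have yc: "continuous_on (X i \<times> {0..T}) (y i)" "continuous_on (X i \<times> {0..T}) (yx i)" "continuous_on (X i \<times> {0..T}) (yt i)"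
      if i: "i \<in> beams net" for i
      unfolding y_def[abs_def] yx_def[abs_def] yt_def[abs_def]
      by (intro continuous_on_add continuous_on_matrix_vector_mult fstc cont1[OF L1] L' rc wc \<rho>c i)+
    have ydx: "((\<lambda>x. y i (x, t)) has_vector_derivative yx i (x, t)) (at x within X i)"
      and ydt: "((\<lambda>t. y i (x, t)) has_vector_derivative yt i (x, t)) (at t within {0..T})"
      if ix: "i \<in> beams net" "x \<in> X i" "t \<in> {0..T}" for i x t
      unfolding y_def yx_def yt_def fst_conv
      by (rule bounded_bilinear.has_vector_derivative[OF bounded_bilinear_matrix_vector_mult L'(1)[OF ix(1,2)] rx[OF ix]],
          rule bounded_linear.has_vector_derivative[OF matrix_vector_mul_bounded_linear rt[OF ix]])
    note yI = C1_xtI[OF len_pos T yc[unfolded X_def] ydx[unfolded X_def] ydt[unfolded X_def]]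
    have y_C1: "y i \<in> C1_xt (len net i) T" if i: "i \<in> beams net" for i
      by (rule yI(1)[OF i i i i]) (rule i | assumption)+
    have y_px: "partial_x (len net i) (y i) (x, t) = yx i (x, t)" and y_pt: "partial_t T (y i) (x, t) = yt i (x, t)"
      if i: "i \<in> beams net" and xt: "x \<in> X i" "t \<in> {0..T}" for i x t
    proof -
      show "partial_x (len net i) (y i) (x, t) = yx i (x, t)"
        by (rule yI(2)[OF i i i i]) (use i xt in \<open>auto simp: X_def\<close>)
      show "partial_t T (y i) (x, t) = yt i (x, t)"
        by (rule yI(3)[OF i i i i]) (use i xt in \<open>auto simp: X_def\<close>)
    qed
    have y_norm: "C1_xt_norm (len net i) T (y i) \<le> C * \<delta>" if i: "i \<in> beams net" for i
    proof -
      let ?b = "C0 * (c1 * \<delta>)"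
      have b: "norm (L i x *v u) \<le> bL * ?b" "norm (L' i x *v u) \<le> bL' * ?b" if "x \<in> X i" "norm u \<le> ?b" for x u
        using bL(1) bL'(1) order_trans[OF norm_ge_zero that(2)]
        by (intro order_trans[OF norm_matrix_vector_le] mult_mono bL(2) bL'(2) i that; simp)+
      have "C1_xt_norm (len net i) T (y i) \<le> bL * ?b + (bL * ?b + bL' * ?b) + bL * ?b"
      proof (rule C1_xt_norm_le[OF len_pos[OF i] T])
        fix p assume p: "p \<in> {0..len net i} \<times> {0..T}"
        then obtain x t where xt: "p = (x, t)" "x \<in> X i" "t \<in> {0..T}" by (auto simp: X_def)
        show "norm (y i p) \<le> bL * ?b" unfolding y_def xt fst_conv by (intro b rb i xt)
        show "norm (partial_x (len net i) (y i) p) \<le> bL * ?b + bL' * ?b"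
          unfolding xt y_px[OF i xt(2,3)] yx_def fst_conv
          by (intro order_trans[OF norm_triangle_ineq] add_mono b rb i xt)
        show "norm (partial_t T (y i) p) \<le> bL * ?b"
          unfolding xt y_pt[OF i xt(2,3)] yt_def fst_conv by (intro b rb i xt)
      qed
      also have "\<dots> = (3 * bL + bL') * (C0 * c1) * \<delta>" by (simp add: algebra_simps)
      also have "\<dots> \<le> C * \<delta>" by (rule mult_right_mono[OF C(3) \<delta>(1)])
      finally show ?thesis .
    qed
    have y_pde: "yt i (x, t) + A_mat net i x *v yx i (x, t) + B_mat net i x *v y i (x, t) = g_fun net i x (y i (x, t))"
      if ix: "i \<in> beams net" "x \<in> X i" "t \<in> {0..T}" for i x t
    proof -
      have "w i (x, t) + \<Lambda> i x (\<rho> i (x, t)) = Bm i x *v r i (x, t) + N i x (r i (x, t)) (r i (x, t))"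
        using pde[OF ix] by (simp add: vec_eq_iff \<Lambda>_def)
      then have "L i x *v (w i (x, t) + \<Lambda> i x (\<rho> i (x, t)))
          = L i x *v (Bm i x *v r i (x, t) + N i x (r i (x, t)) (r i (x, t)))" by simp
      then have "L i x *v w i (x, t) + A_mat net i x *v (L i x *v \<rho> i (x, t))
          = - (B_mat net i x *v (L i x *v r i (x, t)) + A_mat net i x *v (L' i x *v r i (x, t)))
            + g_fun net i x (L i x *v r i (x, t))"
        unfolding Bmu Nu[OF ix(1,2)]
        by (simp only: matrix_vector_right_distrib bounded_bilinear.minus_right[OF bounded_bilinear_matrix_vector_mult]
            LP[OF ix(1,2)] AL[OF ix(1,2)])
      then show ?thesis
        by (simp add: yt_def yx_def y_def matrix_vector_right_distrib algebra_simps)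
    qed
    have y_0: "y i (x, 0) = y0 i x" if "i \<in> beams net" "x \<in> X i" for i x
      by (simp add: y_def r_0[OF that] r0_def LP[OF that])
    have yt_nodal: "nodal_identities net (\<lambda>i x. yt i (x, t)) (\<lambda>n. q' n t)" if t: "t \<in> {0..T}" for t
      using Bd_iff[of "\<lambda>i x. w i (x, t)" t] bc t by (simp add: yt_def)
    have y0_nodal: "nodal_identities net (\<lambda>i x. y i (x, 0)) (\<lambda>n. q n 0)"
    proof (subst nodal_identities_cong[of _ y0])
      show "nodal_identities net y0 (\<lambda>n. q n 0)" using compat by (simp add: first_order_compatible_def)
    qed (use y_0 in \<open>simp add: X_def\<close>)
    have y_nodal: "nodal_identities net (\<lambda>i x. y i (x, t)) (\<lambda>n. q n t)" if t: "t \<in> {0..T}" for t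
      by (rule nodal_identities_integrate[OF ydt[unfolded X_def] qb(2) y0_nodal yt_nodal t])
    have "solves_system net T y0 q y"
      unfolding solves_system_iff
    proof (intro conjI ballI)
      fix i x t assume "i \<in> beams net" "x \<in> {0<..<len net i}" "t \<in> {0<..<T}"
      then have ix: "i \<in> beams net" "x \<in> X i" "t \<in> {0..T}" by (auto simp: X_def)
      show "partial_t T (y i) (x, t) + A_mat net i x *v partial_x (len net i) (y i) (x, t)
        + B_mat net i x *v y i (x, t) = g_fun net i x (y i (x, t))"
        unfolding y_px[OF ix] y_pt[OF ix] by (rule y_pde[OF ix])
    next
      fix t assume "t \<in> {0<..<T}"
      then show "nodal_identities net (\<lambda>i x. y i (x, t)) (\<lambda>n. q n t)" by (intro y_nodal) auto
    next
      fix i x assume "i \<in> beams net" "x \<in> {0<..<len net i}"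
      then show "y i (x, 0) = y0 i x" by (intro y_0) (auto simp: X_def)
    qed
    then show "\<exists>y. (\<forall>i\<in>beams net. y i \<in> C1_xt (len net i) T \<and> C1_xt_norm (len net i) T (y i) \<le> C * \<delta>)
        \<and> solves_system net T y0 q y"
      using y_C1 y_norm by blast
  qed
qed

end

theorem theorem3p2p2:
  fixes net :: beam_network and T :: real
  assumes "wf_network net"
    and "\<forall>i\<in>beams net. rot net i \<in> Ck 2 {0..len net i} SO3"
    and "assumption1 2 net"
    and "T > 0"
  shows "\<exists>\<epsilon>0>0. \<forall>\<epsilon>\<in>{0<..<\<epsilon>0}. \<exists>\<delta>>0.
    \<forall>(y0 :: nat \<Rightarrow> real \<Rightarrow> vec12) (q :: nat \<Rightarrow> real \<Rightarrow> vec6).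
      (\<forall>i\<in>beams net. y0 i \<in> Ck 1 {0..len net i} UNIV)
    \<and> (\<forall>n\<in>nodes net. q n \<in> Ck 1 {0..T} UNIV)
    \<and> (\<forall>i\<in>beams net. \<forall>n\<in>nodes net.
          C1_norm {0..len net i} (y0 i) + C1_norm {0..T} (q n) \<le> \<delta>)
    \<and> first_order_compatible net T y0 q
    \<longrightarrow> (\<exists>y :: nat \<Rightarrow> real \<times> real \<Rightarrow> vec12.
            (\<forall>i\<in>beams net. y i \<in> C1_xt (len net i) T)
          \<and> solves_system net T y0 q y
          \<and> (\<forall>y'. (\<forall>i\<in>beams net. y' i \<in> C1_xt (len net i) T) \<and> solves_system net T y0 q y'
                \<longrightarrow> (\<forall>i\<in>beams net. \<forall>p\<in>{0..len net i} \<times> {0..T}. y' i p = y i p))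
          \<and> (\<forall>i\<in>beams net. C1_xt_norm (len net i) T (y i) \<le> \<epsilon>))"
proof (cases "beams net = {}")
  case True
  \<comment> \<open>Without beams the smallness assumption is void, since it ranges over pairs of a
    beam and a node; but so are all equations and nodal conditions, and every family is a
    solution.\<close>
  have inc: "incident net n = {}" for n using True by (simp add: incident_def)
  have "solves_system net T y0 q y" for y0 q y
    using assms(1) True inc
    by (auto simp: solves_system_iff nodal_identities_iff multiple_nodes_def simple_nodes_def degree_def wf_network_def)
  then show ?thesis using True by (intro exI[of _ 1]) (auto intro!: exI[of _ 1])
next
  case False
  interpret regular_network net using assms by unfold_locales auto
  show ?thesis
  proof (rule solution_exists[OF assms(4)])
    fix C assume C: "C > 0" and sol: "\<And>y0 q \<delta>.
      \<lbrakk>\<delta> \<ge> 0; C * \<delta> \<le> 1;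
       \<And>i. i \<in> beams net \<Longrightarrow> y0 i \<in> Ck 1 {0..len net i} UNIV; \<And>n. n \<in> nodes net \<Longrightarrow> q n \<in> Ck 1 {0..T} UNIV;
       \<And>i. i \<in> beams net \<Longrightarrow> C1_norm {0..len net i} (y0 i) \<le> \<delta>; \<And>n. n \<in> nodes net \<Longrightarrow> C1_norm {0..T} (q n) \<le> \<delta>;
       first_order_compatible net T y0 q\<rbrakk>
      \<Longrightarrow> \<exists>y. (\<forall>i\<in>beams net. y i \<in> C1_xt (len net i) T \<and> C1_xt_norm (len net i) T (y i) \<le> C * \<delta>)
            \<and> solves_system net T y0 q y"
    \<comment> \<open>The smallness assumption bounds a sum for each pair of a beam and a node. With
      one beam and one node at hand, nonnegativity of the norms separates it into a bound for each
      datum.\<close>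
    obtain i0 where i0: "i0 \<in> beams net" using False by blast
    have n0: "init_node net i0 \<in> nodes net" using wf i0 by (auto simp: wf_network_def)
    show ?thesis
    proof (rule exI[of _ 1], intro conjI ballI)
      show "(1::real) > 0" by simp
      fix \<epsilon> :: real assume \<epsilon>: "\<epsilon> \<in> {0<..<1}"
      \<comment> \<open>By linearity of the estimate this choice makes the bound exactly
        \<open>\<epsilon>\<close>, and \<open>\<epsilon> < 1\<close> ensures
        \<open>C * \<delta> \<le> 1\<close>.\<close>
      define \<delta> where "\<delta> = \<epsilon> / C"
      have \<delta>: "\<delta> > 0" "C * \<delta> = \<epsilon>" using \<epsilon> C by (auto simp: \<delta>_def)
      show "\<exists>\<delta>>0. \<forall>(y0 :: nat \<Rightarrow> real \<Rightarrow> vec12) (q :: nat \<Rightarrow> real \<Rightarrow> vec6).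
          (\<forall>i\<in>beams net. y0 i \<in> Ck 1 {0..len net i} UNIV)
        \<and> (\<forall>n\<in>nodes net. q n \<in> Ck 1 {0..T} UNIV)
        \<and> (\<forall>i\<in>beams net. \<forall>n\<in>nodes net.
              C1_norm {0..len net i} (y0 i) + C1_norm {0..T} (q n) \<le> \<delta>)
        \<and> first_order_compatible net T y0 q
        \<longrightarrow> (\<exists>y :: nat \<Rightarrow> real \<times> real \<Rightarrow> vec12.
                (\<forall>i\<in>beams net. y i \<in> C1_xt (len net i) T)
              \<and> solves_system net T y0 q y
              \<and> (\<forall>y'. (\<forall>i\<in>beams net. y' i \<in> C1_xt (len net i) T) \<and> solves_system net T y0 q y'
                    \<longrightarrow> (\<forall>i\<in>beams net. \<forall>p\<in>{0..len net i} \<times> {0..T}. y' i p = y i p))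
              \<and> (\<forall>i\<in>beams net. C1_xt_norm (len net i) T (y i) \<le> \<epsilon>))"
      proof (rule exI[of _ \<delta>], intro conjI allI impI \<delta>(1), elim conjE)
        fix y0 :: "nat \<Rightarrow> real \<Rightarrow> vec12" and q :: "nat \<Rightarrow> real \<Rightarrow> vec6"
        assume y0: "\<forall>i\<in>beams net. y0 i \<in> Ck 1 {0..len net i} UNIV"
          and q: "\<forall>n\<in>nodes net. q n \<in> Ck 1 {0..T} UNIV"
          and small: "\<forall>i\<in>beams net. \<forall>n\<in>nodes net. C1_norm {0..len net i} (y0 i) + C1_norm {0..T} (q n) \<le> \<delta>"
          and compat: "first_order_compatible net T y0 q"
        have y0pos: "0 \<le> C1_norm {0..len net i} (y0 i)" if "i \<in> beams net" for i
          by (rule order_trans[OF norm_ge_zero C1_norm_bounds(1)[of 0 _ _ 0]]) (use len_pos[OF that] y0 that in auto)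
        have qpos: "0 \<le> C1_norm {0..T} (q n)" if "n \<in> nodes net" for n
          by (rule order_trans[OF norm_ge_zero C1_norm_bounds(1)[of 0 _ _ 0]]) (use assms(4) q that in auto)
        have "\<exists>y. (\<forall>i\<in>beams net. y i \<in> C1_xt (len net i) T \<and> C1_xt_norm (len net i) T (y i) \<le> C * \<delta>)
            \<and> solves_system net T y0 q y"
        proof (rule sol[OF less_imp_le[OF \<delta>(1)]])
          show "C * \<delta> \<le> 1" using \<delta>(2) \<epsilon> by simp
          show "C1_norm {0..len net i} (y0 i) \<le> \<delta>" if "i \<in> beams net" for i
            using small that n0 qpos[OF n0] by fastforce
          show "C1_norm {0..T} (q n) \<le> \<delta>" if "n \<in> nodes net" for n
            using small that i0 y0pos[OF i0] by fastforce
        qed (use y0 q compat in auto)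
        then obtain y where y: "\<And>i. i \<in> beams net \<Longrightarrow> y i \<in> C1_xt (len net i) T"
          "\<And>i. i \<in> beams net \<Longrightarrow> C1_xt_norm (len net i) T (y i) \<le> \<epsilon>" "solves_system net T y0 q y"
          unfolding \<delta>(2) by blast
        have "y' i p = y i p" if "\<forall>i\<in>beams net. y' i \<in> C1_xt (len net i) T" "solves_system net T y0 q y'"
          "i \<in> beams net" "p \<in> {0..len net i} \<times> {0..T}" for y' i p
          by (rule solution_unique[OF assms(4) _ that(2) y(1,3) that(3,4)]) (use that(1) in blast)
        then show "\<exists>y. (\<forall>i\<in>beams net. y i \<in> C1_xt (len net i) T)
              \<and> solves_system net T y0 q y
              \<and> (\<forall>y'. (\<forall>i\<in>beams net. y' i \<in> C1_xt (len net i) T) \<and> solves_system net T y0 q y'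
                    \<longrightarrow> (\<forall>i\<in>beams net. \<forall>p\<in>{0..len net i} \<times> {0..T}. y' i p = y i p))
              \<and> (\<forall>i\<in>beams net. C1_xt_norm (len net i) T (y i) \<le> \<epsilon>)"
          using y by blast
      qed
    qed
  qed
qed

end
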